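(* Let $K$ be a field of characteristic zero, let $X=X_j\subset Z=Z_j$ be the $j$-th stage of a desingularization process as in the context, let $x\in X$ with $\widehat{\mathcal O}_{X,x}\cong R/J$, $R=K[[T_1,\dots,T_n]]$, and let $\mathrm{inv}_X(x)=(\nu_1,s_1;\nu_2,s_2;\dots;\nu_t,s_t;\nu_{t+1})$ be the invariant of Bierstone and Milman, constructed as in the context. Let $r\in\{1,\dots,t\}$ and consider the pair with history $(\mathcal F_r,\mathcal E_r)$ on $N_{r-1}=V(y_1,\dots,y_{r-1})$ occurring in this construction. Let $(u,y_r)=(u_1,\dots,u_e;y_r)$ be the remaining part of the regular system of parameters for $R$ (i.e. $(u,y_1,\dots,y_r)$ is a regular system of parameters of $R$, adapted to $\mathcal E_r$), where $y_r$ is the parameter defining the next hypersurface of maximal contact $N_r=V(y_1,\dots,y_r)$ in $N_{r-1}$ used in the construction. Then: (1) $\mu_{r+1}=\delta(\Delta(\mathcal F_r,u,y_r))$. (2) Let $\mathcal E_{r,N_r}=\{(H_1,d_1),\dots,(H_k,d_k)\}$ be the exceptional data of $(\mathcal F_r,\mathcal E_r)$ on $N_r$. Then the entry $\nu_{r+1}=\nu_{r+1}(x)$ of $\mathrm{inv}_X(x)$ is equal to the number coming from the polyhedron $\Delta(\mathcal F_r,u,y_r)$: $$\nu_{r+1}=\nu(\mathcal F_r,\mathcal E_{r,N_r},u)=\delta(\Delta(\mathcal F_r,u,y_r))-\sum_{i=1}^k d_i .$$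
   Context: **Pairs.** Let $S$ be a formal power series ring over $K$ in finitely many variables with maximal ideal $M$ (below $S=R$, or $S$ is the coordinate ring of a regular closed subscheme $N=V(y_1,\dots,y_s)\subset\mathrm{Spec}(R)$ with $(y)$ part of a regular system of parameters; we then say "pair on $N$", and $M$ also denotes the maximal ideal of the quotient). A pair on $S$ is $\mathbb E=(J,b)$ with $J\subset S$ a nonzero ideal and $b\in\mathbb Q_+$; $(f,b):=(\langle f\rangle,b)$. $\mathrm{Sing}(\mathbb E)=\{P\in \mathrm{Spec}(S): \mathrm{ord}_P(J)\ge b\}$. Intersection: $(J_1,b_1)\cap(J_2,b_2)=(J_1^{c/b_1}+J_2^{c/b_2},c)$ with $c=\mathrm{lcm}(b_1,b_2)$. Components with zero ideal are omitted. **Equivalence.** A blow-up with center $D$ is permissible for $\mathbb E$ if $D$ is regular and $D\subseteq\mathrm{Sing}(\mathbb E)$; the transform is $(J',b)$ with $J\mathcal O=J'H^b$, $H$ the ideal of the exceptional divisor. $\mathbb E_1\sim\mathbb E_2$ means: for every finite list of indeterminates $\xi$, after replacing $Z=\mathrm{Spec}(S)$ by $Z\times_{\mathrm{Spec}\,\mathbb Z}\mathrm{Spec}\,\mathbb Z[\xi]$ and extending the ideals, a finite local sequence of blow-ups (at each stage restrict to an open subset, then blow up a regular center) is permissible for $\mathbb E_1$ and its successive transforms if and only if it is permissible for $\mathbb E_2$ and its successive transforms. $V(z)$ has maximal contact with $\mathbb E$ if $\mathbb E\sim(z,1)\cap\mathbb E$. **Coefficient pair.** For a regular system of parameters $(u,z)=(u_1,\dots,u_d;z_1,\dots,z_s)$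 of $S$ and $f\in J$ write $f=\sum_{|B|<b}f_B(u)z^B+h$ with $h\in\langle z\rangle^b$; $\mathbb D(\mathbb E,u,z):=\bigcap_{f\in J}\bigcap_{|B|<b}(f_B(u),b-|B|)$, a pair on $S/\langle z\rangle$. **Polyhedra.** For $\mathbb E=(J,b)$ with $J=\langle f_1,\dots,f_m\rangle$, $f_i=\sum C_{A,B,i}u^Ay^B$ with $C_{A,B,i}\in S^\times\cup\{0\}$ (finite expansion, minimal number of terms), the projected polyhedron $\Delta(\mathbb E,u,y)\subseteq\mathbb R^d_{\ge0}$ is the smallest closed convex set containing all $\frac{A}{b-|B|}+\mathbb R^d_{\ge0}$ with $C_{A,B,i}\ne0$, $|B|<b$ (independent of the generators; for an intersection of pairs it is the smallest closed convex set containing the individual polyhedra). $\delta(\Delta):=\inf\{|v|=v_1+\dots+v_d: v\in\Delta\}$, $\delta(\mathbb E,u,y):=\delta(\Delta(\mathbb E,u,y))$, $d_i(\mathbb E,u,y):=\inf\{v_i: v\in\Delta(\mathbb E,u,y)\}$. $\Delta(\mathbb E,u):=\bigcap_{(y)}\Delta(\mathbb E,u,y)$ over all $(y)$ extending $(u)$ to a regular system of parameters, and $\delta(\mathbb E,u):=\delta(\Delta(\mathbb E,u))$. **Directrix.** For $x\in\mathrm{Sing}(\mathbb E)$, $\mathrm{in}_M(\mathbb E)\subset\mathrm{gr}_M(S)$ is the ideal generated by all $f \bmod M^{b+1}$, $f\in J$ (zero if $b\notin\mathbb Z$); $\mathrm{Dir}_M(\mathbb E)$ is defined by a minimal list of linear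 forms $Y_1,\dots,Y_r$ such that $\mathrm{in}_M(\mathbb E)$ is generated by elements of $K[Y_1,\dots,Y_r]$. A system $(y)$ defines the directrix if its initial forms do. **Pairs with history.** Let $E$ be a finite set of irreducible divisors with simple normal crossings, and $(u,y)=(u_1,\dots,u_d;y_1,\dots,y_s)$ a regular system of parameters such that $(y,u_{e'+1},\dots,u_d)$, $e'\le d$, defines the directrix of $\mathbb E$, adapted to $E$: each $H\in E$ with $x\in H$, $V(y)\not\subset H$ is given by $u_{j(H)}=0$ on $V(y)$. The exceptional data on $V(y)$ is the map $\mathcal E:E\to\mathbb R_{\ge0}$ with $\mathcal E(H)=d_{j(H)}(\mathbb E,u,y)$ if $x\in H$ and $V(y)\not\subset H$, and $\mathcal E(H)=0$ otherwise. $(\mathbb E,\mathcal E)$ is a pair with history. Define $\nu(\mathbb E,\mathcal E,u,y):=\delta(\mathbb E,u)-\sum_{H\in E}\mathcal E(H)$ if $e'=d$, and $:=\delta(\mathbb E,u,y)-\sum_{H\in E}\mathcal E(H)$ if $e'<d$ ($:=\infty$ if the polyhedron is empty); it is also written $\nu(\mathbb E,\mathcal E,u)$, being independent of $y$. A set of exceptional divisors is identified with the exceptional data it defines. **The invariant.** $X_0\subset Z_0$ is a scheme embedded in a regular scheme of finite type over $K$, $Z_0\leftarrow Z_1\leftarrow\dots\leftarrow Z_j$ is a sequence of blow-ups in regular centers contained in the singular loci of the successive transforms $X_i$ of $X_0$ and having simple normal crossings with the sets $E_i$ of exceptional divisors ($E_0=\emptyset$). For $x=x_j\in X_j$ let $x_i$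 be its image in $Z_i$, and $E_j(x)$ the set of members of $E_j$ through $x$. $\nu_1(x)$ is the Hilbert–Samuel function of $X$ at $x$. Put $\mathrm{inv}_{r+1/2}=(\nu_1,s_1;\dots;\nu_r,s_r;\nu_{r+1})$, so $\mathrm{inv}_{1/2}=(\nu_1)$. *Definition of $s_r$:* put $\mathcal E_0(x):=E_j(x)$. For $r\ge0$, let $i_{r+1}:=\min\{k:\mathrm{inv}_{r+1/2}(x)=\mathrm{inv}_{r+1/2}(x_k)\}$; $E^{r+1}(x)$ is the set of $H\in\mathcal E_r(x)$ that are strict transforms of a component in $E_{i_{r+1}}(x_{i_{r+1}})$; $s_{r+1}:=\#E^{r+1}(x)$ and $\mathcal E_{r+1}(x):=\mathcal E_r(x)\setminus E^{r+1}(x)$. *Definition of $\nu_{r+1}$:* let $(f_1,\dots,f_m)$ be a (normalized) standard basis of $J$ (elements of $J$ with $\mathrm{in}_M(J)=\langle\mathrm{in}_M(f_1),\dots,\mathrm{in}_M(f_m)\rangle$, $\mathrm{in}_M(f_i)\notin\langle\mathrm{in}_M(f_1),\dots,\mathrm{in}_M(f_{i-1})\rangle$, $b_1\le\dots\le b_m$ where $b_i=\mathrm{ord}_M(f_i)$), $\mathcal G_1:=(f_1,b_1)\cap\dots\cap(f_m,b_m)$ on $N_0:=\mathrm{Spec}(R)$. Given $(\mathcal G_r,\mathcal E_{r-1})$ on $N_{r-1}$: (a) $\mathcal F_r:=\mathcal G_r\cap(E^r,1)$ with $(E^r,1)=\bigcap_{H\in E^r}(T_H,1)$, $T_H$ a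 local generator of $H$; write $\mathcal F_r=\bigcap_i(f_i,b_i)$. (b) Choose $N_r=V(y_r)\subset N_{r-1}$ of maximal contact with $\mathcal F_r$, as follows: choose $i$ with $\mathrm{ord}_M(f_i)=b_i=:b$; after a linear coordinate change $\partial^bf_i/\partial w^b$ is a unit for a parameter $w$; by Weierstrass preparation assume $f_i=w^b+\sum_{q<b}w^q\phi_q$; take $y_r:=\frac1{b!}\,\partial^{b-1}f_i/\partial w^{b-1}=w+\phi_{b-1}/b$. $\mathcal E_r$ has normal crossings with $N_r$. (c) $\mathcal H_r:=\mathbb D(\mathcal F_r;u;y_r)=\bigcap_i\bigcap_{0\le q<b_i}(h_{i,q},b_i-q)$ on $N_r$, with $h_{i,q}=\partial^qf_i/\partial y_r^q|_{N_r}$. (d) $\mu_{r+1}:=\min_{i,q}\frac{\mathrm{ord}_M(h_{i,q})}{b_i-q}$; for $H\in\mathcal E_r$, $\mu_{r+1,H}:=\min_{i,q}\frac{\mathrm{ord}_H(h_{i,q})}{b_i-q}$, where $\mathrm{ord}_H(h)$ is the largest $\kappa$ with $T_H^\kappa\mid h$; $\nu_{r+1}:=\mu_{r+1}-\sum_{H\in\mathcal E_r}\mu_{r+1,H}$ ($=\infty$ if $\mu_{r+1}=\infty$). If $\nu_{r+1}\in\{0,\infty\}$ the process ends with $t=r$. (e) Otherwise let $D_{r+1}:=\prod_{H\in\mathcal E_r}T_H^{\mu_{r+1,H}}$ (fractional exponents allowed), $h_{i,q}=D_{r+1}^{b_i-q}g_{i,q}$, and $\mathcal G_{r+1}:=\bigcap_{i,q}(g_{i,q},(b_i-q)\nu_{r+1})\cap(D_{r+1},1-\nu_{r+1})$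 on $N_r$, the last component being omitted if $\nu_{r+1}\ge1$. Continue with $(\mathcal G_{r+1},\mathcal E_r)$ on $N_r$. *)

theory Defs
  imports "HOL-Analysis.Analysis" "HOL-Library.Poly_Mapping"
begin

section \<open>The ring of formal power series in finitely many variables\<close>

text \<open>\<open>('k, 'n) mfps\<close> is the ring \<open>R = K[[T\<^sub>i : i \<in> 'n]]\<close>; a series is the family of its
  coefficients, indexed by the exponents \<open>'n \<Rightarrow>\<^sub>0 nat\<close>.\<close>

typedef ('k, 'n) mfps = "UNIV :: (('n::finite \<Rightarrow>\<^sub>0 nat) \<Rightarrow> 'k::zero) set"
  morphisms mcoeff Mfps
  by simp

lemma mcoeff_Mfps [simp]: "mcoeff (Mfps c) = c"
  by (simp add: Mfps_inverse)

lemma mfps_eqI: "(\<And>m. mcoeff f m = mcoeff g m) \<Longrightarrow> f = g"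
  by (metis mcoeff_inject ext)

definition splits :: "('n::finite \<Rightarrow>\<^sub>0 nat) \<Rightarrow> (('n \<Rightarrow>\<^sub>0 nat) \<times> ('n \<Rightarrow>\<^sub>0 nat)) set" where
  "splits m = {(a, b). a + b = m}"

lemma finite_splits [simp, intro]: "finite (splits m)"
proof -
  have fin: "finite {h :: 'a \<Rightarrow> nat. \<forall>i. h i \<le> Poly_Mapping.lookup m i}" (is "finite ?H")
  proof -
    have "?H = PiE UNIV (\<lambda>i. {..Poly_Mapping.lookup m i})"
      by (auto simp: PiE_def Pi_def extensional_def)
    thus ?thesis by (simp add: finite_PiE)
  qed
  have "Poly_Mapping.lookup ` {a. \<exists>b. a + b = m} \<subseteq> ?H"
    by (auto simp: lookup_add)
  hence "finite (Poly_Mapping.lookup ` {a. \<exists>b. a + b = m})"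
    using fin finite_subset by blast
  hence "finite {a. \<exists>b. a + b = m}"
    by (rule finite_imageD) (simp add: inj_on_def)
  hence "finite ((\<lambda>a. (a, m - a)) ` {a. \<exists>b. a + b = m})"
    by simp
  moreover have "splits m \<subseteq> (\<lambda>a. (a, m - a)) ` {a. \<exists>b. a + b = m}"
    by (auto simp: splits_def)
  ultimately show ?thesis using finite_subset by blast
qed

lemma splits_swap: "sum h (splits m) = (\<Sum>(a, b)\<in>splits m. h (b, a))"
  by (rule sum.reindex_bij_witness[of _ prod.swap prod.swap]) (auto simp: splits_def add.commute)

lemma splits_zero_sum:
  fixes m :: "'b::finite \<Rightarrow>\<^sub>0 nat"
  shows "(\<Sum>(a, b)\<in>splits m. (if a = 0 then h b else 0)) = (h m :: 'a::comm_monoid_add)"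
proof -
  have "(\<Sum>(a, b)\<in>splits m. (if a = 0 then h b else 0)) = (\<Sum>p\<in>{(0 :: 'b \<Rightarrow>\<^sub>0 nat, m)}. h (snd p))"
    by (intro sum.mono_neutral_cong_right finite_splits)
      (auto simp: splits_def split: if_splits)
  thus ?thesis by simp
qed

instantiation mfps :: (comm_ring_1, finite) comm_ring_1
begin

definition "0 = Mfps (\<lambda>_. 0)"
definition "1 = Mfps (\<lambda>m. if m = 0 then 1 else 0)"
definition "f + g = Mfps (\<lambda>m. mcoeff f m + mcoeff g m)"
definition "- f = Mfps (\<lambda>m. - mcoeff f m)"
definition "f - g = Mfps (\<lambda>m. mcoeff f m - mcoeff g m)"
definition "f * g = Mfps (\<lambda>m. \<Sum>(a, b)\<in>splits m. mcoeff f a * mcoeff g b)"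

instance
proof
  fix a b c :: "('a, 'b) mfps"
  show "a + b + c = a + (b + c)" by (simp add: plus_mfps_def add.assoc)
  show "a + b = b + a" by (simp add: plus_mfps_def add.commute)
  show "0 + a = a" by (simp add: plus_mfps_def zero_mfps_def mcoeff_inverse)
  show "- a + a = 0" by (simp add: plus_mfps_def zero_mfps_def uminus_mfps_def)
  show "a - b = a + - b" by (simp add: plus_mfps_def minus_mfps_def uminus_mfps_def)
  show "a * b = b * a"
    unfolding times_mfps_def
    by (subst splits_swap) (simp add: mult.commute case_prod_unfold)
  show "1 * a = a"
  proof (rule mfps_eqI)
    fix m
    have "mcoeff (1 * a) m = (\<Sum>(p, q)\<in>splits m. (if p = 0 then mcoeff a q else 0))"
      by (auto simp: times_mfps_def one_mfps_def intro!: sum.cong)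
    thus "mcoeff (1 * a) m = mcoeff a m" by (simp add: splits_zero_sum)
  qed
  show "(a + b) * c = a * c + b * c"
    by (simp add: times_mfps_def plus_mfps_def distrib_right sum.distrib case_prod_unfold)
  show "(0 :: ('a, 'b) mfps) \<noteq> 1"
  proof
    assume "(0 :: ('a, 'b) mfps) = 1"
    hence "mcoeff (0 :: ('a, 'b) mfps) 0 = mcoeff 1 0" by (rule arg_cong)
    thus False by (simp add: zero_mfps_def one_mfps_def)
  qed
  show "a * b * c = a * (b * c)"
  proof (rule mfps_eqI)
    fix m
    have "mcoeff (a * b * c) m =
        (\<Sum>(p, z)\<in>splits m. \<Sum>(x, y)\<in>splits p. mcoeff a x * mcoeff b y * mcoeff c z)"
      by (simp add: times_mfps_def sum_distrib_right case_prod_unfold)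
    also have "\<dots> = (\<Sum>((p, z), (x, y))\<in>(SIGMA u:splits m. splits (fst u)).
        mcoeff a x * mcoeff b y * mcoeff c z)"
      by (simp add: sum.Sigma case_prod_unfold)
    also have "\<dots> = (\<Sum>((x, q), (y, z))\<in>(SIGMA u:splits m. splits (snd u)).
        mcoeff a x * (mcoeff b y * mcoeff c z))"
      by (rule sum.reindex_bij_witness
          [of _ "\<lambda>((x, q), (y, z)). ((x + y, z), (x, y))" "\<lambda>((p, z), (x, y)). ((x, y + z), (y, z))"])
        (auto simp: splits_def add.assoc mult.assoc)
    also have "\<dots> = (\<Sum>(x, q)\<in>splits m. \<Sum>(y, z)\<in>splits q. mcoeff a x * (mcoeff b y * mcoeff c z))"
      by (simp add: sum.Sigma case_prod_unfold)
    also have "\<dots> = mcoeff (a * (b * c)) m"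
      by (simp add: times_mfps_def sum_distrib_left case_prod_unfold)
    finally show "mcoeff (a * b * c) m = mcoeff (a * (b * c)) m" .
  qed
qed

end

definition Const :: "'k::comm_ring_1 \<Rightarrow> ('k, 'n::finite) mfps" where
  "Const c = Mfps (\<lambda>m. if m = 0 then c else 0)"


section \<open>Ideals, orders and derivations\<close>

abbreviation ideal_of :: "'a::comm_ring_1 set \<Rightarrow> 'a set" where
  "ideal_of B \<equiv> module.span (*) B"

abbreviation is_ideal :: "'a::comm_ring_1 set \<Rightarrow> bool" where
  "is_ideal I \<equiv> module.subspace (*) I"

definition ideal_power :: "'a::comm_ring_1 set \<Rightarrow> nat \<Rightarrow> 'a set" where
  "ideal_power I k = ideal_of {prod_list xs | xs. length xs = k \<and> set xs \<subseteq> I}"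

definition prime_ideal :: "'a::comm_ring_1 set \<Rightarrow> bool" where
  "prime_ideal Q \<longleftrightarrow> is_ideal Q \<and> Q \<noteq> UNIV \<and> (\<forall>a b. a * b \<in> Q \<longrightarrow> a \<in> Q \<or> b \<in> Q)"

inductive_set subring_gen :: "'a::comm_ring_1 set \<Rightarrow> 'a set" for B where
  gen: "x \<in> B \<Longrightarrow> x \<in> subring_gen B"
| one: "1 \<in> subring_gen B"
| diff: "x \<in> subring_gen B \<Longrightarrow> y \<in> subring_gen B \<Longrightarrow> x - y \<in> subring_gen B"
| mult: "x \<in> subring_gen B \<Longrightarrow> y \<in> subring_gen B \<Longrightarrow> x * y \<in> subring_gen B"

definition kalg :: "('k::comm_ring_1, 'n::finite) mfps set \<Rightarrow> ('k, 'n) mfps set" where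
  "kalg B = subring_gen (range Const \<union> B)"

text \<open>The maximal ideal of \<open>R\<close>; its complement is the set of units of \<open>R\<close> (\<open>K\<close> a field).\<close>

definition maxid :: "('k::comm_ring_1, 'n::finite) mfps set" where
  "maxid = {f. mcoeff f 0 = 0}"

text \<open>Regular systems of parameters of \<open>R\<close>: since \<open>dim R\<close> is the cardinality of \<open>'n\<close>, these are the
  families indexed by \<open>'n\<close> that generate the maximal ideal.\<close>

definition rsp :: "('n::finite \<Rightarrow> ('k::comm_ring_1, 'n) mfps) \<Rightarrow> bool" where
  "rsp t \<longleftrightarrow> ideal_of (range t) = maxid"

text \<open>Closed subschemes \<open>N = V(I)\<close> of \<open>Spec R\<close> are given by the ideal \<open>I\<close>; elements of the coordinate
  ring \<open>S = R / I\<close> are represented by elements of \<open>R\<close>, and all notions below that take an argument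
  \<open>I\<close> depend only on the classes modulo \<open>I\<close>.  The maximal ideal of \<open>S\<close> and its powers are the images
  of those of \<open>R\<close>.\<close>

definition ord_mod :: "('k::comm_ring_1, 'n::finite) mfps set \<Rightarrow> ('k, 'n) mfps \<Rightarrow> enat" where
  "ord_mod I f = Sup (enat ` {k. f \<in> ideal_of (I \<union> ideal_power maxid k)})"

definition ord_along :: "('k::comm_ring_1, 'n::finite) mfps set \<Rightarrow> ('k, 'n) mfps \<Rightarrow> ('k, 'n) mfps \<Rightarrow> enat"
  where "ord_along I T h = Sup (enat ` {k. \<exists>g. h - T ^ k * g \<in> I})"

text \<open>Elements of \<open>S\<close> that are power series in (the classes of) the elements of \<open>V\<close>.\<close>

definition series_in :: "('k::comm_ring_1, 'n::finite) mfps set \<Rightarrow> ('k, 'n) mfps set \<Rightarrow> ('k, 'n) mfps set"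
  where "series_in I V = {f. \<forall>k. \<exists>p\<in>kalg V. f - p \<in> ideal_of (I \<union> ideal_power maxid k)}"

definition derivation :: "(('k::comm_ring_1, 'n::finite) mfps \<Rightarrow> ('k, 'n) mfps) \<Rightarrow> bool" where
  "derivation D \<longleftrightarrow> (\<forall>c. D (Const c) = 0) \<and> (\<forall>f g. D (f + g) = D f + D g)
     \<and> (\<forall>f g. D (f * g) = D f * g + f * D g)"

text \<open>\<open>\<partial>/\<partial>t\<^sub>i\<close> with respect to the regular system of parameters \<open>t\<close>.  If \<open>I\<close> is generated by some of
  the \<open>t\<^sub>j\<close>, \<open>j \<noteq> i\<close>, it maps \<open>I\<close> to \<open>I\<close> and induces the partial derivative on \<open>R / I\<close>.\<close>

definition partial :: "('n::finite \<Rightarrow> ('k::comm_ring_1, 'n) mfps) \<Rightarrow> 'n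
    \<Rightarrow> ('k, 'n) mfps \<Rightarrow> ('k, 'n) mfps" where
  "partial t i = (THE D. derivation D \<and> (\<forall>j. D (t j) = (if j = i then 1 else 0)))"


section \<open>The associated graded ring and standard bases\<close>

text \<open>\<open>gr\<^sub>M(R)\<close> is the polynomial ring \<open>('n \<Rightarrow>\<^sub>0 nat) \<Rightarrow>\<^sub>0 'k\<close>; for \<open>f \<in> M\<^sup>b\<close>, \<open>init_form b f\<close> is
  the class of \<open>f\<close> modulo \<open>M\<^sup>b\<^sup>+\<^sup>1\<close>.\<close>

definition init_form :: "nat \<Rightarrow> ('k::comm_ring_1, 'n::finite) mfps \<Rightarrow> (('n \<Rightarrow>\<^sub>0 nat) \<Rightarrow>\<^sub>0 'k)" where
  "init_form b f = Abs_poly_mapping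
     (\<lambda>m. if (\<Sum>i\<in>UNIV. Poly_Mapping.lookup m i) = b then mcoeff f m else 0)"

definition nord :: "('k::comm_ring_1, 'n::finite) mfps \<Rightarrow> nat" where
  "nord f = the_enat (ord_mod {0} f)"

definition in_elem :: "('k::comm_ring_1, 'n::finite) mfps \<Rightarrow> (('n \<Rightarrow>\<^sub>0 nat) \<Rightarrow>\<^sub>0 'k)" where
  "in_elem f = (if f = 0 then 0 else init_form (nord f) f)"

definition in_ideal :: "('k::comm_ring_1, 'n::finite) mfps set \<Rightarrow> (('n \<Rightarrow>\<^sub>0 nat) \<Rightarrow>\<^sub>0 'k) set" where
  "in_ideal J = ideal_of (in_elem ` J)"

definition standard_basis :: "('k::comm_ring_1, 'n::finite) mfps set \<Rightarrow> ('k, 'n) mfps list \<Rightarrow> bool" where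
  "standard_basis J fs \<longleftrightarrow> set fs \<subseteq> J \<and> in_ideal J = ideal_of (in_elem ` set fs)
     \<and> (\<forall>i<length fs. in_elem (fs ! i) \<notin> ideal_of (in_elem ` set (take i fs)))
     \<and> sorted (map nord fs)"


section \<open>Pairs, projected polyhedra and the directrix\<close>

text \<open>A finite set of \<open>(f, b)\<close> stands for the intersection of the pairs \<open>(f, b)\<close> on \<open>R / I\<close>; in
  particular \<open>(\<langle>f\<^sub>1, \<dots>, f\<^sub>m\<rangle>, b)\<close> is given by \<open>{(f\<^sub>1, b), \<dots>, (f\<^sub>m, b)}\<close>.\<close>

type_synonym ('k, 'n) pair = "(('k, 'n) mfps \<times> real) set"

definition drop_zero :: "('k, 'n) mfps set \<Rightarrow> ('k::comm_ring_1, 'n::finite) pair \<Rightarrow> ('k, 'n) pair" where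
  "drop_zero I E = {(f, b) \<in> E. f \<notin> I}"

definition monom_val :: "('n::finite \<Rightarrow> ('k::comm_ring_1, 'n) mfps) \<Rightarrow> ('n \<Rightarrow>\<^sub>0 nat) \<Rightarrow> ('k, 'n) mfps" where
  "monom_val t m = (\<Prod>i\<in>UNIV. t i ^ Poly_Mapping.lookup m i)"

text \<open>In the following, \<open>t\<close> is a regular system of parameters of \<open>R\<close>, \<open>U\<close> and \<open>Y\<close> are disjoint sets of
  indices, \<open>(u) = (t\<^sub>i)\<^bsub>i\<in>U\<^esub>\<close>, \<open>(y) = (t\<^sub>i)\<^bsub>i\<in>Y\<^esub>\<close>, and \<open>I\<close> is generated by the remaining \<open>t\<^sub>i\<close>, so that
  \<open>(u, y)\<close> is a regular system of parameters of \<open>R / I\<close>.  \<open>expansion I t (U \<union> Y) f X\<close>: the class of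
  \<open>f\<close> has a finite expansion in \<open>(u, y)\<close> with unit coefficients and set of exponents \<open>X\<close>.\<close>

definition expansion :: "('k::comm_ring_1, 'n::finite) mfps set \<Rightarrow> ('n \<Rightarrow> ('k, 'n) mfps) \<Rightarrow> 'n set
    \<Rightarrow> ('k, 'n) mfps \<Rightarrow> ('n \<Rightarrow>\<^sub>0 nat) set \<Rightarrow> bool" where
  "expansion I t V f X \<longleftrightarrow> finite X \<and> (\<forall>m\<in>X. Poly_Mapping.keys m \<subseteq> V)
     \<and> (\<exists>C. (\<forall>m\<in>X. C m \<notin> maxid) \<and> f - (\<Sum>m\<in>X. C m * monom_val t m) \<in> I)"

definition minimal_expansion :: "('k::comm_ring_1, 'n::finite) mfps set \<Rightarrow> ('n \<Rightarrow> ('k, 'n) mfps)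
    \<Rightarrow> 'n set \<Rightarrow> ('k, 'n) mfps \<Rightarrow> ('n \<Rightarrow>\<^sub>0 nat) set \<Rightarrow> bool" where
  "minimal_expansion I t V f X \<longleftrightarrow> expansion I t V f X
     \<and> (\<forall>X'. expansion I t V f X' \<longrightarrow> card X \<le> card X')"

text \<open>\<open>\<real>\<^sup>d\<close> with coordinates indexed by \<open>U\<close> is realised as the set of vectors whose coordinates outside
  \<open>U\<close> vanish.  \<open>orthant_at b U Y m\<close> is \<open>A / (b - |B|) + \<real>\<^sup>d\<^sub>\<ge>\<^sub>0\<close> for the exponent \<open>m = (A, B)\<close>.\<close>

definition ydeg :: "'n set \<Rightarrow> ('n::finite \<Rightarrow>\<^sub>0 nat) \<Rightarrow> nat" where
  "ydeg Y m = (\<Sum>i\<in>Y. Poly_Mapping.lookup m i)"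

definition orthant_at :: "real \<Rightarrow> 'n set \<Rightarrow> 'n set \<Rightarrow> ('n::finite \<Rightarrow>\<^sub>0 nat) \<Rightarrow> (real ^ 'n) set" where
  "orthant_at b U Y m = {v. (\<forall>i\<in>U. real (Poly_Mapping.lookup m i) / (b - real (ydeg Y m)) \<le> v $ i)
     \<and> (\<forall>i. i \<notin> U \<longrightarrow> v $ i = 0)}"

definition proj_polyhedron :: "('k::comm_ring_1, 'n::finite) mfps set \<Rightarrow> ('n \<Rightarrow> ('k, 'n) mfps)
    \<Rightarrow> 'n set \<Rightarrow> 'n set \<Rightarrow> ('k, 'n) pair \<Rightarrow> (real ^ 'n) set" where
  "proj_polyhedron I t U Y E = (\<lambda>C. closed C \<and> convex C) hull
     (\<Union>{orthant_at b U Y m | f b X m. (f, b) \<in> E \<and> minimal_expansion I t (U \<union> Y) f X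
                                    \<and> m \<in> X \<and> real (ydeg Y m) < b})"

definition delta :: "'n set \<Rightarrow> (real ^ 'n::finite) set \<Rightarrow> ereal" where
  "delta U P = (INF v\<in>P. ereal (\<Sum>i\<in>U. v $ i))"

definition dcoord :: "'n \<Rightarrow> (real ^ 'n::finite) set \<Rightarrow> ereal" where
  "dcoord i P = (INF v\<in>P. ereal (v $ i))"

text \<open>\<open>\<Delta>(E, u)\<close>: the intersection over all \<open>(y)\<close> extending \<open>(u)\<close>.\<close>

definition min_polyhedron :: "('k::comm_ring_1, 'n::finite) mfps set \<Rightarrow> ('n \<Rightarrow> ('k, 'n) mfps)
    \<Rightarrow> 'n set \<Rightarrow> 'n set \<Rightarrow> ('k, 'n) pair \<Rightarrow> (real ^ 'n) set" where
  "min_polyhedron I t U Y E =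
     (\<Inter>t' \<in> {t'. rsp t' \<and> (\<forall>i. i \<notin> Y \<longrightarrow> t' i = t i)}. proj_polyhedron I t' U Y E)"

text \<open>The intersection of the pairs \<open>(f\<^sub>i, b\<^sub>i)\<close> is the pair \<open>(\<Sum>\<^sub>i \<langle>f\<^sub>i\<rangle>\<^bsup>c/b\<^sub>i\<^esup>, c)\<close> with \<open>c\<close> the least common
  multiple of the (rational) \<open>b\<^sub>i\<close>.  \<open>pair_ideal\<close> is the preimage in \<open>R\<close> of its ideal.\<close>

definition pair_lcm :: "('k, 'n) pair \<Rightarrow> real" where
  "pair_lcm E = (LEAST c. 0 < c \<and> (\<forall>(f, b)\<in>E. \<exists>k::nat. c = real k * b))"

definition pair_ideal :: "('k::comm_ring_1, 'n::finite) mfps set \<Rightarrow> ('k, 'n) pair \<Rightarrow> ('k, 'n) mfps set" where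
  "pair_ideal I E = ideal_of (I \<union> {f ^ k | f b k. (f, b) \<in> E \<and> pair_lcm E = real k * b})"

text \<open>The preimage of \<open>in\<^sub>M(E)\<close> under \<open>gr\<^sub>M(R) \<rightarrow> gr\<^sub>M(R / I) = gr\<^sub>M(R) / in\<^sub>M(I)\<close>.\<close>

definition in_pair :: "('k::comm_ring_1, 'n::finite) mfps set \<Rightarrow> ('k, 'n) pair
    \<Rightarrow> (('n \<Rightarrow>\<^sub>0 nat) \<Rightarrow>\<^sub>0 'k) set" where
  "in_pair I E = ideal_of (in_ideal I \<union>
     {init_form b f | b f. pair_lcm E = real b \<and> f \<in> pair_ideal I E \<inter> ideal_power maxid b})"

text \<open>The minimal number of linear forms \<open>Y\<^sub>1, \<dots>, Y\<^sub>r\<close> in \<open>gr\<^sub>M(R / I)\<close> such that \<open>in\<^sub>M(E)\<close> is generated by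
  elements of \<open>K[Y\<^sub>1, \<dots>, Y\<^sub>r]\<close>, that is, the codimension of the directrix.\<close>

definition directrix_codim :: "('k::comm_ring_1, 'n::finite) mfps set \<Rightarrow> ('k, 'n) pair \<Rightarrow> nat" where
  "directrix_codim I E = (LEAST r. \<exists>Ys. length Ys = r \<and> set Ys \<subseteq> init_form 1 ` maxid \<and>
     (\<exists>G \<subseteq> subring_gen (range (Poly_Mapping.single 0) \<union> set Ys).
        in_pair I E = ideal_of (in_ideal I \<union> G)))"


section \<open>Pairs with history\<close>

text \<open>The exceptional divisors through the point are indexed by natural numbers, \<open>T l\<close> being a local
  generator of the \<open>l\<close>-th one.\<close>

definition on_sub :: "('k::comm_ring_1, 'n::finite) mfps set \<Rightarrow> ('k, 'n) mfps \<Rightarrow> ('k, 'n) mfps \<Rightarrow> bool" where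
  "on_sub I f g \<longleftrightarrow> ideal_of (insert f I) = ideal_of (insert g I)"

definition adapted :: "('k::comm_ring_1, 'n::finite) mfps set \<Rightarrow> ('n \<Rightarrow> ('k, 'n) mfps) \<Rightarrow> 'n set
    \<Rightarrow> (nat \<Rightarrow> ('k, 'n) mfps) \<Rightarrow> nat set \<Rightarrow> bool" where
  "adapted IN t U T Hs \<longleftrightarrow> (\<forall>l\<in>Hs. T l \<notin> IN \<longrightarrow> (\<exists>i\<in>U. on_sub IN (T l) (t i)))"

definition exc_data :: "('k::comm_ring_1, 'n::finite) mfps set \<Rightarrow> ('n \<Rightarrow> ('k, 'n) mfps) \<Rightarrow> 'n set \<Rightarrow> 'n set
    \<Rightarrow> ('k, 'n) pair \<Rightarrow> (nat \<Rightarrow> ('k, 'n) mfps) \<Rightarrow> nat \<Rightarrow> ereal" where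
  "exc_data I t U Y E T l = (let IN = ideal_of (I \<union> t ` Y) in
     if T l \<in> IN then 0
     else dcoord (THE i. i \<in> U \<and> on_sub IN (T l) (t i)) (proj_polyhedron I t U Y E))"

text \<open>\<open>e'\<close> is the dimension of the directrix of \<open>E\<close>.  In \<open>ereal\<close>, \<open>\<infinity> - x = \<infinity>\<close> for every \<open>x\<close>, including
  \<open>x = \<infinity>\<close>.\<close>

definition nu_hist :: "('k::comm_ring_1, 'n::finite) mfps set \<Rightarrow> ('n \<Rightarrow> ('k, 'n) mfps) \<Rightarrow> 'n set \<Rightarrow> 'n set
    \<Rightarrow> ('k, 'n) pair \<Rightarrow> nat set \<Rightarrow> (nat \<Rightarrow> ereal) \<Rightarrow> ereal" where
  "nu_hist I t U Y E Hs d =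
     (let e' = card (U \<union> Y) - directrix_codim I E in
      if proj_polyhedron I t U Y E = {} then \<infinity>
      else if e' = card U then delta U (min_polyhedron I t U Y E) - (\<Sum>l\<in>Hs. d l)
      else delta U (proj_polyhedron I t U Y E) - (\<Sum>l\<in>Hs. d l))"


section \<open>Sequences of blow-ups, seen along the images of a point\<close>

text \<open>The points \<open>x\<^sub>k\<close> are the images of \<open>x = x\<^sub>j\<close>; only the germs at them matter.  They are \<open>K\<close>-rational because the
  completed local ring of \<open>Z\<^sub>j\<close> at \<open>x\<close> is \<open>K[[T]]\<close>.  The germ of \<open>Z\<^sub>k\<close> at \<open>x\<^sub>k\<close> is given by its local ring
  \<open>A k\<close>, a subring of its completion \<open>R\<close>; the germ of \<open>X\<^sub>k\<close> by the completed ideal \<open>J k\<close>; and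
  \<open>dv k l\<close> is the completed ideal of the component at \<open>x\<^sub>k\<close> of the strict transform of the exceptional
  divisor of the \<open>l\<close>-th blow-up (the unit ideal if it does not pass through \<open>x\<^sub>k\<close>).\<close>

definition localize :: "('k::comm_ring_1, 'n::finite) mfps set \<Rightarrow> ('k, 'n) mfps set" where
  "localize B = {f. \<exists>a\<in>B. \<exists>b\<in>B. b \<notin> maxid \<and> f * b = a}"

definition rsp_in :: "('k::comm_ring_1, 'n::finite) mfps set \<Rightarrow> ('n \<Rightarrow> ('k, 'n) mfps) \<Rightarrow> bool" where
  "rsp_in A t \<longleftrightarrow> rsp t \<and> range t \<subseteq> A \<and> A \<inter> maxid = {\<Sum>i\<in>UNIV. a i * t i | a. range a \<subseteq> A}"

text \<open>\<open>A\<close> is the local ring of a regular scheme of finite type over \<open>K\<close> at a \<open>K\<close>-rational point, with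
  completion \<open>R\<close>.\<close>

definition regular_germ :: "('k::comm_ring_1, 'n::finite) mfps set \<Rightarrow> bool" where
  "regular_germ A \<longleftrightarrow> (\<exists>B. finite B \<and> A = localize (kalg B)) \<and> (\<exists>t. rsp_in A t)"

definition kalg_hom :: "(('k::comm_ring_1, 'n::finite) mfps \<Rightarrow> ('k, 'n) mfps) \<Rightarrow> bool" where
  "kalg_hom \<phi> \<longleftrightarrow> (\<forall>c. \<phi> (Const c) = Const c) \<and> (\<forall>f g. \<phi> (f + g) = \<phi> f + \<phi> g)
     \<and> (\<forall>f g. \<phi> (f * g) = \<phi> f * \<phi> g)"

definition strict_transform :: "(('k::comm_ring_1, 'n::finite) mfps \<Rightarrow> ('k, 'n) mfps)
    \<Rightarrow> ('k, 'n) mfps \<Rightarrow> ('k, 'n) mfps set \<Rightarrow> ('k, 'n) mfps set" where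
  "strict_transform \<phi> e J = {f. \<exists>k. e ^ k * f \<in> ideal_of (\<phi> ` J)}"

text \<open>The local ring \<open>(R / J)\<^sub>Q\<close> is regular: its maximal ideal is generated by \<open>dim (R / J)\<^sub>Q\<close> elements.\<close>

definition local_dim :: "'a::comm_ring_1 set \<Rightarrow> 'a set \<Rightarrow> enat" where
  "local_dim J Q = Sup (enat ` {l. \<exists>c. (\<forall>i\<le>l. prime_ideal (c i) \<and> J \<subseteq> c i)
     \<and> (\<forall>i<l. c i \<subset> c (Suc i)) \<and> c l = Q})"

definition regular_at :: "'a::comm_ring_1 set \<Rightarrow> 'a set \<Rightarrow> bool" where
  "regular_at J Q \<longleftrightarrow> (\<exists>qs. set qs \<subseteq> Q \<and> enat (length qs) = local_dim J Q
     \<and> (\<forall>f\<in>Q. \<exists>s. s \<notin> Q \<and> s * f \<in> ideal_of (J \<union> set qs)))"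

definition singular_locus :: "'a::comm_ring_1 set \<Rightarrow> 'a set set" where
  "singular_locus J = {Q. prime_ideal Q \<and> J \<subseteq> Q \<and> \<not> regular_at J Q}"

definition exc_through :: "(nat \<Rightarrow> nat \<Rightarrow> ('k::comm_ring_1, 'n::finite) mfps set) \<Rightarrow> nat \<Rightarrow> nat set" where
  "exc_through dv k = {l. 1 \<le> l \<and> l \<le> k \<and> dv k l \<noteq> UNIV}"

text \<open>One blow-up.  In the first case \<open>x\<^sub>k\<close> does not lie on the center.  In the second case the center is
  \<open>V(t\<^sub>i : i \<in> P)\<close>, and \<open>x\<^sub>k\<^sub>+\<^sub>1\<close> is the point of the chart with exceptional divisor \<open>t\<^sub>p = 0\<close>, \<open>p \<in> P\<close>, at
  which the functions \<open>t\<^sub>i / t\<^sub>p\<close> take the values \<open>a\<^sub>i \<in> K\<close>.\<close>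

definition germ_blow_up :: "(nat \<Rightarrow> ('k::field, 'n::finite) mfps set) \<Rightarrow> (nat \<Rightarrow> ('k, 'n) mfps set)
    \<Rightarrow> (nat \<Rightarrow> nat \<Rightarrow> ('k, 'n) mfps set) \<Rightarrow> nat \<Rightarrow> bool" where
  "germ_blow_up A J dv k \<longleftrightarrow> (\<exists>\<phi>. kalg_hom \<phi> \<and>
     ((bij \<phi> \<and> A (Suc k) = \<phi> ` A k \<and> J (Suc k) = \<phi> ` J k
        \<and> (\<forall>l\<le>k. dv (Suc k) l = \<phi> ` dv k l) \<and> dv (Suc k) (Suc k) = UNIV)
      \<or> (\<exists>t s P p a. rsp_in (A k) t \<and> rsp s \<and> p \<in> P
        \<and> (\<forall>l\<in>exc_through dv k. \<exists>i. dv k l = ideal_of {t i})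
        \<and> {Q. prime_ideal Q \<and> t ` P \<subseteq> Q} \<subseteq> singular_locus (J k)
        \<and> (\<forall>i. \<phi> (t i) = (if i \<in> P - {p} then s p * (s i + Const (a i)) else s i))
        \<and> A (Suc k) = localize (kalg (\<phi> ` A k \<union> range s))
        \<and> J (Suc k) = strict_transform \<phi> (s p) (J k)
        \<and> (\<forall>l\<le>k. dv (Suc k) l = strict_transform \<phi> (s p) (dv k l))
        \<and> dv (Suc k) (Suc k) = ideal_of {s p})))"

definition blow_up_sequence :: "nat \<Rightarrow> (nat \<Rightarrow> ('k::field, 'n::finite) mfps set)
    \<Rightarrow> (nat \<Rightarrow> ('k, 'n) mfps set) \<Rightarrow> (nat \<Rightarrow> nat \<Rightarrow> ('k, 'n) mfps set) \<Rightarrow> bool" where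
  "blow_up_sequence j A J dv \<longleftrightarrow> regular_germ (A 0) \<and> is_ideal (J 0) \<and> J 0 = ideal_of (J 0 \<inter> A 0)
     \<and> (\<forall>k<j. germ_blow_up A J dv k)"

text \<open>The Hilbert--Samuel function \<open>m \<mapsto> dim\<^sub>K R / (J + M\<^sup>m\<^sup>+\<^sup>1)\<close>, the dimension being the least number of
  elements that span the quotient.\<close>

definition hilbert_samuel :: "('k::field, 'n::finite) mfps set \<Rightarrow> nat \<Rightarrow> nat" where
  "hilbert_samuel J m = (LEAST d. \<exists>B. finite B \<and> card B = d
     \<and> module.span (\<lambda>c f. Const c * f) (B \<union> J \<union> ideal_power maxid (Suc m)) = UNIV)"


section \<open>The invariant of Bierstone and Milman\<close>

text \<open>The data chosen and constructed at one point.  \<open>steps\<close> is \<open>t\<close>, \<open>gens l\<close> is \<open>T\<^sub>H\<close> for the \<open>l\<close>-th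
  divisor, \<open>pairG r = \<G>\<^sub>r\<close>, \<open>pairF r = \<F>\<^sub>r\<close>, \<open>excE r = E\<^sup>r\<close>, \<open>excR r = \<E>\<^sub>r\<close>.  \<open>param r\<close> is the regular system of
  parameters \<open>(u, y\<^sub>1, \<dots>, y\<^sub>r)\<close> of \<open>R\<close> used at the \<open>r\<close>-th step, with \<open>y\<^sub>i\<close> at the index \<open>idx i\<close>.\<close>

record ('k, 'n) run =
  steps :: nat
  gens :: "nat \<Rightarrow> ('k, 'n) mfps"
  idx :: "nat \<Rightarrow> 'n"
  param :: "nat \<Rightarrow> 'n \<Rightarrow> ('k, 'n) mfps"
  pairG :: "nat \<Rightarrow> ('k, 'n) pair"
  pairF :: "nat \<Rightarrow> ('k, 'n) pair"
  excE :: "nat \<Rightarrow> nat set"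
  excR :: "nat \<Rightarrow> nat set"

definition yy :: "('k::field, 'n::finite) run \<Rightarrow> nat \<Rightarrow> ('k, 'n) mfps" where
  "yy \<rho> r = param \<rho> r (idx \<rho> r)"

text \<open>The ideal of \<open>N\<^sub>r = V(y\<^sub>1, \<dots>, y\<^sub>r)\<close>, and the indices of the remaining parameters \<open>(u)\<close>.\<close>

definition idN :: "('k::field, 'n::finite) run \<Rightarrow> nat \<Rightarrow> ('k, 'n) mfps set" where
  "idN \<rho> r = ideal_of (yy \<rho> ` {1..r})"

definition uix :: "('k::field, 'n::finite) run \<Rightarrow> nat \<Rightarrow> 'n set" where
  "uix \<rho> r = - idx \<rho> ` {1..r}"

definition hcoef :: "('k::field, 'n::finite) run \<Rightarrow> nat \<Rightarrow> ('k, 'n) mfps \<Rightarrow> nat \<Rightarrow> ('k, 'n) mfps" where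
  "hcoef \<rho> r f q = (partial (param \<rho> r) (idx \<rho> r) ^^ q) f"

text \<open>\<open>mu \<rho> r\<close>, \<open>muH \<rho> r l\<close> and \<open>nu \<rho> r\<close> are \<open>\<mu>\<^sub>r\<^sub>+\<^sub>1\<close>, \<open>\<mu>\<^bsub>r+1,H\<^esub>\<close> and \<open>\<nu>\<^sub>r\<^sub>+\<^sub>1\<close>.\<close>

definition mu :: "('k::field, 'n::finite) run \<Rightarrow> nat \<Rightarrow> ereal" where
  "mu \<rho> r = (INF (f, b)\<in>pairF \<rho> r. INF q\<in>{q. real q < b}.
     ereal_of_enat (ord_mod (idN \<rho> r) (hcoef \<rho> r f q)) / ereal (b - real q))"

definition muH :: "('k::field, 'n::finite) run \<Rightarrow> nat \<Rightarrow> nat \<Rightarrow> ereal" where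
  "muH \<rho> r l = (INF (f, b)\<in>pairF \<rho> r. INF q\<in>{q. real q < b}.
     ereal_of_enat (ord_along (idN \<rho> r) (gens \<rho> l) (hcoef \<rho> r f q)) / ereal (b - real q))"

definition nu :: "('k::field, 'n::finite) run \<Rightarrow> nat \<Rightarrow> ereal" where
  "nu \<rho> r = (if mu \<rho> r = \<infinity> then \<infinity> else mu \<rho> r - (\<Sum>l\<in>excR \<rho> r. muH \<rho> r l))"

text \<open>\<open>inv_half J \<rho> k r\<close> is \<open>inv\<^bsub>r+1/2\<^esub>(x\<^sub>k) = (\<nu>\<^sub>1, [(s\<^sub>1, \<nu>\<^sub>2), \<dots>, (s\<^sub>r, \<nu>\<^sub>r\<^sub>+\<^sub>1)])\<close>, if it is defined.\<close>

type_synonym inv_value = "(nat \<Rightarrow> nat) \<times> (nat \<times> ereal) list"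

definition inv_half :: "(nat \<Rightarrow> ('k::field, 'n::finite) mfps set) \<Rightarrow> (nat \<Rightarrow> ('k, 'n) run)
    \<Rightarrow> nat \<Rightarrow> nat \<Rightarrow> inv_value option" where
  "inv_half J \<rho> k r = (if r \<le> steps (\<rho> k)
     then Some (hilbert_samuel (J k), map (\<lambda>i. (card (excE (\<rho> k) i), nu (\<rho> k) i)) [1..<Suc r])
     else None)"

definition inv_X :: "(nat \<Rightarrow> ('k::field, 'n::finite) mfps set) \<Rightarrow> (nat \<Rightarrow> ('k, 'n) run)
    \<Rightarrow> nat \<Rightarrow> inv_value" where
  "inv_X J \<rho> k = the (inv_half J \<rho> k (steps (\<rho> k)))"

definition nu_entry :: "inv_value \<Rightarrow> nat \<Rightarrow> ereal" where
  "nu_entry v i = snd (snd v ! (i - 2))"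

text \<open>\<open>first_year J \<rho> k r\<close> is \<open>i\<^sub>r\<^sub>+\<^sub>1\<close> at the point \<open>x\<^sub>k\<close>.\<close>

definition first_year :: "(nat \<Rightarrow> ('k::field, 'n::finite) mfps set) \<Rightarrow> (nat \<Rightarrow> ('k, 'n) run)
    \<Rightarrow> nat \<Rightarrow> nat \<Rightarrow> nat" where
  "first_year J \<rho> k r = (LEAST i. i \<le> k \<and> inv_half J \<rho> i r = inv_half J \<rho> k r)"

text \<open>The divisor of the \<open>l\<close>-th blow-up keeps its index \<open>l\<close> under strict transforms.\<close>

definition exc_history :: "(nat \<Rightarrow> ('k::field, 'n::finite) mfps set)
    \<Rightarrow> (nat \<Rightarrow> nat \<Rightarrow> ('k, 'n) mfps set) \<Rightarrow> (nat \<Rightarrow> ('k, 'n) run) \<Rightarrow> nat \<Rightarrow> bool" where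
  "exc_history J dv \<rho> k \<longleftrightarrow> excR (\<rho> k) 0 = exc_through dv k \<and>
     (\<forall>r<steps (\<rho> k). excE (\<rho> k) (Suc r) = excR (\<rho> k) r \<inter> exc_through dv (first_year J \<rho> k r)
        \<and> excR (\<rho> k) (Suc r) = excR (\<rho> k) r - excE (\<rho> k) (Suc r))"

text \<open>Steps (a) and (b).  The chosen \<open>f\<^sub>i\<close> is replaced by the multiple by a unit provided by the Weierstrass
  preparation theorem; \<open>v\<close> are the coordinates used there, \<open>w = v (idx r)\<close>.\<close>

definition contact_step :: "('k::field_char_0, 'n::finite) run \<Rightarrow> nat \<Rightarrow> bool" where
  "contact_step \<rho> r \<longleftrightarrow> (let I = idN \<rho> (r - 1); p = idx \<rho> r;
       F0 = drop_zero I (pairG \<rho> r \<union> (\<lambda>l. (gens \<rho> l, 1)) ` excE \<rho> r) in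
     \<exists>f0 f b \<epsilon> v \<phi>. (f0, real b) \<in> F0 \<and> 0 < b \<and> ord_mod I f0 = enat b
       \<and> rsp v \<and> (\<forall>i\<in>{1..<r}. v (idx \<rho> i) = yy \<rho> i)
       \<and> (partial v p ^^ b) f0 \<notin> maxid
       \<and> \<epsilon> \<notin> maxid \<and> f - \<epsilon> * f0 \<in> I
       \<and> pairF \<rho> r = insert (f, real b) (F0 - {(f0, real b)})
       \<and> (\<forall>q<b. \<phi> q \<in> series_in I (v ` uix \<rho> r))
       \<and> f - (v p ^ b + (\<Sum>q<b. v p ^ q * \<phi> q)) \<in> I
       \<and> yy \<rho> r - Const (1 / fact b) * (partial v p ^^ (b - 1)) f \<in> I)"

definition normal_crossings :: "('k::field, 'n::finite) run \<Rightarrow> nat \<Rightarrow> bool" where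
  "normal_crossings \<rho> r \<longleftrightarrow> (\<exists>s c. rsp s \<and> ideal_of (s ` idx \<rho> ` {1..r}) = idN \<rho> r
     \<and> inj_on c (excR \<rho> r) \<and> (\<forall>l\<in>excR \<rho> r. ideal_of {gens \<rho> l} = ideal_of {s (c l)}))"

text \<open>Step (e).  A pair \<open>(g, b)\<close> with \<open>g\<close> involving fractional exponents is represented by \<open>(g\<^sup>N, N b)\<close> for
  some \<open>N \<ge> 1\<close> such that all exponents become integral; \<open>e l\<close> is the exponent of \<open>T\<^sub>H\<close> in the
  corresponding power of \<open>D\<^sub>r\<^sub>+\<^sub>1\<close>.\<close>

definition next_pair :: "('k::field, 'n::finite) run \<Rightarrow> nat \<Rightarrow> bool" where
  "next_pair \<rho> r \<longleftrightarrow> (let I = idN \<rho> r; n = real_of_ereal (nu \<rho> r);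
       m = (\<lambda>l. real_of_ereal (muH \<rho> r l));
       C = {(f, b, q). (f, b) \<in> pairF \<rho> r \<and> real q < b \<and> hcoef \<rho> r f q \<notin> I} in
     \<exists>N g e N' e'.
       (\<forall>(f, b, q)\<in>C. 0 < N (f, b, q)
          \<and> (\<forall>l\<in>excR \<rho> r. real (e (f, b, q) l) = real (N (f, b, q)) * (b - real q) * m l)
          \<and> hcoef \<rho> r f q ^ N (f, b, q)
              - (\<Prod>l\<in>excR \<rho> r. gens \<rho> l ^ e (f, b, q) l) * g (f, b, q) \<in> I)
       \<and> 0 < N' \<and> (\<forall>l\<in>excR \<rho> r. real (e' l) = real N' * m l)
       \<and> pairG \<rho> (Suc r) =
           (\<lambda>(f, b, q). (g (f, b, q), real (N (f, b, q)) * (b - real q) * n)) ` C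
           \<union> (if n < 1 then {(\<Prod>l\<in>excR \<rho> r. gens \<rho> l ^ e' l, real (N' :: nat) * (1 - n))} else {}))"

text \<open>\<open>\<rho> k\<close> is an outcome of the construction of the invariant at \<open>x\<^sub>k\<close>; the outcomes at the earlier points
  enter through the sets \<open>E\<^sup>r(x\<^sub>k)\<close>.\<close>

definition is_run :: "(nat \<Rightarrow> ('k::field_char_0, 'n::finite) mfps set)
    \<Rightarrow> (nat \<Rightarrow> nat \<Rightarrow> ('k, 'n) mfps set) \<Rightarrow> (nat \<Rightarrow> ('k, 'n) run) \<Rightarrow> nat \<Rightarrow> bool" where
  "is_run J dv \<rho> k \<longleftrightarrow>
     1 \<le> steps (\<rho> k)
     \<and> (\<forall>l\<in>exc_through dv k. dv k l = ideal_of {gens (\<rho> k) l})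
     \<and> exc_history J dv \<rho> k
     \<and> (\<exists>fs. standard_basis (J k) fs \<and> pairG (\<rho> k) 1 = (\<lambda>f. (f, real (nord f))) ` set fs)
     \<and> inj_on (idx (\<rho> k)) {1..steps (\<rho> k)}
     \<and> (\<forall>r\<in>{1..steps (\<rho> k)}.
          rsp (param (\<rho> k) r)
          \<and> (\<forall>i\<in>{1..r}. param (\<rho> k) r (idx (\<rho> k) i) = yy (\<rho> k) i)
          \<and> contact_step (\<rho> k) r
          \<and> normal_crossings (\<rho> k) r
          \<and> adapted (idN (\<rho> k) r) (param (\<rho> k) r) (uix (\<rho> k) r) (gens (\<rho> k)) (excR (\<rho> k) r)
          \<and> (nu (\<rho> k) r \<in> {0, \<infinity>} \<longleftrightarrow> r = steps (\<rho> k))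
          \<and> (r < steps (\<rho> k) \<longrightarrow> next_pair (\<rho> k) r))"

end

theory Submission
  imports Defs
begin

text \<open>Expanding in a regular system of parameters \<open>(u, y)\<close>, the exponents of a minimal expansion of \<open>f\<close>
  are the minimal exponents of its power series, so every linear functional with nonnegative
  coefficients has the same infimum over the projected polyhedron as over all monomials
  \<open>u\<^sup>A y\<^sup>B\<close> of \<open>f\<close> with \<open>B < b\<close>.  The coefficient of \<open>y\<^sup>q\<close> being \<open>\<partial>\<^sup>q f / q!\<close> at \<open>y = 0\<close>, this identifies
  \<open>\<mu>\<close> and the \<open>\<mu>\<^sub>H\<close> with \<open>\<delta>\<close> and the \<open>d\<^sub>i\<close> of the polyhedron.

  It remains to see that intersecting the polyhedra over all choices \<open>y'\<close> of \<open>y\<close> does not increase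
  \<open>\<delta>\<close>.  If \<open>y\<^sup>b\<close> occurs in the element \<open>f\<close> defining the maximal contact, the root \<open>\<eta>(u)\<close> of
  \<open>\<partial>\<^bsup>b-1\<^esup> f / \<partial>y\<^bsup>b-1\<^esup>\<close> gives a parameter \<open>y - \<eta>\<close> whose polyhedron lies in all the others, because \<open>f\<close> has no
  term of degree \<open>b - 1\<close> in it; and its \<open>\<delta>\<close> is at most that of \<open>y\<close>, because \<open>y\<close> itself is a derivative
  of order \<open>b - 1\<close> of \<open>f\<close>.  Otherwise \<open>\<delta> \<le> 1\<close>, and an initial form for which \<open>y\<close> has weight less than \<open>1\<close>,
  the weight of the \<open>u\<^sub>i\<close>, provides points common to all the polyhedra.\<close>

text \<open>The parameter \<open>y_r\<close> is a derivative of \<open>f\<close> in the Weierstrass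
  coordinates \<open>v\<close>, but the polyhedron is formed in the parameters
  \<open>(u, y_r)\<close> of \<open>t\<close>. The \<open>u_i\<close> need not belong to
  \<open>v\<close>, so the derivation may move them. This is harmless only when all
  \<open>u_i\<close> have weight 1, for then every nonconstant monomial weighs at least 1. Hence
  \<open>y_r\<close> is compared with other choices through \<delta> alone, and arbitrary
  half-spaces are compared only for the parameter \<open>y - \<eta>\<close>, whose own partial
  derivative kills the \<open>u_i\<close>. The same freedom of \<open>u\<close> can make
  \<open>y^b\<close> disappear from \<open>f\<close>: for \<open>f = w^2 - x^2\<close> one gets
  \<open>y = w\<close>, and with \<open>u = x + w\<close> this reads \<open>f = 2uy - u^2\<close>.
  The infimum over an intersection can exceed the infimum over each of the intersected sets. So an
  upper bound for it requires either one polyhedron inside all the others or explicit common points;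
  the two cases of the proof supply one each.\<close>

abbreviation "lookup \<equiv> Poly_Mapping.lookup"
abbreviation "keys \<equiv> Poly_Mapping.keys"
abbreviation "single \<equiv> Poly_Mapping.single"

interpretation ideal: module "(*) :: 'a::comm_ring_1 \<Rightarrow> 'a \<Rightarrow> 'a"
  by unfold_locales (simp_all add: algebra_simps)

declare ideal.scale_scale [simp del] \<comment> \<open>loops with associativity of \<open>(*)\<close>\<close>

section \<open>Exponents\<close>

definition mdeg :: "('n::finite \<Rightarrow>\<^sub>0 nat) \<Rightarrow> nat" where
  "mdeg m = (\<Sum>i\<in>UNIV. lookup m i)"

definition mle :: "('n \<Rightarrow>\<^sub>0 nat) \<Rightarrow> ('n \<Rightarrow>\<^sub>0 nat) \<Rightarrow> bool" where
  "mle m k \<longleftrightarrow> (\<forall>i. lookup m i \<le> lookup k i)"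

lemma mdeg_zero [simp]: "mdeg 0 = 0"
  by (simp add: mdeg_def)

lemma mdeg_add [simp]: "mdeg (a + b) = mdeg a + mdeg b"
  by (simp add: mdeg_def lookup_add sum.distrib)

lemma mdeg_single [simp]: "mdeg (single i n) = n"
  by (simp add: mdeg_def lookup_single when_def)

lemma mdeg_eq_0_iff [simp]: "mdeg m = 0 \<longleftrightarrow> m = 0"
  by (auto simp: mdeg_def poly_mapping_eq_iff fun_eq_iff)

lemma lookup_le_mdeg: "lookup m i \<le> mdeg m"
  by (simp add: mdeg_def member_le_sum)

lemma finite_mdeg_le [simp, intro]: "finite {m :: 'n::finite \<Rightarrow>\<^sub>0 nat. mdeg m \<le> N}"
proof -
  have "finite (PiE (UNIV :: 'n set) (\<lambda>i. {..N}))"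
    by (simp add: finite_PiE)
  moreover have "lookup ` {m :: 'n \<Rightarrow>\<^sub>0 nat. mdeg m \<le> N} \<subseteq> PiE UNIV (\<lambda>i. {..N})"
    using lookup_le_mdeg by (auto simp: PiE_def Pi_def extensional_def intro: order_trans)
  ultimately have "finite (lookup ` {m :: 'n \<Rightarrow>\<^sub>0 nat. mdeg m \<le> N})"
    by (rule rev_finite_subset)
  thus ?thesis by (rule finite_imageD) (simp add: inj_on_def)
qed

lemma finite_mdeg_less [simp, intro]: "finite {m :: 'n::finite \<Rightarrow>\<^sub>0 nat. mdeg m < N}"
  by (rule finite_subset[OF _ finite_mdeg_le[of N]]) auto

lemma mle_refl [simp]: "mle m m"
  by (simp add: mle_def)

lemma mle_trans: "mle a b \<Longrightarrow> mle b c \<Longrightarrow> mle a c"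
  by (meson mle_def order_trans)

lemma mle_add [simp]: "mle m (m + k)"
  by (simp add: mle_def lookup_add)

lemma mle_imp_add: "mle m k \<Longrightarrow> k = m + (k - m)"
  by (auto simp: mle_def poly_mapping_eq_iff fun_eq_iff lookup_add lookup_minus)

lemma mle_mdeg: "mle a b \<Longrightarrow> mdeg a \<le> mdeg b"
  by (simp add: mdeg_def mle_def sum_mono)

lemma mle_mdeg_eq: "mle a b \<Longrightarrow> mdeg a = mdeg b \<Longrightarrow> a = b"
  using mle_imp_add[of a b] by (metis add.right_neutral add_left_cancel mdeg_add mdeg_eq_0_iff)

lemma mle_single_iff [simp]: "mle (single i (Suc 0)) m \<longleftrightarrow> lookup m i \<noteq> 0"
  by (auto simp: mle_def lookup_single when_def)

lemma keys_add_nat: "keys (a + b :: 'n \<Rightarrow>\<^sub>0 nat) = keys a \<union> keys b"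
  by (auto simp: in_keys_iff lookup_add)

lemma mdeg_pos_split:
  fixes m :: "'n::finite \<Rightarrow>\<^sub>0 nat"
  assumes "m \<noteq> 0" obtains i k where "m = single i 1 + k" "lookup m i \<noteq> 0"
proof -
  from assms obtain i where i: "lookup m i \<noteq> 0"
    by (auto simp: poly_mapping_eq_iff fun_eq_iff)
  hence "mle (single i 1) m" by (simp add: mle_single_iff)
  from mle_imp_add[OF this] i that show thesis by blast
qed

lemma exponent_induct [case_names zero step]:
  assumes "P 0" "\<And>i k. P k \<Longrightarrow> P (single i 1 + k)"
  shows "P (m :: 'n::finite \<Rightarrow>\<^sub>0 nat)"
proof (induction "mdeg m" arbitrary: m)
  case 0 thus ?case using assms(1) by simp
next
  case (Suc d)
  hence "m \<noteq> 0" by auto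
  then obtain i k where m: "m = single i 1 + k" using mdeg_pos_split by blast
  with Suc have "P k" by (simp add: mdeg_add)
  thus ?case using m assms(2) by simp
qed

section \<open>Coefficients\<close>

lemma mcoeff_zero [simp]: "mcoeff 0 m = 0"
  by (simp add: zero_mfps_def)

lemma mcoeff_one: "mcoeff 1 m = (if m = 0 then 1 else 0)"
  by (simp add: one_mfps_def)

lemma mcoeff_add [simp]: "mcoeff (f + g) m = mcoeff f m + mcoeff g m"
  by (simp add: plus_mfps_def)

lemma mcoeff_diff [simp]: "mcoeff (f - g) m = mcoeff f m - mcoeff g m"
  by (simp add: minus_mfps_def)

lemma mcoeff_mult: "mcoeff (f * g) m = (\<Sum>(a, b)\<in>splits m. mcoeff f a * mcoeff g b)"
  by (simp add: times_mfps_def)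

lemma mcoeff_sum [simp]: "mcoeff (sum f X) m = (\<Sum>x\<in>X. mcoeff (f x) m)"
  by (induction X rule: infinite_finite_induct) auto

lemma splits_0 [simp]: "splits 0 = {(0, 0)}"
  by (auto simp: splits_def poly_mapping_eq_iff fun_eq_iff lookup_add)

lemma mcoeff_mult_0 [simp]: "mcoeff (f * g) 0 = mcoeff f 0 * mcoeff g 0"
  by (simp add: mcoeff_mult)

lemma mcoeff_Const: "mcoeff (Const c) m = (if m = 0 then c else 0)"
  by (simp add: Const_def)

lemma mcoeff_Const_mult [simp]: "mcoeff (Const c * f) m = c * mcoeff f m"
proof -
  have "mcoeff (Const c * f) m = (\<Sum>(a, b)\<in>splits m. if a = 0 then c * mcoeff f b else 0)"
    unfolding mcoeff_mult by (auto intro!: sum.cong simp: mcoeff_Const)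
  thus ?thesis by (simp add: splits_zero_sum)
qed

lemma Const_add: "Const (a + b) = Const a + Const b"
  and Const_mult: "Const (a * b) = Const a * Const b"
  and Const_0 [simp]: "Const 0 = 0"
  and Const_1 [simp]: "Const 1 = 1"
  by (rule mfps_eqI, simp add: mcoeff_Const mcoeff_one)+

lemma Const_of_nat: "Const (of_nat n) = of_nat n"
  by (induction n) (simp_all add: Const_add)

definition Mono :: "('n::finite \<Rightarrow>\<^sub>0 nat) \<Rightarrow> ('k::comm_ring_1, 'n) mfps" where
  "Mono m = Mfps (\<lambda>k. if k = m then 1 else 0)"

lemma mcoeff_Mono: "mcoeff (Mono m) k = (if k = m then 1 else 0)"
  by (simp add: Mono_def)

lemma mcoeff_Mono_mult_add [simp]: "mcoeff (Mono m * f) (m + k) = mcoeff f k"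
proof -
  have "mcoeff (Mono m * f) (m + k) = (\<Sum>(a, b)\<in>splits (m + k). if (a, b) = (m, k) then mcoeff f k else 0)"
    unfolding mcoeff_mult by (intro sum.cong) (auto simp: mcoeff_Mono splits_def)
  also have "\<dots> = (\<Sum>p\<in>splits (m + k). if p = (m, k) then mcoeff f k else 0)"
    by (rule sum.cong) (auto split: if_splits)
  also have "\<dots> = mcoeff f k"
    by (subst sum.delta[OF finite_splits, where a = "(m, k)" and b = "\<lambda>_. mcoeff f k"]) (simp add: splits_def)
  finally show ?thesis .
qed

lemma mcoeff_Mono_mult: "mcoeff (Mono m * f) k = (if mle m k then mcoeff f (k - m) else 0)"
proof (cases "mle m k")
  case True
  thus ?thesis using mcoeff_Mono_mult_add[of m f "k - m"] mle_imp_add[OF True] by simp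
next
  case False
  hence "a \<noteq> m" if "(a, b) \<in> splits k" for a b using that by (auto simp: splits_def)
  thus ?thesis using False unfolding mcoeff_mult by (auto intro!: sum.neutral simp: mcoeff_Mono)
qed

lemma Mono_0 [simp]: "Mono 0 = 1"
  by (rule mfps_eqI) (simp add: mcoeff_Mono mcoeff_one)

lemma monom_val_0 [simp]: "monom_val t 0 = 1"
  by (simp add: monom_val_def)

lemma monom_val_add: "monom_val t (a + b) = monom_val t a * monom_val t b"
  by (simp add: monom_val_def lookup_add power_add prod.distrib)

lemma monom_val_single [simp]: "monom_val t (single i n) = t i ^ n"
proof -
  have "monom_val t (single i n) = (\<Prod>j\<in>UNIV. if j = i then t i ^ n else 1)"
    unfolding monom_val_def by (intro prod.cong) (auto simp: lookup_single when_def)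
  thus ?thesis by simp
qed

text \<open>Grouping the monomials of \<open>f\<close> according to a chosen divisor among \<open>e x\<close>, \<open>x \<in> X\<close>.\<close>

lemma monomial_division:
  fixes f :: "('k::comm_ring_1, 'n::finite) mfps"
  assumes "finite X" and "\<And>m. mcoeff f m \<noteq> 0 \<Longrightarrow> c m \<in> X \<and> mle (e (c m)) m"
  shows "f = (\<Sum>x\<in>X. Mono (e x) * Mfps (\<lambda>k. if c (e x + k) = x then mcoeff f (e x + k) else 0))"
proof (rule mfps_eqI)
  fix m
  have "mcoeff (Mono (e x) * Mfps (\<lambda>k. if c (e x + k) = x then mcoeff f (e x + k) else 0)) m
      = (if mle (e x) m \<and> c m = x then mcoeff f m else 0)" for x
    using mle_imp_add[of "e x" m] by (auto simp: mcoeff_Mono_mult)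
  thus "mcoeff f m = mcoeff (\<Sum>x\<in>X. Mono (e x) * Mfps (\<lambda>k. if c (e x + k) = x then mcoeff f (e x + k) else 0)) m"
  proof -
    assume a: "\<And>x. mcoeff (Mono (e x) * Mfps (\<lambda>k. if c (e x + k) = x then mcoeff f (e x + k) else 0)) m
      = (if mle (e x) m \<and> c m = x then mcoeff f m else 0)"
    have "(\<Sum>x\<in>X. if mle (e x) m \<and> c m = x then mcoeff f m else 0)
        = (\<Sum>x\<in>X. if x = c m then mcoeff f m else 0)"
      using assms(2)[of m] by (intro sum.cong) auto
    also have "\<dots> = mcoeff f m"
      using assms by (auto simp: sum.delta)
    finally show ?thesis by (simp add: a)
  qed
qed

section \<open>Powers of the maximal ideal\<close>

text \<open>The power \<open>M^d\<close> of the maximal ideal, encoded by coefficients;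
  \<open>ideal_power_maxid\<close> connects the two.\<close>

definition van :: "nat \<Rightarrow> ('k::comm_ring_1, 'n::finite) mfps set" where
  "van d = {f. \<forall>m. mdeg m < d \<longrightarrow> mcoeff f m = 0}"

lemma van_0 [simp]: "van 0 = UNIV"
  by (simp add: van_def)

lemma van_antimono: "d \<le> e \<Longrightarrow> van e \<subseteq> van d"
  by (auto simp: van_def)

lemma van_mult:
  fixes f g :: "('k::comm_ring_1, 'n::finite) mfps"
  shows "f \<in> van d \<Longrightarrow> g \<in> van e \<Longrightarrow> f * g \<in> van (d + e)"
  unfolding van_def mem_Collect_eq mcoeff_mult
proof (intro allI impI sum.neutral ballI)
  fix m :: "'n \<Rightarrow>\<^sub>0 nat" and p
  assume f: "\<forall>m. mdeg m < d \<longrightarrow> mcoeff f m = 0" and g: "\<forall>m. mdeg m < e \<longrightarrow> mcoeff g m = 0"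
    and m: "mdeg m < d + e" and p: "p \<in> splits m"
  obtain a b where ab: "p = (a, b)" "a + b = m" using p by (auto simp: splits_def)
  hence "mdeg a < d \<or> mdeg b < e" using m by auto
  thus "(\<lambda>(a, b). mcoeff f a * mcoeff g b) p = 0" using f g ab by auto
qed

lemma is_ideal_van: "is_ideal (van d)"
proof (rule ideal.subspaceI)
  fix c x :: "('a, 'b) mfps" assume "x \<in> van d"
  thus "c * x \<in> van d" using van_mult[of c 0 x d] by simp
qed (auto simp: van_def)

lemmas van_add = ideal.subspace_add[OF is_ideal_van]
  and van_diff = ideal.subspace_diff[OF is_ideal_van]
  and van_sum = ideal.subspace_sum[OF is_ideal_van]
  and van_scale = ideal.subspace_scale[OF is_ideal_van]
  and van_zero [simp] = ideal.subspace_0[OF is_ideal_van]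

lemma van_Inter: "(\<And>d. f \<in> van d) \<Longrightarrow> f = 0"
  by (rule mfps_eqI) (auto simp: van_def)

lemma maxid_van: "maxid = van 1"
  by (auto simp: maxid_def van_def)

lemma Mono_van: "Mono m \<in> van (mdeg m)"
  by (auto simp: van_def mcoeff_Mono)

text \<open>Induction step for statements about \<open>van\<close>: a homomorphism or derivation is
  controlled in order \<open>d + 1\<close> by its values on the variables and in order
  \<open>d\<close>. Each monomial is assigned to a variable dividing it.\<close>

lemma van_Suc_split:
  assumes "f \<in> van (Suc d)"
  shows "\<exists>g. (\<forall>i. g i \<in> van d) \<and> f = (\<Sum>i\<in>UNIV. Mono (single i 1) * g i)"
proof -
  define c where "c m = (SOME i. lookup m i \<noteq> 0)" for m :: "'b \<Rightarrow>\<^sub>0 nat"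
  have c: "mle (single (c m) 1) m" if "mcoeff f m \<noteq> 0" for m
  proof -
    from that assms have "m \<noteq> 0" by (auto simp: van_def)
    hence "\<exists>i. lookup m i \<noteq> 0" by (auto simp: poly_mapping_eq_iff fun_eq_iff)
    hence "lookup m (c m) \<noteq> 0" unfolding c_def by (rule someI_ex)
    thus ?thesis by (simp add: mle_single_iff)
  qed
  define g where "g i = Mfps (\<lambda>k. if c (single i 1 + k) = i then mcoeff f (single i 1 + k) else 0)" for i
  have "g i \<in> van d" for i
    using assms by (auto simp: van_def g_def)
  moreover have "f = (\<Sum>i\<in>UNIV. Mono (single i 1) * g i)"
    unfolding g_def by (rule monomial_division) (use c in auto)
  ultimately show ?thesis by blast
qed

lemma ideal_power_mult:
  assumes "x \<in> I" "y \<in> ideal_power I k"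
  shows "x * y \<in> ideal_power I (Suc k)"
proof -
  define P where "P k = {prod_list xs | xs. length xs = k \<and> set xs \<subseteq> I}" for k
  have base: "x * z \<in> P (Suc k)" if z: "z \<in> P k" for z
  proof -
    obtain xs where "z = prod_list xs" "length xs = k" "set xs \<subseteq> I" using z unfolding P_def by blast
    thus ?thesis unfolding P_def mem_Collect_eq using assms(1) by (intro exI[of _ "x # xs"]) simp
  qed
  have "y \<in> ideal_of (P k)" using assms(2) by (simp add: ideal_power_def P_def)
  hence "x * y \<in> ideal_of (P (Suc k))"
  proof (induction rule: ideal.span_induct_alt)
    case base
    show ?case by (simp add: ideal.span_zero)
  next
    case (step c y z)
    have "c * (x * y) + x * z \<in> ideal_of (P (Suc k))"
      by (rule ideal.span_add[OF ideal.span_scale[OF ideal.span_base[OF base[OF step.hyps(1)]]] step.IH])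
    thus ?case by (simp only: distrib_left mult.left_commute)
  qed
  thus ?thesis by (simp add: ideal_power_def P_def)
qed

lemma is_ideal_ideal_power: "is_ideal (ideal_power I k)"
  unfolding ideal_power_def by (rule ideal.subspace_span)

lemma ideal_power_maxid: "ideal_power maxid k = (van k :: ('k::comm_ring_1, 'n::finite) mfps set)"
proof
  have prod: "prod_list xs \<in> van (length xs)" if "set xs \<subseteq> van 1" for xs :: "('k, 'n) mfps list"
    using that
  proof (induction xs)
    case (Cons x xs)
    hence "x * prod_list xs \<in> van (1 + length xs)" by (intro van_mult) auto
    thus ?case by simp
  qed simp
  show "ideal_power maxid k \<subseteq> (van k :: ('k, 'n) mfps set)"
    unfolding ideal_power_def maxid_van
    by (rule ideal.span_minimal[OF _ is_ideal_van]) (use prod in blast)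
  show "(van k :: ('k, 'n) mfps set) \<subseteq> ideal_power maxid k"
  proof (induction k)
    case 0
    have "(1 :: ('k, 'n) mfps) \<in> ideal_power maxid 0"
      unfolding ideal_power_def by (rule ideal.span_base) simp
    hence "f * 1 \<in> ideal_power maxid 0" for f :: "('k, 'n) mfps"
      by (rule ideal.subspace_scale[OF is_ideal_ideal_power])
    thus ?case by (metis mult.right_neutral subsetI)
  next
    case (Suc k)
    show ?case
    proof
      fix f :: "('k, 'n) mfps" assume "f \<in> van (Suc k)"
      then obtain g where g: "\<And>i. g i \<in> van k" "f = (\<Sum>i\<in>UNIV. Mono (single i 1) * g i)"
        using van_Suc_split by blast
      have "Mono (single i 1) \<in> (maxid :: ('k, 'n) mfps set)" for i
        using Mono_van[of "single i 1"] by (simp add: maxid_van)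
      hence "Mono (single i 1) * g i \<in> ideal_power maxid (Suc k)" for i
        using g(1) Suc by (intro ideal_power_mult) auto
      hence "(\<Sum>i\<in>UNIV. Mono (single i 1) * g i) \<in> ideal_power maxid (Suc k)"
        by (rule ideal.subspace_sum[OF is_ideal_ideal_power])
      thus "f \<in> ideal_power maxid (Suc k)" using g(2) by simp
    qed
  qed
qed

text \<open>The Neumann series: \<open>N\<close> raises the order, so
  \<open>g + N g + N (N g) + ...\<close> converges M-adically and solves \<open>f - N f = g\<close>.
  It serves for inverting units and for maps close to the identity.\<close>

lemma fixed_point_series:
  fixes N :: "('k::comm_ring_1, 'n::finite) mfps \<Rightarrow> ('k, 'n) mfps"
  assumes diff: "\<And>f g. N (f - g) = N f - N g"
    and van: "\<And>d f. f \<in> van d \<Longrightarrow> N f \<in> van (Suc d)"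
  shows "bij (\<lambda>f. f - N f)"
proof (rule bijI)
  show "inj (\<lambda>f. f - N f)"
  proof (rule injI)
    fix f g assume "f - N f = g - N g"
    hence "(f - N f) - (g - N g) = 0" by (simp only: diff_self)
    moreover have "(f - N f) - (g - N g) = (f - g) - N (f - g)" by (simp add: diff)
    ultimately have e: "f - g = N (f - g)" by simp
    have "f - g \<in> van d" for d :: nat
    proof (induction d)
      case (Suc d) show ?case by (subst e) (rule van[OF Suc])
    qed simp
    thus "f = g" using van_Inter[of "f - g"] by simp
  qed
  have N0: "N 0 = 0" using diff[of 0 0] by simp
  have plus: "N (f + g) = N f + N g" for f g
    using diff[of f "- g"] diff[of 0 g] N0 by simp
  have sum: "N (\<Sum>i<n. F i) = (\<Sum>i<n. N (F i))" for F and n :: nat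
    by (induction n) (simp_all add: N0 plus)
  show "surj (\<lambda>f. f - N f)"
  unfolding surj_def
  proof
    fix g
    have pow: "(N ^^ i) g \<in> van i" for i
      by (induction i) (auto intro: van)
    define F where "F n = (\<Sum>i<n. (N ^^ i) g)" for n
    \<comment> \<open>The limit of the partial sums: coefficients of degree \<open>d\<close> no
      longer change from \<open>F (d + 1)\<close> on.\<close>
    define f where "f = Mfps (\<lambda>k. mcoeff (F (Suc (mdeg k))) k)"
    have FF: "F (n + l) - F n \<in> van n" for n l
    proof (induction l)
      case (Suc l)
      have "(N ^^ (n + l)) g \<in> van n" using pow[of "n + l"] van_antimono[of n "n + l"] by auto
      hence "(F (n + l) - F n) + (N ^^ (n + l)) g \<in> van n" using Suc by (rule van_add[rotated])
      thus ?case by (simp add: F_def algebra_simps)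
    qed simp
    have fF: "f - F n \<in> van n" for n
      unfolding van_def
    proof (clarify)
      fix m :: "'n \<Rightarrow>\<^sub>0 nat" assume "mdeg m < n"
      then obtain l where "n = Suc (mdeg m) + l" using less_imp_Suc_add by (metis add_Suc)
      with FF[of "Suc (mdeg m)" l] show "mcoeff (f - F n) m = 0"
        by (auto simp: van_def f_def)
    qed
    have "f - N f - g \<in> van n" for n
    proof -
      have "f - N f - g = (f - F n) - N (f - F n) + (F n - N (F n) - g)"
        by (simp add: diff)
      moreover have "F n - N (F n) - g = - (N ^^ n) g"
      proof -
        have "N (F n) + g = (\<Sum>i<n. (N ^^ Suc i) g) + g" by (simp add: F_def sum)
        also have "\<dots> = (\<Sum>i<Suc n. (N ^^ i) g)" by (subst sum.lessThan_Suc_shift) simp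
        also have "\<dots> = F n + (N ^^ n) g" by (simp add: F_def)
        finally have "F n + (N ^^ n) g - (N (F n) + g) = 0" by simp
        thus ?thesis by (simp add: algebra_simps)
      qed
      moreover have "N (f - F n) \<in> van n" using van[OF fF, of n] van_antimono[of n "Suc n"] by auto
      moreover have "- (N ^^ n) g \<in> van n" using pow by (intro ideal.subspace_neg is_ideal_van)
      ultimately show ?thesis using fF[of n] van_add van_diff by metis
    qed
    hence "f - N f - g = 0" by (rule van_Inter)
    thus "\<exists>f. g = f - N f" by (intro exI[of _ f]) simp
  qed
qed

lemma is_unit_mfps:
  fixes f :: "('k::field, 'n::finite) mfps"
  assumes "f \<notin> maxid" shows "\<exists>g. f * g = 1 \<and> g \<notin> maxid"
proof -
  define c where "c = mcoeff f 0"
  have c: "c \<noteq> 0" using assms by (simp add: maxid_def c_def)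
  \<comment> \<open>\<open>f\<close> is \<open>c\<close> times \<open>1 - h\<close> with
    \<open>h\<close> in the maximal ideal, so a solution of \<open>1 = g - h * g\<close> inverts
    \<open>f\<close> up to the constant.\<close>
  define h where "h = 1 - Const (inverse c) * f"
  have "mcoeff h 0 = 0" using c by (simp add: h_def mcoeff_one mcoeff_Const c_def)
  hence h: "h \<in> van 1" by (simp add: van_def)
  have "surj (\<lambda>g. g - h * g)"
  proof (rule bij_is_surj, rule fixed_point_series)
    show "h * f \<in> van (Suc d)" if "f \<in> van d" for d f
      using van_mult[OF h that] by simp
  qed (rule right_diff_distrib)
  then obtain g where g: "1 = g - h * g" by (rule surjE)
  have e: "g - h * g = f * (Const (inverse c) * g)"
    unfolding h_def left_diff_distrib mult_1_left diff_diff_eq2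
    by (simp only: mult.assoc mult.left_commute add_diff_cancel_left')
  have 1: "f * (Const (inverse c) * g) = 1" by (rule trans[OF sym[OF e] sym[OF g]])
  have "Const (inverse c) * g \<notin> maxid"
  proof
    assume "Const (inverse c) * g \<in> maxid"
    hence 0: "mcoeff (Const (inverse c) * g) 0 = 0" unfolding maxid_def by (rule CollectD)
    have "mcoeff (f * (Const (inverse c) * g)) 0 = mcoeff (1 :: ('k, 'n) mfps) 0"
      by (rule arg_cong[where f = "\<lambda>x. mcoeff x 0", OF 1])
    thus False unfolding mcoeff_mult_0[of f] 0 mcoeff_one by simp
  qed
  thus ?thesis using 1 by (intro exI[of _ "Const (inverse c) * g"] conjI)
qed

section \<open>Substitution of a regular system of parameters\<close>

definition cont_hom :: "(('k::comm_ring_1, 'n::finite) mfps \<Rightarrow> ('k, 'n) mfps) \<Rightarrow> bool" where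
  "cont_hom \<phi> \<longleftrightarrow> kalg_hom \<phi> \<and> (\<forall>d. \<forall>f\<in>van d. \<phi> f \<in> van d)"

lemma kalg_homD:
  assumes "kalg_hom \<phi>"
  shows "\<phi> (f + g) = \<phi> f + \<phi> g" "\<phi> (f * g) = \<phi> f * \<phi> g" "\<phi> (Const c) = Const c" "\<phi> 0 = 0" "\<phi> 1 = 1"
    "\<phi> (- f) = - \<phi> f" "\<phi> (f - g) = \<phi> f - \<phi> g" "\<phi> (sum F X) = (\<Sum>x\<in>X. \<phi> (F x))"
proof -
  show plus: "\<phi> (f + g) = \<phi> f + \<phi> g" for f g using assms by (simp add: kalg_hom_def)
  show times: "\<phi> (f * g) = \<phi> f * \<phi> g" for f g using assms by (simp add: kalg_hom_def)
  show c: "\<phi> (Const c) = Const c" for c using assms by (simp add: kalg_hom_def)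
  show 0: "\<phi> 0 = 0" using c[of 0] by simp
  show 1: "\<phi> 1 = 1" using c[of 1] by simp
  show minus: "\<phi> (- f) = - \<phi> f" for f
    using plus[of f "- f"] 0 by (simp add: eq_neg_iff_add_eq_0 add.commute)
  show "\<phi> (f - g) = \<phi> f - \<phi> g" using plus[of f "- g"] minus by simp
  show "\<phi> (sum F X) = (\<Sum>x\<in>X. \<phi> (F x))"
    by (induction X rule: infinite_finite_induct) (simp_all add: 0 plus)
qed

lemma van_eqI: "(\<And>N. f - g \<in> van N) \<Longrightarrow> f = g"
  using van_Inter[of "f - g"] by simp

lemma monom_val_van:
  fixes t :: "'n::finite \<Rightarrow> ('k::comm_ring_1, 'n) mfps"
  assumes "\<And>i. t i \<in> maxid" shows "monom_val t m \<in> van (mdeg m)"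
proof (induction m rule: exponent_induct)
  case (step i k)
  have "t i * monom_val t k \<in> van (1 + mdeg k)"
    using assms step by (intro van_mult) (simp_all add: maxid_van)
  thus ?case by (simp add: monom_val_add)
qed simp

lemma mcoeff_sum_Mono: "mcoeff (\<Sum>m | mdeg m < N. Const (mcoeff f m) * Mono m) k
    = (if mdeg k < N then mcoeff f k else 0)"
proof -
  have "mcoeff (\<Sum>m | mdeg m < N. Const (mcoeff f m) * Mono m) k
      = (\<Sum>m | mdeg m < N. if m = k then mcoeff f k else 0)"
    unfolding mcoeff_sum by (intro sum.cong) (auto simp: mcoeff_Mono)
  thus ?thesis by (simp add: sum.delta)
qed

lemma truncation: "f - (\<Sum>m | mdeg m < N. Const (mcoeff f m) * Mono m) \<in> van N"
  unfolding van_def by (simp add: mcoeff_sum_Mono del: mcoeff_sum)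

text \<open>If all \<open>t i\<close> lie in the maximal ideal, \<open>monom_val t m\<close> has
  order at least \<open>mdeg m\<close> and contributes nothing to coefficients of smaller degree;
  cutting the sum there keeps it finite.\<close>

definition substitute :: "('n \<Rightarrow> ('k::comm_ring_1, 'n::finite) mfps) \<Rightarrow> ('k, 'n) mfps \<Rightarrow> ('k, 'n) mfps" where
  "substitute t f = Mfps (\<lambda>k. \<Sum>m | mdeg m \<le> mdeg k. mcoeff f m * mcoeff (monom_val t m) k)"

lemma substitute_add: "substitute t (f + g) = substitute t f + substitute t g"
  by (rule mfps_eqI) (simp add: substitute_def distrib_right sum.distrib)

lemma substitute_diff: "substitute t (f - g) = substitute t f - substitute t g"
  by (rule mfps_eqI) (simp add: substitute_def left_diff_distrib sum_subtractf)

lemma substitute_scale: "substitute t (Const c * f) = Const c * substitute t f"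
  by (rule mfps_eqI)
    (simp only: substitute_def mcoeff_Mfps mcoeff_Const_mult mult.assoc sum_distrib_left)

lemma substitute_sum: "substitute t (sum F X) = (\<Sum>x\<in>X. substitute t (F x))"
proof -
  have "substitute t 0 = 0" by (rule mfps_eqI) (simp add: substitute_def)
  thus ?thesis by (induction X rule: infinite_finite_induct) (simp_all add: substitute_add)
qed

lemma substitute_van: "f \<in> van d \<Longrightarrow> substitute t f \<in> van d"
  by (auto simp: van_def substitute_def intro!: sum.neutral)

context
  fixes t :: "'n::finite \<Rightarrow> ('k::comm_ring_1, 'n) mfps"
  assumes t: "\<And>i. t i \<in> maxid"
begin

lemma substitute_approx:
  "substitute t f - (\<Sum>m | mdeg m < N. Const (mcoeff f m) * monom_val t m) \<in> van N"
proof -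
  have "(\<Sum>m | mdeg m \<le> mdeg k. mcoeff f m * mcoeff (monom_val t m) k)
      = (\<Sum>m | mdeg m < N. mcoeff f m * mcoeff (monom_val t m) k)" if "mdeg k < N" for k
  proof (rule sum.mono_neutral_left)
    show "\<forall>m\<in>{m. mdeg m < N} - {m. mdeg m \<le> mdeg k}. mcoeff f m * mcoeff (monom_val t m) k = 0"
      using monom_val_van[of t, OF t] by (auto simp: van_def)
  qed (use that in auto)
  thus ?thesis by (simp add: van_def substitute_def)
qed

lemma substitute_Mono_mult: "substitute t (Mono a * f) = monom_val t a * substitute t f"
proof (rule van_eqI)
  fix N
  let ?S = "\<lambda>f N. \<Sum>m | mdeg m < N. Const (mcoeff f m) * monom_val t m"
  have "?S (Mono a * f) (N + mdeg a)
      = (\<Sum>m\<in>(+) a ` {k. mdeg k < N}. Const (mcoeff (Mono a * f) m) * monom_val t m)"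
  proof (rule sum.mono_neutral_right)
    show "\<forall>m\<in>{m. mdeg m < N + mdeg a} - (+) a ` {k. mdeg k < N}. Const (mcoeff (Mono a * f) m) * monom_val t m = 0"
    proof
      fix m assume m: "m \<in> {m. mdeg m < N + mdeg a} - (+) a ` {k. mdeg k < N}"
      have "\<not> mle a m"
      proof
        assume "mle a m"
        from mle_imp_add[OF this] obtain k where k: "m = a + k" by blast
        with m have "mdeg k < N" by auto
        with m k show False by auto
      qed
      thus "Const (mcoeff (Mono a * f) m) * monom_val t m = 0" by (simp add: mcoeff_Mono_mult)
    qed
  qed auto
  also have "\<dots> = (\<Sum>k | mdeg k < N. Const (mcoeff f k) * (monom_val t a * monom_val t k))"
    by (subst sum.reindex) (auto simp: inj_on_def monom_val_add)
  also have "\<dots> = monom_val t a * ?S f N"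
    unfolding sum_distrib_left by (rule sum.cong[OF refl]) (rule mult.left_commute)
  finally have e: "?S (Mono a * f) (N + mdeg a) = monom_val t a * ?S f N" .
  have "substitute t (Mono a * f) - ?S (Mono a * f) (N + mdeg a) \<in> van N"
    using substitute_approx[of "Mono a * f" "N + mdeg a"] van_antimono[of N "N + mdeg a"] by auto
  moreover have "monom_val t a * (substitute t f - ?S f N) \<in> van N"
    by (intro van_scale substitute_approx)
  ultimately have "substitute t (Mono a * f) - ?S (Mono a * f) (N + mdeg a)
      - monom_val t a * (substitute t f - ?S f N) \<in> van N" by (rule van_diff)
  thus "substitute t (Mono a * f) - monom_val t a * substitute t f \<in> van N"
    unfolding e by (simp add: right_diff_distrib)
qed

lemma substitute_1 [simp]: "substitute t 1 = 1"
proof (rule van_eqI)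
  fix N
  have "(\<Sum>m | mdeg m < N. Const (mcoeff (1 :: ('k, 'n) mfps) m) * monom_val t m)
      = (\<Sum>m\<in>{m. mdeg m < N}. if m = (0 :: 'n \<Rightarrow>\<^sub>0 nat) then 1 else 0)"
    by (intro sum.cong) (auto simp: mcoeff_one)
  also have "\<dots> = (if 0 < N then 1 else 0)" by (simp add: sum.delta)
  finally show "substitute t 1 - 1 \<in> van N"
    using substitute_approx[of 1 N] by (cases "0 < N") simp_all
qed

lemma substitute_Const: "substitute t (Const c) = Const c"
  using substitute_scale[of t c 1] by simp

lemma substitute_Mono: "substitute t (Mono a) = monom_val t a"
  using substitute_Mono_mult[of a 1] by simp

lemma substitute_mult: "substitute t (f * g) = substitute t f * substitute t g"
proof (rule van_eqI)
  fix N
  \<comment> \<open>Multiplicativity is known when one factor is a monomial, hence for the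
    polynomial \<open>P\<close>; the rest of \<open>f\<close> has order at least
    \<open>N\<close>.\<close>
  define P where "P = (\<Sum>m | mdeg m < N. Const (mcoeff f m) * Mono m)"
  have r: "f - P \<in> van N" unfolding P_def by (rule truncation)
  have P: "substitute t (P * g) = substitute t P * substitute t g"
    unfolding P_def sum_distrib_right substitute_sum mult.assoc substitute_scale substitute_Mono_mult
      substitute_Mono ..
  have "substitute t (f * g) - substitute t f * substitute t g
      = substitute t ((f - P) * g) - substitute t (f - P) * substitute t g"
    by (simp add: left_diff_distrib substitute_diff P)
  moreover have "substitute t ((f - P) * g) \<in> van N"
    using van_scale[OF r, of g] by (intro substitute_van) (simp add: mult.commute)
  moreover have "substitute t (f - P) * substitute t g \<in> van N"
    using van_scale[OF substitute_van[OF r], of "substitute t g" t] by (simp add: mult.commute)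
  ultimately show "substitute t (f * g) - substitute t f * substitute t g \<in> van N"
    using van_diff by simp
qed

lemma cont_hom_substitute: "cont_hom (substitute t)"
  unfolding cont_hom_def kalg_hom_def
  by (simp add: substitute_add substitute_mult substitute_Const substitute_van)

end

lemma cont_hom_compose: "cont_hom \<phi> \<Longrightarrow> cont_hom \<psi> \<Longrightarrow> cont_hom (\<phi> \<circ> \<psi>)"
  unfolding cont_hom_def kalg_hom_def by simp

lemma const_split: "f - Const (mcoeff f 0) \<in> van 1"
  by (simp add: van_def mcoeff_Const)

text \<open>The difference \<open>id - \<phi>\<close> raises the order, by induction through
  \<open>van_Suc_split\<close>: a difference of products splits into a variable times a difference
  of cofactors, and \<open>\<phi> x - x\<close>, of order at least 2, times a cofactor. Then \<phi>
  is the identity minus such a map.\<close>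

lemma near_identity_bij:
  fixes \<phi> :: "('k::comm_ring_1, 'n::finite) mfps \<Rightarrow> ('k, 'n) mfps"
  assumes "cont_hom \<phi>" and X: "\<And>i. \<phi> (Mono (single i 1)) - Mono (single i 1) \<in> van 2"
  shows "bij \<phi>"
proof -
  have hom: "kalg_hom \<phi>" and van: "\<And>d f. f \<in> van d \<Longrightarrow> \<phi> f \<in> van d"
    using assms by (auto simp: cont_hom_def)
  note h = kalg_homD[OF hom]
  have N: "f - \<phi> f \<in> van (Suc d)" if "f \<in> van d" for f d
    using that
  proof (induction d arbitrary: f)
    case 0
    define r where "r = f - Const (mcoeff f 0)"
    have "f = Const (mcoeff f 0) + r" by (simp add: r_def)
    hence "f - \<phi> f = (Const (mcoeff f 0) + r) - \<phi> (Const (mcoeff f 0) + r)" by simp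
    also have "\<dots> = r - \<phi> r" by (simp add: h)
    also have "\<dots> \<in> van 1" using const_split[of f] by (intro van_diff van) (simp_all add: r_def)
    finally show ?case by simp
  next
    case (Suc d)
    then obtain g where g: "\<And>i. g i \<in> van d" "f = (\<Sum>i\<in>UNIV. Mono (single i 1) * g i)"
      using van_Suc_split by blast
    let ?X = "\<lambda>i. Mono (single i 1) :: ('k, 'n) mfps"
    have "f - \<phi> f = (\<Sum>i\<in>UNIV. ?X i * g i - \<phi> (?X i) * \<phi> (g i))"
      unfolding g(2) by (simp add: h sum_subtractf)
    also have "\<dots> = (\<Sum>i\<in>UNIV. ?X i * (g i - \<phi> (g i)) - (\<phi> (?X i) - ?X i) * \<phi> (g i))"
      by (intro sum.cong) (simp_all add: algebra_simps)
    also have "\<dots> \<in> van (Suc (Suc d))"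
    proof (intro van_sum van_diff)
      fix i
      have "Mono (single i 1) * (g i - \<phi> (g i)) \<in> van (1 + Suc d)"
        using Mono_van[of "single i 1"] Suc.IH[OF g(1)] by (intro van_mult) simp_all
      thus "Mono (single i 1) * (g i - \<phi> (g i)) \<in> van (Suc (Suc d))" by simp
      have "(\<phi> (?X i) - ?X i) * \<phi> (g i) \<in> van (2 + d)"
        using X van g(1) by (intro van_mult) auto
      thus "(\<phi> (?X i) - ?X i) * \<phi> (g i) \<in> van (Suc (Suc d))" by simp
    qed
    finally show ?case .
  qed
  have "bij (\<lambda>f. f - (f - \<phi> f))"
    by (rule fixed_point_series) (auto simp: h N)
  moreover have "(\<lambda>f. f - (f - \<phi> f)) = \<phi>" by (simp add: fun_eq_iff)
  ultimately show ?thesis by simp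
qed

lemma ideal_of_image_sum:
  fixes W :: "'n::finite set"
  assumes "f \<in> ideal_of (t ` W)" shows "\<exists>a. f = (\<Sum>j\<in>W. a j * t j)"
  using assms
proof (induction rule: ideal.span_induct)
  case base
  show ?case
  proof (rule ideal.subspaceI)
    show "0 \<in> {x. \<exists>a. x = (\<Sum>j\<in>W. a j * t j)}" by (auto intro!: exI[of _ "\<lambda>_. 0"])
    show "x + y \<in> {x. \<exists>a. x = (\<Sum>j\<in>W. a j * t j)}"
      if "x \<in> {x. \<exists>a. x = (\<Sum>j\<in>W. a j * t j)}" "y \<in> {x. \<exists>a. x = (\<Sum>j\<in>W. a j * t j)}" for x y
      using that by (auto simp flip: sum.distrib distrib_right)
    show "c * x \<in> {x. \<exists>a. x = (\<Sum>j\<in>W. a j * t j)}" if "x \<in> {x. \<exists>a. x = (\<Sum>j\<in>W. a j * t j)}" for c x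
      using that by (auto simp: sum_distrib_left simp flip: mult.assoc)
  qed
next
  case (step x)
  then obtain i where i: "i \<in> W" "x = t i" by auto
  have "(\<Sum>j\<in>W. (if j = i then 1 else 0) * t j) = (\<Sum>j\<in>W. if j = i then t i else 0)"
    by (intro sum.cong) auto
  thus ?case using i by (intro exI[of _ "\<lambda>j. if j = i then 1 else 0"]) (simp add: sum.delta)
qed

lemma mdeg_less_2: "mdeg m < 2 \<longleftrightarrow> m = 0 \<or> (\<exists>k. m = single k 1)"
proof
  assume m: "mdeg m < 2"
  show "m = 0 \<or> (\<exists>k. m = single k 1)"
  proof (cases "m = 0")
    case False
    then obtain i k where e: "m = single i 1 + k" using mdeg_pos_split by blast
    hence "mdeg k = 0" using m by simp
    thus ?thesis using e by auto
  qed simp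
qed auto

lemma van_2_iff: "f \<in> van 2 \<longleftrightarrow> mcoeff f 0 = 0 \<and> (\<forall>k. mcoeff f (single k 1) = 0)"
  unfolding van_def mdeg_less_2 by auto

lemma mcoeff_mult_linear:
  assumes "f \<in> van 1"
  shows "mcoeff (c * f) (single k 1) = mcoeff c 0 * mcoeff f (single k 1)"
proof -
  have "(c - Const (mcoeff c 0)) * f \<in> van (1 + 1)"
    using const_split assms by (intro van_mult)
  hence "mcoeff ((c - Const (mcoeff c 0)) * f) (single k 1) = 0"
    by (simp add: van_def)
  thus ?thesis by (simp add: left_diff_distrib)
qed

lemma single_one_inject [simp]: "single i (Suc 0) = single j (Suc 0) \<longleftrightarrow> i = j"
  by (metis lookup_single_eq lookup_single_not_eq zero_neq_one One_nat_def)

lemma mcoeff_substitute_linear: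
  fixes s :: "'n::finite \<Rightarrow> ('k::comm_ring_1, 'n) mfps"
  shows "mcoeff (substitute s f) (single k 1) = (\<Sum>j\<in>UNIV. mcoeff f (single j 1) * mcoeff (s j) (single k 1))"
proof -
  have set: "{m. mdeg m \<le> mdeg (single k 1)} = insert 0 ((\<lambda>j. single j 1) ` UNIV)" (is "?A = _")
    using mdeg_less_2 by (auto simp: less_Suc_eq_le numeral_2_eq_2)
  have nz: "single j (1::nat) \<noteq> 0" for j :: 'n
    by (metis lookup_single_eq lookup_zero zero_neq_one)
  have 0: "mcoeff (1 :: ('k, 'n) mfps) (single k 1) = 0" using nz by (simp add: mcoeff_one)
  have "mcoeff (substitute s f) (single k 1) = (\<Sum>m\<in>?A. mcoeff f m * mcoeff (monom_val s m) (single k 1))"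
    by (simp add: substitute_def)
  also have "\<dots> = (\<Sum>m\<in>(\<lambda>j. single j 1) ` UNIV. mcoeff f m * mcoeff (monom_val s m) (single k 1))"
    unfolding set using nz 0 by (subst sum.insert) auto
  also have "\<dots> = (\<Sum>j\<in>UNIV. mcoeff f (single j 1) * mcoeff (s j) (single k 1))"
    by (subst sum.reindex) (auto simp: inj_on_def)
  finally show ?thesis .
qed

lemma rsp_maxid: "rsp t \<Longrightarrow> t i \<in> maxid"
  unfolding rsp_def by (metis ideal.span_base rangeI)

text \<open>The inverse function theorem. The constant terms of the coefficients that express the
  variables through \<open>t\<close> form a left inverse \<open>A\<close> of the Jacobian matrix
  \<open>L\<close>, two-sided since the matrices are square over a field. Composing with the linear
  substitution \<open>s\<close> given by \<open>A\<close>, on either side, yields a map close to the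
  identity.\<close>

lemma bij_substitute:
  fixes t :: "'n::finite \<Rightarrow> ('k::field, 'n) mfps"
  assumes "rsp t" shows "bij (substitute t)"
proof -
  have t: "t i \<in> maxid" for i using rsp_maxid[OF assms] .
  let ?X = "\<lambda>i. Mono (single i 1) :: ('k, 'n) mfps"
  have "?X i \<in> maxid" for i using Mono_van[of "single i 1"] by (simp add: maxid_van)
  hence "\<exists>a. ?X i = (\<Sum>j\<in>UNIV. a j * t j)" for i
    using assms ideal_of_image_sum[of "?X i" t UNIV] unfolding rsp_def by simp
  then obtain a where a: "\<And>i. ?X i = (\<Sum>j\<in>UNIV. a i j * t j)" by metis
  define L :: "'k ^ 'n ^ 'n" where "L = (\<chi> i j. mcoeff (t i) (single j 1))"
  define A :: "'k ^ 'n ^ 'n" where "A = (\<chi> i j. mcoeff (a i j) 0)"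
  have X: "mcoeff (?X i) (single k 1) = mat 1 $ i $ k" for i k
    by (auto simp: mcoeff_Mono mat_def)
  have "(A ** L) $ i $ k = mat 1 $ i $ k" for i k
  proof -
    have "mcoeff (?X i) (single k 1) = (\<Sum>j\<in>UNIV. mcoeff (a i j) 0 * mcoeff (t j) (single k 1))"
      unfolding a mcoeff_sum using t by (intro sum.cong mcoeff_mult_linear) (auto simp: maxid_van)
    thus ?thesis unfolding X by (simp add: matrix_matrix_mult_def A_def L_def)
  qed
  hence AL: "A ** L = mat 1" by (simp add: vec_eq_iff)
  hence LA: "L ** A = mat 1" using matrix_left_right_inverse by blast
  define s where "s i = (\<Sum>j\<in>UNIV. Const (A $ i $ j) * ?X j)" for i
  have s1: "mcoeff (s i) (single k 1) = A $ i $ k" for i k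
    unfolding s_def mcoeff_sum mcoeff_Const_mult X by (simp add: mat_def if_distrib cong: if_cong)
  have s: "s i \<in> maxid" for i
    unfolding s_def maxid_van using Mono_van[of "single _ 1"] by (intro van_sum van_scale) simp
  have st: "bij (substitute s \<circ> substitute t)"
  proof (rule near_identity_bij[OF cont_hom_compose[OF cont_hom_substitute[of s, OF s] cont_hom_substitute[of t, OF t]]])
    fix i
    have e: "(substitute s \<circ> substitute t) (?X i) = substitute s (t i)"
      using substitute_Mono[of t, OF t] by simp
    have "substitute s (t i) \<in> van 1" using t by (intro substitute_van) (simp add: maxid_van)
    hence "mcoeff (substitute s (t i)) 0 = 0" by (simp add: van_def)
    moreover have "mcoeff (substitute s (t i)) (single k 1) = mat 1 $ i $ k" for k
      unfolding mcoeff_substitute_linear s1 LA[symmetric] by (simp add: matrix_matrix_mult_def L_def)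
    moreover have "mcoeff (?X i) 0 = 0" using Mono_van[of "single i 1"] by (simp add: van_def)
    ultimately show "(substitute s \<circ> substitute t) (?X i) - ?X i \<in> van 2"
      unfolding e van_2_iff mcoeff_diff X by simp
  qed
  have ts: "bij (substitute t \<circ> substitute s)"
  proof (rule near_identity_bij[OF cont_hom_compose[OF cont_hom_substitute[of t, OF t] cont_hom_substitute[of s, OF s]]])
    fix i
    have e: "(substitute t \<circ> substitute s) (?X i) = substitute t (s i)"
      using substitute_Mono[of s, OF s] by simp
    have "substitute t (s i) \<in> van 1" using s by (intro substitute_van) (simp add: maxid_van)
    hence "mcoeff (substitute t (s i)) 0 = 0" by (simp add: van_def)
    moreover have "mcoeff (substitute t (s i)) (single k 1) = mat 1 $ i $ k" for k
      unfolding mcoeff_substitute_linear s1 AL[symmetric] by (simp add: matrix_matrix_mult_def L_def)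
    moreover have "mcoeff (?X i) 0 = 0" using Mono_van[of "single i 1"] by (simp add: van_def)
    ultimately show "(substitute t \<circ> substitute s) (?X i) - ?X i \<in> van 2"
      unfolding e van_2_iff mcoeff_diff X by simp
  qed
  show ?thesis
  proof (rule bijI)
    show "inj (substitute t)" using bij_is_inj[OF st] by (rule inj_on_imageI2)
    show "surj (substitute t)"
      unfolding surj_def
    proof
      fix y
      from bij_is_surj[OF ts] obtain x where "y = (substitute t \<circ> substitute s) x" by (rule surjE)
      thus "\<exists>x. y = substitute t x" by (simp add: exI[of _ "substitute s x"])
    qed
  qed
qed

section \<open>Coefficients with respect to a regular system of parameters\<close>

definition tc :: "('n \<Rightarrow> ('k::comm_ring_1, 'n::finite) mfps) \<Rightarrow> ('k, 'n) mfps \<Rightarrow> ('n \<Rightarrow>\<^sub>0 nat) \<Rightarrow> 'k" where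
  "tc t f = mcoeff (inv (substitute t) f)"

text \<open>The exponents of the expansion in \<open>t\<close> of the class of \<open>f\<close> modulo \<open>\<langle>t\<^sub>i : i \<in> W\<rangle>\<close>.\<close>

definition supp :: "('n \<Rightarrow> ('k::comm_ring_1, 'n::finite) mfps) \<Rightarrow> 'n set \<Rightarrow> ('k, 'n) mfps \<Rightarrow> ('n \<Rightarrow>\<^sub>0 nat) set" where
  "supp t W f = {m. keys m \<inter> W = {} \<and> tc t f m \<noteq> 0}"

lemma kalg_hom_inv:
  assumes "kalg_hom \<phi>" "bij \<phi>" shows "kalg_hom (inv \<phi>)"
proof -
  note h = kalg_homD[OF assms(1)]
  have inv: "inv \<phi> y = x \<longleftrightarrow> y = \<phi> x" for x y
    using assms(2) by (auto simp: bij_is_surj surj_f_inv_f bij_is_inj inv_f_f)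
  have "\<phi> (inv \<phi> y) = y" for y by (metis inv)
  thus ?thesis unfolding kalg_hom_def inv h by simp
qed

context
  fixes t :: "'n::finite \<Rightarrow> ('k::field, 'n) mfps"
  assumes rsp: "rsp t"
begin

lemma kalg_hom_substitute: "kalg_hom (substitute t)"
  using cont_hom_substitute[of t, OF rsp_maxid[OF rsp]] by (simp add: cont_hom_def)

lemma kalg_hom_inv_substitute: "kalg_hom (inv (substitute t))"
  by (intro kalg_hom_inv kalg_hom_substitute bij_substitute rsp)

lemma substitute_inv: "substitute t (inv (substitute t) f) = f"
  by (simp add: bij_is_surj[OF bij_substitute[OF rsp]] surj_f_inv_f)

lemma inv_substitute: "inv (substitute t) (substitute t f) = f"
  by (simp add: bij_is_inj[OF bij_substitute[OF rsp]] inv_f_f)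

lemma substitute_monomial: "substitute t (Mono m) = monom_val t m"
  by (rule substitute_Mono) (rule rsp_maxid[OF rsp])

lemma inv_monom_val: "inv (substitute t) (monom_val t m) = Mono m"
  by (metis inv_substitute substitute_monomial)

lemma tc_substitute: "tc t (substitute t f) = mcoeff f"
  by (simp add: tc_def inv_substitute)

lemma tc_eqI: "(\<And>m. tc t f m = tc t g m) \<Longrightarrow> f = g"
  unfolding tc_def by (metis mfps_eqI substitute_inv)

lemma tc_zero: "tc t 0 m = 0"
  and tc_add: "tc t (f + g) m = tc t f m + tc t g m"
  and tc_diff: "tc t (f - g) m = tc t f m - tc t g m"
  and tc_Const: "tc t (Const c) m = (if m = 0 then c else 0)"
  and tc_mult: "tc t (f * g) m = (\<Sum>(a, b)\<in>splits m. tc t f a * tc t g b)"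
  and tc_sum: "tc t (sum F X) m = (\<Sum>x\<in>X. tc t (F x) m)"
  and tc_monom_val: "tc t (monom_val t k) m = (if m = k then 1 else 0)"
  unfolding tc_def
  by (simp_all add: kalg_homD[OF kalg_hom_inv_substitute] mcoeff_Const mcoeff_mult inv_monom_val mcoeff_Mono)

lemma tc_scale: "tc t (Const c * f) m = c * tc t f m"
  unfolding tc_def by (simp add: kalg_homD[OF kalg_hom_inv_substitute])

lemma tc_monom_val_mult: "tc t (monom_val t a * f) m = (if mle a m then tc t f (m - a) else 0)"
  unfolding tc_def kalg_homD(2)[OF kalg_hom_inv_substitute] inv_monom_val by (rule mcoeff_Mono_mult)

lemma tc_param: "tc t (t i) m = (if m = single i 1 then 1 else 0)"
  using tc_monom_val[of "single i 1"] by simp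

lemma tc_param_mult: "tc t (t i * f) m = (if lookup m i \<noteq> 0 then tc t f (m - single i 1) else 0)"
  using tc_monom_val_mult[of "single i 1"] by simp

text \<open>The M-adic order can be read in any regular system of parameters: the variables are
  combinations of the \<open>t j\<close>, so their images under the inverse substitution have no
  constant term.\<close>

lemma van_tc: "f \<in> van N \<longleftrightarrow> (\<forall>m. mdeg m < N \<longrightarrow> tc t f m = 0)"
proof
  assume "\<forall>m. mdeg m < N \<longrightarrow> tc t f m = 0"
  hence "inv (substitute t) f \<in> van N" by (simp add: van_def tc_def)
  from substitute_van[OF this, of t] show "f \<in> van N" by (simp add: substitute_inv)
next
  let ?\<psi> = "inv (substitute t)"
  note h = kalg_homD[OF kalg_hom_inv_substitute]
  have X: "?\<psi> (Mono (single i 1)) \<in> van 1" for i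
  proof -
    have "Mono (single i 1) \<in> maxid" using Mono_van[of "single i 1"] by (simp add: maxid_van)
    then obtain a where a: "Mono (single i 1) = (\<Sum>j\<in>UNIV. a j * t j)"
      using rsp ideal_of_image_sum[of _ t UNIV] unfolding rsp_def by blast
    have "?\<psi> (t j) \<in> van 1" for j
      using inv_monom_val[of "single j 1"] Mono_van[of "single j 1"] by simp
    thus ?thesis unfolding a h by (intro van_sum van_scale)
  qed
  assume "f \<in> van N"
  hence "?\<psi> f \<in> van N"
  proof (induction N arbitrary: f)
    case (Suc N)
    then obtain g where g: "\<And>i. g i \<in> van N" "f = (\<Sum>i\<in>UNIV. Mono (single i 1) * g i)"
      using van_Suc_split by blast
    have "?\<psi> (Mono (single i 1)) * ?\<psi> (g i) \<in> van (1 + N)" for i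
      using X Suc.IH[OF g(1)] by (intro van_mult)
    thus ?case unfolding g(2) h by (intro van_sum) simp
  qed simp
  thus "\<forall>m. mdeg m < N \<longrightarrow> tc t f m = 0" by (simp add: van_def tc_def)
qed

lemma maxid_tc: "f \<in> maxid \<longleftrightarrow> tc t f 0 = 0"
  unfolding maxid_van van_tc by simp

lemma truncation_tc: "f - (\<Sum>m | mdeg m < N. Const (tc t f m) * monom_val t m) \<in> van N"
proof -
  have "(\<Sum>m | mdeg m < N. tc t f m * (if k = m then 1 else 0)) = tc t f k" if "mdeg k < N" for k
  proof -
    have "(\<Sum>m | mdeg m < N. tc t f m * (if k = m then 1 else 0))
        = (\<Sum>m | mdeg m < N. if k = m then tc t f m else 0)" by (intro sum.cong) auto
    thus ?thesis using that by (simp add: sum.delta')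
  qed
  thus ?thesis by (simp add: van_tc tc_diff tc_sum tc_scale tc_monom_val)
qed

lemma ideal_tc: "f \<in> ideal_of (t ` W) \<longleftrightarrow> supp t W f = {}"
proof
  assume "f \<in> ideal_of (t ` W)"
  then obtain a where a: "f = (\<Sum>j\<in>W. a j * t j)" using ideal_of_image_sum by blast
  have "tc t f m = 0" if "keys m \<inter> W = {}" for m
    unfolding a tc_sum
  proof (rule sum.neutral, rule ballI)
    fix j assume "j \<in> W"
    hence "lookup m j = 0" using that by (auto simp: in_keys_iff)
    thus "tc t (a j * t j) m = 0" by (simp add: mult.commute[of "a j"] tc_param_mult)
  qed
  thus "supp t W f = {}" by (auto simp: supp_def)
next
  assume s: "supp t W f = {}"
  define F where "F = inv (substitute t) f"
  define c where "c m = (SOME i. i \<in> keys m \<inter> W)" for m :: "'n \<Rightarrow>\<^sub>0 nat"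
  have c: "c m \<in> keys m \<inter> W" if "mcoeff F m \<noteq> 0" for m
  proof -
    have "keys m \<inter> W \<noteq> {}" using s that by (auto simp: supp_def tc_def F_def)
    thus ?thesis unfolding c_def some_in_eq .
  qed
  define G where "G x = Mfps (\<lambda>k. if c (single x 1 + k) = x then mcoeff F (single x 1 + k) else 0)" for x
  have "F = (\<Sum>x\<in>W. Mono (single x 1) * G x)"
    unfolding G_def by (rule monomial_division) (use c in \<open>auto simp: in_keys_iff\<close>)
  hence "substitute t F = (\<Sum>x\<in>W. t x * substitute t (G x))"
    by (simp only: kalg_homD[OF kalg_hom_substitute] substitute_monomial monom_val_single power_one_right)
  hence f: "f = (\<Sum>x\<in>W. substitute t (G x) * t x)" by (simp add: F_def substitute_inv mult.commute)
  show "f \<in> ideal_of (t ` W)"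
    unfolding f by (intro ideal.span_sum ideal.span_scale ideal.span_base) auto
qed

lemma supp_mult: "m \<in> supp t W (f * g) \<Longrightarrow> \<exists>a b. m = a + b \<and> a \<in> supp t W f \<and> b \<in> supp t W g"
proof -
  assume m: "m \<in> supp t W (f * g)"
  hence "(\<Sum>(a, b)\<in>splits m. tc t f a * tc t g b) \<noteq> 0" by (simp add: supp_def tc_mult)
  then obtain p where "p \<in> splits m" "(\<lambda>(a, b). tc t f a * tc t g b) p \<noteq> 0"
    by (meson sum.neutral)
  then obtain a b where ab: "a + b = m" "tc t f a \<noteq> 0" "tc t g b \<noteq> 0" by (auto simp: splits_def)
  with m show ?thesis
    by (intro exI[of _ a] exI[of _ b]) (auto simp: supp_def keys_add_nat)
qed

lemma supp_add: "supp t W (f + g) \<subseteq> supp t W f \<union> supp t W g"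
  by (auto simp: supp_def tc_add)

lemma ideal_van_tc:
  "f \<in> ideal_of (ideal_of (t ` W) \<union> ideal_power maxid N) \<longleftrightarrow> (\<forall>m\<in>supp t W f. N \<le> mdeg m)"
proof
  let ?S = "{f. \<forall>m\<in>supp t W f. N \<le> mdeg m}"
  have "is_ideal ?S"
  proof (rule ideal.subspaceI)
    show "0 \<in> ?S" by (simp add: supp_def tc_zero)
    show "x + y \<in> ?S" if "x \<in> ?S" "y \<in> ?S" for x y using that supp_add by blast
    show "c * x \<in> ?S" if "x \<in> ?S" for c x
    proof (clarify)
      fix m assume "m \<in> supp t W (c * x)"
      then obtain a b where "m = a + b" "b \<in> supp t W x" using supp_mult by blast
      thus "N \<le> mdeg m" using that by force
    qed
  qed
  moreover have "ideal_of (t ` W) \<union> ideal_power maxid N \<subseteq> ?S"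
    unfolding ideal_power_maxid using ideal_tc[of _ W] van_tc[of _ N] by (auto simp: supp_def not_less[symmetric])
  ultimately have "ideal_of (ideal_of (t ` W) \<union> ideal_power maxid N) \<subseteq> ?S" by (rule ideal.span_minimal[rotated])
  moreover assume "f \<in> ideal_of (ideal_of (t ` W) \<union> ideal_power maxid N)"
  ultimately show "\<forall>m\<in>supp t W f. N \<le> mdeg m" by blast
next
  assume s: "\<forall>m\<in>supp t W f. N \<le> mdeg m"
  \<comment> \<open>The part of degree below \<open>N\<close>: by assumption each of its monomials
    contains some \<open>t i\<close> with \<open>i\<close> in \<open>W\<close>.\<close>
  define g where "g = substitute t (Mfps (\<lambda>m. if mdeg m < N then tc t f m else 0))"
  have g: "tc t g m = (if mdeg m < N then tc t f m else 0)" for m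
    by (simp add: g_def tc_substitute)
  have "g \<in> ideal_of (t ` W)" unfolding ideal_tc using s by (auto simp: supp_def g)
  moreover have "f - g \<in> ideal_power maxid N"
    unfolding ideal_power_maxid van_tc by (simp add: tc_diff g)
  ultimately have "g + (f - g) \<in> ideal_of (ideal_of (t ` W) \<union> ideal_power maxid N)"
    by (intro ideal.span_add ideal.span_base) auto
  thus "f \<in> ideal_of (ideal_of (t ` W) \<union> ideal_power maxid N)" by simp
qed

end

section \<open>Derivations\<close>

definition pd :: "'n \<Rightarrow> ('k::comm_ring_1, 'n::finite) mfps \<Rightarrow> ('k, 'n) mfps" where
  "pd i f = Mfps (\<lambda>m. of_nat (lookup m i + 1) * mcoeff f (m + single i 1))"

text \<open>Splittings with \<open>lookup a i = 0\<close> drop out through their factor; the others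
  come from splittings of \<open>m\<close>.\<close>

lemma sum_splits_shift:
  fixes H :: "('n::finite \<Rightarrow>\<^sub>0 nat) \<Rightarrow> ('n \<Rightarrow>\<^sub>0 nat) \<Rightarrow> 'k::comm_ring_1"
  shows "(\<Sum>(a, b)\<in>splits (m + single i 1). of_nat (lookup a i) * H a b)
    = (\<Sum>(a, b)\<in>splits m. of_nat (lookup a i + 1) * H (a + single i 1) b)"
proof -
  let ?e = "\<lambda>(a :: 'n \<Rightarrow>\<^sub>0 nat, b :: 'n \<Rightarrow>\<^sub>0 nat). (a + single i 1, b)"
  have "(\<Sum>(a, b)\<in>splits (m + single i 1). of_nat (lookup a i) * H a b)
      = (\<Sum>(a, b)\<in>?e ` splits m. of_nat (lookup a i) * H a b)"
  proof (rule sum.mono_neutral_right)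
    show "\<forall>p\<in>splits (m + single i 1) - ?e ` splits m. (case p of (a, b) \<Rightarrow> of_nat (lookup a i) * H a b) = 0"
    proof
      fix p assume p: "p \<in> splits (m + single i 1) - ?e ` splits m"
      obtain a b where ab: "p = (a, b)" by fastforce
      have "lookup a i = 0"
      proof (rule ccontr)
        assume "lookup a i \<noteq> 0"
        hence "mle (single i 1) a" by simp
        from mle_imp_add[OF this] obtain k where k: "a = k + single i 1" by (metis add.commute)
        have "k + b + single i 1 = m + single i 1" using p ab k by (auto simp: splits_def ac_simps)
        hence "(k, b) \<in> splits m" by (simp add: splits_def)
        with p ab k show False by force
      qed
      thus "(case p of (a, b) \<Rightarrow> of_nat (lookup a i) * H a b) = 0" using ab by simp
    qed
    show "?e ` splits m \<subseteq> splits (m + single i 1)" by (auto simp: splits_def ac_simps)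
  qed (rule finite_splits)
  also have "\<dots> = (\<Sum>(a, b)\<in>splits m. of_nat (lookup a i + 1) * H (a + single i 1) b)"
    by (subst sum.reindex) (auto simp: inj_on_def lookup_add intro!: sum.cong)
  finally show ?thesis .
qed

lemma derivation_pd: "derivation (pd i :: ('k::comm_ring_1, 'n::finite) mfps \<Rightarrow> _)"
  unfolding derivation_def
proof (intro conjI allI)
  have "m + single i 1 \<noteq> (0 :: 'n \<Rightarrow>\<^sub>0 nat)" for m
    by (metis add_is_0 lookup_add lookup_single_eq lookup_zero zero_neq_one)
  thus "pd i (Const c) = (0 :: ('k, 'n) mfps)" for c
    by (intro mfps_eqI) (simp add: pd_def mcoeff_Const)
  show "pd i (f + g) = pd i f + (pd i g :: ('k, 'n) mfps)" for f g
    by (intro mfps_eqI) (simp add: pd_def algebra_simps)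
  fix f g :: "('k, 'n) mfps"
  show "pd i (f * g) = pd i f * g + f * pd i g"
  proof (rule mfps_eqI)
    fix m :: "'n \<Rightarrow>\<^sub>0 nat"
    let ?m = "m + single i 1"
    have "mcoeff (pd i (f * g)) m = of_nat (lookup ?m i) * (\<Sum>(a, b)\<in>splits ?m. mcoeff f a * mcoeff g b)"
      by (simp add: pd_def mcoeff_mult lookup_add)
    \<comment> \<open>The Leibniz rule arises from distributing the exponent of the variable
      \<open>i\<close> over the two parts of each splitting.\<close>
    also have "\<dots> = (\<Sum>(a, b)\<in>splits ?m. of_nat (lookup a i) * (mcoeff f a * mcoeff g b)
        + of_nat (lookup b i) * (mcoeff f a * mcoeff g b))"
      unfolding sum_distrib_left
    proof (rule sum.cong[OF refl], clarify)
      fix a b assume "(a, b) \<in> splits ?m"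
      hence "a + b = ?m" by (simp add: splits_def)
      hence "lookup ?m i = lookup a i + lookup b i" by (metis lookup_add)
      thus "of_nat (lookup ?m i) * (mcoeff f a * mcoeff g b) = of_nat (lookup a i) * (mcoeff f a * mcoeff g b)
        + of_nat (lookup b i) * (mcoeff f a * mcoeff g b)"
        by (simp only: of_nat_add distrib_right)
    qed
    also have "\<dots> = (\<Sum>(a, b)\<in>splits ?m. of_nat (lookup a i) * (mcoeff f a * mcoeff g b))
        + (\<Sum>(a, b)\<in>splits ?m. of_nat (lookup b i) * (mcoeff f a * mcoeff g b))"
      by (simp add: sum.distrib case_prod_unfold)
    also have "(\<Sum>(a, b)\<in>splits ?m. of_nat (lookup b i) * (mcoeff f a * mcoeff g b))
        = (\<Sum>(a, b)\<in>splits ?m. of_nat (lookup a i) * (mcoeff f b * mcoeff g a))"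
      by (subst splits_swap) (simp add: case_prod_unfold)
    also have "\<dots> = (\<Sum>(a, b)\<in>splits m. of_nat (lookup a i + 1) * (mcoeff f b * mcoeff g (a + single i 1)))"
      by (rule sum_splits_shift)
    also have "\<dots> = (\<Sum>(a, b)\<in>splits m. mcoeff (pd i g) a * mcoeff f b)"
      by (intro sum.cong) (auto simp: pd_def ac_simps)
    also have "\<dots> = mcoeff (f * pd i g) m"
      unfolding mult.commute[of f] by (simp add: mcoeff_mult)
    also have "(\<Sum>(a, b)\<in>splits ?m. of_nat (lookup a i) * (mcoeff f a * mcoeff g b))
        = (\<Sum>(a, b)\<in>splits m. of_nat (lookup a i + 1) * (mcoeff f (a + single i 1) * mcoeff g b))"
      by (rule sum_splits_shift)
    also have "\<dots> = mcoeff (pd i f * g) m"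
      unfolding mcoeff_mult by (intro sum.cong) (auto simp: pd_def ac_simps)
    finally show "mcoeff (pd i (f * g)) m = mcoeff (pd i f * g + f * pd i g) m" by simp
  qed
qed

lemma derivationD:
  assumes "derivation D"
  shows "D (f + g) = D f + D g" "D (f * g) = D f * g + f * D g" "D (Const c) = 0" "D 0 = 0" "D 1 = 0"
    "D (f - g) = D f - D g" "D (sum F X) = (\<Sum>x\<in>X. D (F x))" "D (Const c * f) = Const c * D f"
proof -
  show plus: "D (f + g) = D f + D g" for f g using assms by (simp add: derivation_def)
  show times: "D (f * g) = D f * g + f * D g" for f g using assms by (simp add: derivation_def)
  show c: "D (Const c) = 0" for c using assms by (simp add: derivation_def)
  show 0: "D 0 = 0" using c[of 0] by simp
  show "D 1 = 0" using c[of 1] by simp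
  show "D (f - g) = D f - D g" using plus[of "f - g" g] by simp
  show "D (sum F X) = (\<Sum>x\<in>X. D (F x))"
    by (induction X rule: infinite_finite_induct) (simp_all add: 0 plus)
  show "D (Const c * f) = Const c * D f" by (simp add: times c)
qed

lemma derivation_power:
  assumes "derivation D" shows "D (x ^ Suc n) = of_nat (Suc n) * x ^ n * D x"
  by (induction n) (simp_all add: derivationD[OF assms] algebra_simps)

lemma derivation_van:
  assumes D: "derivation D" and "f \<in> van (Suc N)" shows "D f \<in> van N"
  using assms(2)
proof (induction N arbitrary: f)
  case (Suc N)
  then obtain g where g: "\<And>i. g i \<in> van (Suc N)" "f = (\<Sum>i\<in>UNIV. Mono (single i 1) * g i)"
    using van_Suc_split by blast
  have "Mono (single i 1) * D (g i) \<in> van (1 + N)" for i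
    using Mono_van[of "single i 1"] Suc.IH[OF g(1)] by (intro van_mult) simp_all
  moreover have "D (Mono (single i 1)) * g i \<in> van (Suc N)" for i
    using g(1) by (intro van_scale)
  ultimately show ?case
    unfolding g(2) derivationD[OF D] by (intro van_sum van_add) simp_all
qed simp

text \<open>Derivations are automatically continuous, since they lower the order by at most one
  (\<open>derivation_van\<close>); so equality on monomials in \<open>t\<close> extends to
  series.\<close>

lemma derivation_eqI:
  fixes t :: "'n::finite \<Rightarrow> ('k::field, 'n) mfps"
  assumes "rsp t" "derivation D" "derivation D'" "\<And>i. D (t i) = D' (t i)"
  shows "D = D'"
proof
  fix f
  have mon: "D (monom_val t m) = D' (monom_val t m)" for m
    by (induction m rule: exponent_induct)
      (simp_all add: derivationD[OF assms(2)] derivationD[OF assms(3)] monom_val_add assms(4))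
  show "D f = D' f"
  proof (rule van_eqI)
    fix N
    define P where "P = (\<Sum>m | mdeg m < Suc N. Const (tc t f m) * monom_val t m)"
    have r: "f - P \<in> van (Suc N)" unfolding P_def by (rule truncation_tc[OF assms(1)])
    have "D P = D' P"
      unfolding P_def derivationD[OF assms(2)] derivationD[OF assms(3)] by (simp add: mon)
    hence "D f - D' f = D (f - P) - D' (f - P)"
      unfolding derivationD[OF assms(2)] derivationD[OF assms(3)] by simp
    thus "D f - D' f \<in> van N"
      using derivation_van[OF assms(2) r] derivation_van[OF assms(3) r] by (simp add: van_diff)
  qed
qed

lemma partial_unique:
  assumes "rsp (t :: 'n::finite \<Rightarrow> ('k::field, 'n) mfps)"
    and "derivation D" "\<And>j. D (t j) = (if j = i then 1 else 0)"
  shows "partial t i = D"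
  unfolding partial_def
proof (rule the_equality)
  fix D' assume "derivation D' \<and> (\<forall>j. D' (t j) = (if j = i then 1 else 0))"
  thus "D' = D" using derivation_eqI[OF assms(1), of D' D] assms by simp
qed (use assms in simp)

lemma partial_eq:
  fixes t :: "'n::finite \<Rightarrow> ('k::field, 'n) mfps"
  assumes "rsp t" shows "partial t i f = substitute t (pd i (inv (substitute t) f))"
proof -
  note s = kalg_homD[OF kalg_hom_substitute[OF assms]] and s' = kalg_homD[OF kalg_hom_inv_substitute[OF assms]]
    and d = derivationD[OF derivation_pd]
  have pdX: "pd i (Mono (single j 1)) = (if j = i then 1 else (0 :: ('k, 'n) mfps))" for j
  proof (rule mfps_eqI)
    fix m :: "'n \<Rightarrow>\<^sub>0 nat"
    have "m + single i 1 = single j 1 \<longleftrightarrow> m = 0 \<and> j = i"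
    proof
      assume e: "m + single i 1 = single j 1"
      hence "mdeg (m + single i 1) = mdeg (single j 1)" by (rule arg_cong)
      hence "m = 0" by simp
      with e show "m = 0 \<and> j = i" by auto
    qed auto
    thus "mcoeff (pd i (Mono (single j 1))) m = mcoeff (if j = i then 1 else (0 :: ('k, 'n) mfps)) m"
      by (auto simp: pd_def mcoeff_Mono mcoeff_one)
  qed
  have "partial t i = substitute t \<circ> pd i \<circ> inv (substitute t)"
  proof (rule partial_unique[OF assms])
    show "derivation (substitute t \<circ> pd i \<circ> inv (substitute t))"
      unfolding derivation_def by (simp add: s s' d substitute_inv[OF assms])
    show "(substitute t \<circ> pd i \<circ> inv (substitute t)) (t j) = (if j = i then 1 else 0)" for j
      using inv_monom_val[OF assms, of "single j 1"] pdX[of j] s by simp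
  qed
  thus ?thesis by simp
qed

lemma derivation_partial:
  fixes t :: "'n::finite \<Rightarrow> ('k::field, 'n) mfps"
  assumes "rsp t" shows "derivation (partial t i)"
proof -
  note s = kalg_homD[OF kalg_hom_substitute[OF assms]] and s' = kalg_homD[OF kalg_hom_inv_substitute[OF assms]]
    and d = derivationD[OF derivation_pd]
  show ?thesis
    unfolding derivation_def partial_eq[OF assms] by (simp add: s s' d substitute_inv[OF assms])
qed

lemma tc_partial:
  fixes t :: "'n::finite \<Rightarrow> ('k::field, 'n) mfps"
  assumes "rsp t" shows "tc t (partial t i f) m = of_nat (lookup m i + 1) * tc t f (m + single i 1)"
  unfolding partial_eq[OF assms] tc_substitute[OF assms] by (simp add: pd_def tc_def)

lemma partial_param:
  fixes t :: "'n::finite \<Rightarrow> ('k::field, 'n) mfps"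
  assumes "rsp t" shows "partial t i (t j) = (if j = i then 1 else 0)"
proof (rule tc_eqI[OF assms])
  fix m :: "'n \<Rightarrow>\<^sub>0 nat"
  have "m + single i 1 = single j 1 \<longleftrightarrow> m = 0 \<and> j = i"
  proof
    assume e: "m + single i 1 = single j 1"
    hence "mdeg (m + single i 1) = mdeg (single j 1)" by (rule arg_cong)
    hence "m = 0" by simp
    with e show "m = 0 \<and> j = i" by auto
  qed auto
  thus "tc t (partial t i (t j)) m = tc t (if j = i then 1 else 0) m"
    using tc_Const[OF assms, of 1 m] by (auto simp: tc_partial[OF assms] tc_param[OF assms] tc_zero[OF assms])
qed

text \<open>With \<open>m_i\<close> for \<open>lookup m i\<close>, the constant is
  \<open>(m_i + 1) ... (m_i + q)\<close>; what matters is that it does not vanish in characteristic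
  zero.\<close>

lemma tc_partial_power:
  fixes t :: "'n::finite \<Rightarrow> ('k::field_char_0, 'n) mfps"
  assumes "rsp t"
  shows "\<exists>c. c \<noteq> 0 \<and> tc t ((partial t i ^^ q) f) m = c * tc t f (m + single i q)"
proof (induction q arbitrary: m)
  case 0
  show ?case by (intro exI[of _ 1]) simp
next
  case (Suc q)
  obtain c where c: "c \<noteq> 0" "tc t ((partial t i ^^ q) f) (m + single i 1) = c * tc t f (m + single i 1 + single i q)"
    using Suc.IH by blast
  have "m + single i 1 + single i q = m + single i (Suc q)"
    unfolding add.assoc single_add[symmetric] by simp
  moreover have "of_nat (lookup m i + 1) \<noteq> (0 :: 'k)" by (simp only: of_nat_eq_0_iff add_is_0 simp_thms one_neq_zero)
  ultimately show ?case
    using c by (intro exI[of _ "of_nat (lookup m i + 1) * c"]) (simp add: tc_partial[OF assms] mult.assoc)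
qed

section \<open>Weighted filtrations\<close>

definition wt :: "('n::finite \<Rightarrow> real) \<Rightarrow> ('n \<Rightarrow>\<^sub>0 nat) \<Rightarrow> real" where
  "wt \<tau> m = (\<Sum>i\<in>UNIV. \<tau> i * real (lookup m i))"

text \<open>A piece of the weighted filtration on the quotient by the \<open>t i\<close> with
  \<open>i\<close> in \<open>W\<close>. Half-spaces containing a projected polyhedron become
  membership in such pieces (\<open>Fil_iff_vertices\<close>), which can be followed through
  products, derivations and changes of parameters.\<close>

definition Fil :: "('n \<Rightarrow> ('k::comm_ring_1, 'n::finite) mfps) \<Rightarrow> 'n set \<Rightarrow> ('n \<Rightarrow> real) \<Rightarrow> real \<Rightarrow> ('k, 'n) mfps set" where
  "Fil t W \<tau> \<gamma> = {f. \<forall>m\<in>supp t W f. \<gamma> \<le> wt \<tau> m}"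

lemma wt_zero [simp]: "wt \<tau> 0 = 0"
  by (simp add: wt_def)

lemma wt_add [simp]: "wt \<tau> (a + b) = wt \<tau> a + wt \<tau> b"
  by (simp add: wt_def lookup_add distrib_left sum.distrib)

lemma wt_single [simp]: "wt \<tau> (single i n) = \<tau> i * real n"
proof -
  have "wt \<tau> (single i n) = (\<Sum>j\<in>UNIV. if j = i then \<tau> i * real n else 0)"
    unfolding wt_def by (intro sum.cong) (auto simp: lookup_single when_def)
  thus ?thesis by (simp add: sum.delta)
qed

lemma wt_linear: "wt (\<lambda>i. x * \<tau> i + y * \<tau>' i) m = x * wt \<tau> m + y * wt \<tau>' m"
  by (simp add: wt_def distrib_right sum.distrib sum_distrib_left mult.assoc)

lemma wt_upd: "wt (\<tau>(p := a)) m = wt (\<tau>(p := 0)) m + a * real (lookup m p)"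
proof -
  have "wt (\<tau>(p := a)) m - wt (\<tau>(p := 0)) m = (\<Sum>j\<in>UNIV. if j = p then a * real (lookup m p) else 0)"
    unfolding wt_def sum_subtractf[symmetric] by (intro sum.cong) auto
  thus ?thesis by (simp add: sum.delta)
qed

lemma wt_lower: "(\<And>i. c \<le> \<tau> i) \<Longrightarrow> c * real (mdeg m) \<le> wt \<tau> m"
  unfolding wt_def mdeg_def of_nat_sum sum_distrib_left by (intro sum_mono mult_right_mono) auto

lemma wt_nonneg: "(\<And>i. 0 \<le> \<tau> i) \<Longrightarrow> 0 \<le> wt \<tau> m"
  using wt_lower[of 0 \<tau> m] by simp

lemma wt_mono: "(\<And>i. 0 \<le> \<tau> i) \<Longrightarrow> mle a b \<Longrightarrow> wt \<tau> a \<le> wt \<tau> b"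
  unfolding wt_def mle_def by (intro sum_mono mult_left_mono) auto

lemma wt_member: "(\<And>i. 0 \<le> \<tau> i) \<Longrightarrow> lookup m i \<noteq> 0 \<Longrightarrow> \<tau> i \<le> wt \<tau> m"
  using wt_mono[of \<tau> "single i 1" m] by simp

lemma positive_lower_bound:
  fixes \<tau> :: "'n::finite \<Rightarrow> real"
  assumes "\<And>i. 0 < \<tau> i" shows "\<exists>c>0. \<forall>i. c \<le> \<tau> i"
proof (intro exI conjI allI)
  show "Min (range \<tau>) \<le> \<tau> i" for i by (intro Min_le) auto
  show "0 < Min (range \<tau>)" using assms by (subst Min_gr_iff) auto
qed

lemma wt_positive:
  assumes "\<And>i. 0 < \<tau> i" "m \<noteq> 0" shows "0 < wt \<tau> m"
proof -
  obtain c where c: "0 < c" "\<And>i. c \<le> \<tau> i" using positive_lower_bound[of \<tau>] assms(1) by blast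
  have "0 < mdeg m" using assms(2) by (metis gr0I mdeg_eq_0_iff)
  hence "0 < c * real (mdeg m)" using c(1) by (intro mult_pos_pos) (simp_all only: of_nat_0_less_iff)
  also have "\<dots> \<le> wt \<tau> m" by (rule wt_lower) (rule c(2))
  finally show ?thesis .
qed

lemma finite_wt_le:
  assumes "\<And>i. 0 < \<tau> i" shows "finite {m. wt \<tau> m \<le> x}"
proof -
  obtain c where c: "0 < c" "\<And>i. c \<le> \<tau> i" using positive_lower_bound[of \<tau>] assms(1) by blast
  have "mdeg m \<le> nat \<lfloor>x / c\<rfloor>" if "wt \<tau> m \<le> x" for m
  proof -
    have "c * real (mdeg m) \<le> x" using wt_lower[of c \<tau> m, OF c(2)] that by simp
    hence "real (mdeg m) \<le> x / c" using c(1) by (simp add: field_simps)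
    thus ?thesis by (simp add: le_nat_floor)
  qed
  thus ?thesis by (intro finite_subset[OF _ finite_mdeg_le[of "nat \<lfloor>x / c\<rfloor>"]]) auto
qed

lemma wt_argmin:
  assumes "\<And>i. 0 < \<tau> i" "S \<noteq> {}"
  shows "\<exists>A\<in>S. \<forall>m\<in>S. wt \<tau> A \<le> wt \<tau> m"
proof -
  obtain m0 where m0: "m0 \<in> S" using assms(2) by blast
  let ?T = "S \<inter> {m. wt \<tau> m \<le> wt \<tau> m0}"
  have fin: "finite ?T" using finite_wt_le[of \<tau>, OF assms(1)] by blast
  have "Min (wt \<tau> ` ?T) \<in> wt \<tau> ` ?T" using fin m0 by (intro Min_in) auto
  then obtain A where A: "A \<in> ?T" "wt \<tau> A = Min (wt \<tau> ` ?T)" by auto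
  have "wt \<tau> A \<le> wt \<tau> m" if "m \<in> S" for m
  proof (cases "wt \<tau> m \<le> wt \<tau> m0")
    case True
    thus ?thesis unfolding A(2) using fin that by (intro Min_le) auto
  qed (use A(1) in auto)
  thus ?thesis using A(1) by blast
qed

context
  fixes t :: "'n::finite \<Rightarrow> ('k::field, 'n) mfps" and W :: "'n set"
  assumes rsp: "rsp t"
begin

lemma Fil_add: "f \<in> Fil t W \<tau> \<gamma> \<Longrightarrow> g \<in> Fil t W \<tau> \<gamma> \<Longrightarrow> f + g \<in> Fil t W \<tau> \<gamma>"
  using supp_add[OF rsp, of W f g] by (auto simp: Fil_def)

lemma ideal_Fil: "f \<in> ideal_of (t ` W) \<Longrightarrow> f \<in> Fil t W \<tau> \<gamma>"
  by (simp add: ideal_tc[OF rsp] Fil_def)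

lemma Fil_zero: "0 \<in> Fil t W \<tau> \<gamma>"
  by (rule ideal_Fil) (rule ideal.span_zero)

lemma Fil_sum: "(\<And>x. x \<in> X \<Longrightarrow> F x \<in> Fil t W \<tau> \<gamma>) \<Longrightarrow> sum F X \<in> Fil t W \<tau> \<gamma>"
  by (induction X rule: infinite_finite_induct) (auto simp: Fil_zero Fil_add)

lemma Fil_mult: "f \<in> Fil t W \<tau> \<gamma> \<Longrightarrow> g \<in> Fil t W \<tau> \<gamma>' \<Longrightarrow> f * g \<in> Fil t W \<tau> (\<gamma> + \<gamma>')"
  unfolding Fil_def using supp_mult[OF rsp, of _ W f g] by (fastforce intro: add_mono)

lemma Fil_antimono: "f \<in> Fil t W \<tau> \<gamma> \<Longrightarrow> \<gamma>' \<le> \<gamma> \<Longrightarrow> f \<in> Fil t W \<tau> \<gamma>'"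
  by (force simp: Fil_def)

lemma Fil_param: "t i \<in> Fil t W \<tau> (\<tau> i)"
  by (auto simp: Fil_def supp_def tc_param[OF rsp] split: if_splits)

context
  fixes \<tau> :: "'n \<Rightarrow> real"
  assumes pos: "\<And>i. 0 < \<tau> i"
begin

lemma Fil_nonpos: "\<gamma> \<le> 0 \<Longrightarrow> f \<in> Fil t W \<tau> \<gamma>"
proof -
  have "0 \<le> wt \<tau> m" for m by (rule wt_nonneg) (rule less_imp_le[OF pos])
  thus "\<gamma> \<le> 0 \<Longrightarrow> f \<in> Fil t W \<tau> \<gamma>" unfolding Fil_def by (auto intro: order_trans)
qed

lemma Fil_scale: "f \<in> Fil t W \<tau> \<gamma> \<Longrightarrow> c * f \<in> Fil t W \<tau> \<gamma>"
  using Fil_mult[of c \<tau> 0 f \<gamma>] Fil_nonpos[of 0 c] by simp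

lemma Fil_power: "f \<in> Fil t W \<tau> \<gamma> \<Longrightarrow> f ^ n \<in> Fil t W \<tau> (real n * \<gamma>)"
proof (induction n)
  case 0 thus ?case by (simp add: Fil_nonpos)
next
  case (Suc n)
  hence "f * f ^ n \<in> Fil t W \<tau> (\<gamma> + real n * \<gamma>)" by (intro Fil_mult)
  thus ?case by (simp add: algebra_simps)
qed

text \<open>Positive weights make the pieces M-adically open, which reduces the statements below to
  polynomials in the parameters.\<close>

lemma van_Fil: "\<exists>N. van N \<subseteq> Fil t W \<tau> \<gamma>"
proof -
  obtain c where c: "0 < c" "\<And>i. c \<le> \<tau> i" using positive_lower_bound[of \<tau>] pos by blast
  obtain N :: nat where N: "\<gamma> / c \<le> real N" using real_arch_simple by blast
  have "\<gamma> \<le> wt \<tau> m" if "N \<le> mdeg m" for m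
  proof -
    have "\<gamma> \<le> c * real N" using N c(1) by (simp add: field_simps)
    also have "\<dots> \<le> c * real (mdeg m)" using that c(1) by simp
    also have "\<dots> \<le> wt \<tau> m" by (rule wt_lower) (rule c(2))
    finally show ?thesis .
  qed
  hence "van N \<subseteq> Fil t W \<tau> \<gamma>"
    unfolding Fil_def by (auto simp: supp_def van_tc[OF rsp]) (metis not_less)
  thus ?thesis by blast
qed

text \<open>It suffices to know the weights of the new parameters: each monomial in
  \<open>t'\<close> then keeps at least its weight when rewritten in \<open>t\<close>, and the
  remainder of high order is absorbed by \<open>van_Fil\<close>.\<close>

lemma Fil_change:
  assumes rsp': "rsp t'" and W: "\<And>i. i \<in> W \<Longrightarrow> t' i \<in> ideal_of (t ` W)"
    and V: "\<And>i. i \<notin> W \<Longrightarrow> t' i \<in> Fil t W \<tau> (\<tau> i)" and f: "f \<in> Fil t' W \<tau> \<gamma>"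
  shows "f \<in> Fil t W \<tau> \<gamma>"
proof -
  have mon: "monom_val t' m \<in> Fil t W \<tau> (wt \<tau> m)" for m
  proof (induction m rule: exponent_induct)
    case zero thus ?case by (simp add: Fil_nonpos)
  next
    case (step i k)
    have "t' i \<in> Fil t W \<tau> (\<tau> i)" using V[of i] W[of i] ideal_Fil by blast
    from Fil_mult[OF this step] show ?case by (simp add: monom_val_add)
  qed
  have mon': "monom_val t' m \<in> ideal_of (t ` W)" if ne: "keys m \<inter> W \<noteq> {}" for m
  proof -
    obtain i where i: "i \<in> W" "i \<in> keys m" using ne by blast
    hence "mle (single i 1) m" by (simp add: in_keys_iff)
    from mle_imp_add[OF this] obtain k where "m = single i 1 + k" by blast
    hence "monom_val t' m = monom_val t' k * t' i" by (simp add: monom_val_add mult.commute)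
    thus ?thesis using W[OF i(1)] by (simp add: ideal.span_scale)
  qed
  obtain N where N: "van N \<subseteq> Fil t W \<tau> \<gamma>" using van_Fil by blast
  define P where "P = (\<Sum>m | mdeg m < N. Const (tc t' f m) * monom_val t' m)"
  have "f - P \<in> Fil t W \<tau> \<gamma>" using truncation_tc[OF rsp', of f N] N by (auto simp: P_def)
  moreover have "P \<in> Fil t W \<tau> \<gamma>"
    unfolding P_def
  proof (intro Fil_sum)
    fix m
    show "Const (tc t' f m) * monom_val t' m \<in> Fil t W \<tau> \<gamma>"
    proof (cases "m \<in> supp t' W f")
      case True
      hence "\<gamma> \<le> wt \<tau> m" using f by (simp add: Fil_def)
      thus ?thesis using mon by (intro Fil_scale) (rule Fil_antimono)
    next
      case False
      have "Const (tc t' f m) * monom_val t' m \<in> Fil t W \<tau> \<gamma>" if "keys m \<inter> W \<noteq> {}"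
        using mon'[OF that] by (intro Fil_scale ideal_Fil)
      moreover have "tc t' f m = 0 \<or> keys m \<inter> W \<noteq> {}" using False by (auto simp: supp_def)
      ultimately show ?thesis by (auto simp: Fil_zero)
    qed
  qed
  ultimately have "f - P + P \<in> Fil t W \<tau> \<gamma>" by (rule Fil_add)
  thus ?thesis by simp
qed

lemma Fil_derivation:
  assumes D: "derivation D" and W: "\<And>x. x \<in> ideal_of (t ` W) \<Longrightarrow> D x \<in> ideal_of (t ` W)"
    and V: "\<And>i. i \<notin> W \<Longrightarrow> D (t i) \<in> Fil t W \<tau> (\<tau> i - a)" and f: "f \<in> Fil t W \<tau> \<gamma>"
  shows "D f \<in> Fil t W \<tau> (\<gamma> - a)"
proof -
  have mon: "monom_val t m \<in> Fil t W \<tau> (wt \<tau> m) \<and> D (monom_val t m) \<in> Fil t W \<tau> (wt \<tau> m - a)" for m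
  proof (induction m rule: exponent_induct)
    case zero thus ?case by (simp add: Fil_nonpos derivationD(5)[OF D] Fil_zero)
  next
    case (step i k)
    have "D (t i) \<in> Fil t W \<tau> (\<tau> i - a)"
      using V[of i] ideal_Fil[OF W[OF ideal.span_base[of "t i"]]] by blast
    hence "D (t i) * monom_val t k \<in> Fil t W \<tau> (\<tau> i - a + wt \<tau> k)" using step by (intro Fil_mult) auto
    moreover have "t i * D (monom_val t k) \<in> Fil t W \<tau> (\<tau> i + (wt \<tau> k - a))"
      using step Fil_param by (intro Fil_mult) auto
    ultimately have "D (t i) * monom_val t k + t i * D (monom_val t k) \<in> Fil t W \<tau> (\<tau> i + wt \<tau> k - a)"
      by (intro Fil_add) (simp_all add: algebra_simps)
    moreover have "t i * monom_val t k \<in> Fil t W \<tau> (\<tau> i + wt \<tau> k)"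
      using step Fil_param by (intro Fil_mult) auto
    ultimately show ?case by (simp add: monom_val_add derivationD(2)[OF D])
  qed
  obtain N where N: "van N \<subseteq> Fil t W \<tau> (\<gamma> - a)" using van_Fil by blast
  define P where "P = (\<Sum>m | mdeg m < Suc N. Const (tc t f m) * monom_val t m)"
  have "f - P \<in> van (Suc N)" unfolding P_def by (rule truncation_tc[OF rsp])
  hence "D (f - P) \<in> Fil t W \<tau> (\<gamma> - a)" using derivation_van[OF D] N by blast
  moreover have "D P \<in> Fil t W \<tau> (\<gamma> - a)"
    unfolding P_def derivationD(7,8)[OF D]
  proof (intro Fil_sum)
    fix m
    show "Const (tc t f m) * D (monom_val t m) \<in> Fil t W \<tau> (\<gamma> - a)"
    proof (cases "m \<in> supp t W f")
      case True
      hence "\<gamma> - a \<le> wt \<tau> m - a" using f by (simp add: Fil_def)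
      thus ?thesis using mon[of m] Fil_antimono Fil_scale by blast
    next
      case False
      have "D (monom_val t m) \<in> ideal_of (t ` W)" if "keys m \<inter> W \<noteq> {}"
      proof (rule W)
        show "monom_val t m \<in> ideal_of (t ` W)"
          using that by (auto simp: ideal_tc[OF rsp] supp_def tc_monom_val[OF rsp])
      qed
      hence "Const (tc t f m) * D (monom_val t m) \<in> Fil t W \<tau> (\<gamma> - a)" if "keys m \<inter> W \<noteq> {}"
        using that by (blast intro: Fil_scale ideal_Fil)
      moreover have "tc t f m = 0 \<or> keys m \<inter> W \<noteq> {}" using False by (auto simp: supp_def)
      ultimately show ?thesis by (auto simp: Fil_zero)
    qed
  qed
  ultimately have "D (f - P) + D P \<in> Fil t W \<tau> (\<gamma> - a)" by (rule Fil_add)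
  thus ?thesis by (simp add: derivationD[OF D])
qed

text \<open>Weights are positive, so a nonconstant monomial of \<open>x\<close> pushes every
  monomial of \<open>y\<close> above the lowest weight \<open>a\<close>.\<close>

lemma tc_mult_initial:
  assumes y: "y \<in> Fil t W \<tau> a" and m: "wt \<tau> m = a" "keys m \<inter> W = {}"
  shows "tc t (x * y) m = tc t x 0 * tc t y m"
proof -
  define z where "z = x - Const (tc t x 0)"
  have z0: "tc t z 0 = 0" by (simp add: z_def tc_diff[OF rsp] tc_Const[OF rsp])
  have "tc t (z * y) m = 0"
  proof (rule ccontr)
    assume "tc t (z * y) m \<noteq> 0"
    hence "m \<in> supp t W (z * y)" using m by (simp add: supp_def)
    then obtain c d where cd: "m = c + d" "c \<in> supp t W z" "d \<in> supp t W y"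
      using supp_mult[OF rsp] by blast
    have "c \<noteq> 0" using cd(2) z0 by (auto simp: supp_def)
    hence "0 < wt \<tau> c" using wt_positive[of \<tau>] pos by blast
    moreover have "a \<le> wt \<tau> d" using y cd(3) by (simp add: Fil_def)
    ultimately show False using cd(1) m(1) by simp
  qed
  moreover have "x * y = Const (tc t x 0) * y + z * y" by (simp add: z_def algebra_simps)
  ultimately show ?thesis by (simp add: tc_add[OF rsp] tc_scale[OF rsp])
qed

text \<open>Modulo higher weight only the derivatives falling on powers of \<open>y\<close> count:
  differentiating the factor \<open>D y ^ k\<close> keeps all remaining factors \<open>y\<close>,
  which leaves an excess weight of \<open>a\<close>, at least \<eta>. The constant stays
  unspecified; its nonvanishing will follow from the coefficient of \<open>t p\<close>.\<close>

lemma derivation_power_initial: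
  assumes D: "derivation D" and DF: "\<And>\<gamma> f. f \<in> Fil t W \<tau> \<gamma> \<Longrightarrow> D f \<in> Fil t W \<tau> (\<gamma> - a)"
    and y: "y \<in> Fil t W \<tau> a" and "\<eta> \<le> a" "k \<le> b"
  shows "\<exists>c. (D ^^ k) (y ^ b) - Const c * (D y ^ k * y ^ (b - k)) \<in> Fil t W \<tau> (real (b - k) * a + \<eta>)"
  using assms(5)
proof (induction k)
  case 0
  show ?case by (intro exI[of _ 1]) (simp add: Fil_zero)
next
  case (Suc k)
  then obtain c where c: "(D ^^ k) (y ^ b) - Const c * (D y ^ k * y ^ (b - k)) \<in> Fil t W \<tau> (real (b - k) * a + \<eta>)"
    by auto
  obtain n where n: "b - k = Suc n" "b - Suc k = n" using Suc.prems by (metis Suc_diff_Suc Suc_le_lessD)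
  define A where "A = Const c * (D (D y ^ k) * y ^ Suc n)"
  have dpow: "D (y ^ Suc n) = of_nat (Suc n) * y ^ n * D y" by (rule derivation_power[OF D])
  have "D (Const c * (D y ^ k * y ^ Suc n)) = A + Const c * (D y ^ k * D (y ^ Suc n))"
    unfolding A_def derivationD(8)[OF D] derivationD(2)[OF D, of "D y ^ k"] by (simp add: algebra_simps)
  also have "Const c * (D y ^ k * D (y ^ Suc n)) = Const (c * of_nat (Suc n)) * (D y ^ Suc k * y ^ n)"
    unfolding dpow Const_mult Const_of_nat by (simp add: ac_simps)
  finally have e: "D (Const c * (D y ^ k * y ^ Suc n)) = A + Const (c * of_nat (Suc n)) * (D y ^ Suc k * y ^ n)" .
  have "A \<in> Fil t W \<tau> (real (Suc n) * a)"
    unfolding A_def by (intro Fil_scale Fil_power y)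
  hence A: "A \<in> Fil t W \<tau> (real n * a + \<eta>)"
    by (rule Fil_antimono) (use assms(4) in \<open>simp add: algebra_simps\<close>)
  have "D ((D ^^ k) (y ^ b) - Const c * (D y ^ k * y ^ Suc n)) \<in> Fil t W \<tau> (real (Suc n) * a + \<eta> - a)"
    using DF[OF c] n by simp
  hence "D ((D ^^ k) (y ^ b) - Const c * (D y ^ k * y ^ Suc n)) \<in> Fil t W \<tau> (real n * a + \<eta>)"
    by (simp add: algebra_simps)
  hence "D ((D ^^ k) (y ^ b) - Const c * (D y ^ k * y ^ Suc n)) + A \<in> Fil t W \<tau> (real n * a + \<eta>)"
    using A by (rule Fil_add)
  thus ?case unfolding n derivationD(6)[OF D] e
    by (intro exI[of _ "c * of_nat (Suc n)"]) simp
qed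

end
end

text \<open>Here \<open>D\<^bsup>b-1\<^esup> f\<close> is a unit times \<open>t\<^sub>p\<close> modulo \<open>\<langle>t\<^sub>i : i \<in> W\<rangle>\<close>.  If some monomial \<open>A\<close> of \<open>t'\<^sub>p\<close> free of
  \<open>t\<^sub>p\<close> had weight \<open>a < \<delta>\<close>, then for the weight \<open>a\<close> of \<open>t\<^sub>p\<close> the initial form of \<open>f\<close> would be that of a
  multiple of \<open>t'\<^sub>p\<^bsup>b\<^esup>\<close>, and \<open>A\<close> would survive in \<open>D\<^bsup>b-1\<^esup> f\<close>.\<close>

lemma contact_optimal:
  fixes t t' :: "'n::finite \<Rightarrow> ('k::field, 'n) mfps"
  assumes rsp: "rsp t" and rsp': "rsp t'" and p: "p \<notin> W" and off: "\<And>i. i \<noteq> p \<Longrightarrow> t' i = t i"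
    and w: "\<And>i. 0 < w i" and D: "derivation D"
    and DW: "\<And>x. x \<in> ideal_of (t ` W) \<Longrightarrow> D x \<in> ideal_of (t ` W)"
    and DV: "\<And>m i. m \<noteq> 0 \<Longrightarrow> lookup m p = 0 \<Longrightarrow> i \<notin> W \<Longrightarrow>
      D (t i) \<in> Fil t W (w(p := wt w m)) ((w(p := wt w m)) i - wt w m)"
    and b: "0 < b"
    and G: "tc t ((D ^^ (b - 1)) f) (single p 1) \<noteq> 0"
      "\<And>m. keys m \<inter> W = {} \<Longrightarrow> lookup m p = 0 \<Longrightarrow> tc t ((D ^^ (b - 1)) f) m = 0"
    and \<delta>: "0 < \<delta>" and f: "f \<in> Fil t' W (w(p := \<delta>)) (real b * \<delta>)"
  shows "t' p \<in> Fil t W (w(p := \<delta>)) \<delta>"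
proof (rule ccontr)
  define y where "y = t' p"
  have wt0: "wt (w(p := x)) m = wt w m" if "lookup m p = 0" for m x
    unfolding wt_def by (intro sum.cong) (use that in auto)
  have upd_pos: "0 < (w(p := x)) i" if "0 < x" for x i using that w by simp
  have big: "x \<le> wt (w(p := x)) m" if "lookup m p \<noteq> 0" "0 < x" for x m
    using wt_member[of "w(p := x)" m p] that upd_pos[of x] by (simp add: less_imp_le)
  assume "t' p \<notin> Fil t W (w(p := \<delta>)) \<delta>"
  then obtain m0 where m0: "m0 \<in> supp t W y" "wt (w(p := \<delta>)) m0 < \<delta>" by (auto simp: Fil_def y_def)
  have m0p: "lookup m0 p = 0" using big[of m0 \<delta>] m0(2) \<delta> by linarith
  \<comment> \<open>Monomials free of \<open>t p\<close> have the same weight whatever is assigned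
    to \<open>t p\<close>, so their minimum \<open>a\<close> can be found first and then be given to
    \<open>t p\<close> as its weight.\<close>
  define S where "S = {m \<in> supp t W y. lookup m p = 0}"
  have "S \<noteq> {}" using m0 m0p by (auto simp: S_def)
  then obtain A where A: "A \<in> S" "\<And>m. m \<in> S \<Longrightarrow> wt w A \<le> wt w m" using wt_argmin[of w S] w by blast
  define a where "a = wt w A"
  have a\<delta>: "a < \<delta>" using A(2)[of m0] m0 m0p wt0[OF m0p] by (auto simp: a_def S_def)
  have "tc t y 0 = 0" using rsp_maxid[OF rsp', of p] by (simp add: maxid_tc[OF rsp] y_def)
  hence "A \<noteq> 0" using A(1) by (auto simp: S_def supp_def)
  hence a: "0 < a" unfolding a_def using wt_positive[of w] w by blast
  have Ap: "lookup A p = 0" using A(1) by (simp add: S_def)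
  define \<tau> where "\<tau> = w(p := a)"
  have pos: "0 < \<tau> i" for i using upd_pos[OF a] by (simp add: \<tau>_def)
  have y: "y \<in> Fil t W \<tau> a"
    unfolding Fil_def
  proof (clarify)
    fix m assume m: "m \<in> supp t W y"
    show "a \<le> wt \<tau> m"
    proof (cases "lookup m p = 0")
      case True
      thus ?thesis using A(2)[of m] m wt0[OF True] by (simp add: a_def \<tau>_def S_def)
    qed (use big a in \<open>simp add: \<tau>_def\<close>)
  qed
  obtain c0 where c0: "0 < c0" "\<And>i. c0 \<le> w i" using positive_lower_bound[of w] w by blast
  \<comment> \<open>A lower bound for the excess weight over \<open>y^b\<close> of any other term
    \<open>u^A y^n\<close> of \<open>f\<close>: \<open>\<delta> - a\<close> covers
    \<open>n < b\<close>, the least weight \<open>c0\<close> of a further parameter covers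
    \<open>n = b\<close>, and \<open>a\<close> covers \<open>n > b\<close>.\<close>
  define \<eta> where "\<eta> = min c0 (min a (\<delta> - a))"
  have \<eta>: "0 < \<eta>" "\<eta> \<le> c0" "\<eta> \<le> a" "\<eta> \<le> \<delta> - a" using c0 a a\<delta> by (auto simp: \<eta>_def)
  define c where "c = tc t' f (single p b)"
  define h where "h = f - Const c * y ^ b"
  have yb: "y ^ b = monom_val t' (single p b)" by (simp add: y_def)
  have "h \<in> Fil t' W \<tau> (real b * a + \<eta>)"
    unfolding Fil_def
  proof (clarify)
    fix m assume m: "m \<in> supp t' W h"
    have tch: "tc t' h m = tc t' f m - c * (if m = single p b then 1 else 0)"
      unfolding h_def yb tc_diff[OF rsp'] tc_scale[OF rsp'] tc_monom_val[OF rsp'] ..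
    have ne: "m \<noteq> single p b" using m tch by (auto simp: supp_def c_def)
    hence "m \<in> supp t' W f" using m tch by (simp add: supp_def)
    hence ge: "real b * \<delta> \<le> wt (w(p := \<delta>)) m" using f by (simp add: Fil_def)
    define V where "V = wt (w(p := 0)) m"
    define n where "n = lookup m p"
    have V0: "0 \<le> V" unfolding V_def using w by (intro wt_nonneg) (auto simp: less_imp_le)
    have ge: "real b * \<delta> \<le> V + \<delta> * real n" using ge unfolding wt_upd[of w p \<delta>] V_def n_def .
    have goal: "wt \<tau> m = V + a * real n" unfolding \<tau>_def wt_upd[of w p a] V_def n_def ..
    consider "n < b" | "n = b" | "b < n" by linarith
    thus "real b * a + \<eta> \<le> wt \<tau> m"
    proof cases
      case 1
      have "1 * (\<delta> - a) \<le> (real b - real n) * (\<delta> - a)"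
        using 1 a\<delta> by (intro mult_right_mono) linarith+
      hence "\<eta> \<le> real b * \<delta> - real b * a - real n * \<delta> + real n * a" using \<eta>(4) by (simp add: algebra_simps)
      thus ?thesis unfolding goal using ge by (simp add: algebra_simps)
    next
      case 2
      have "\<exists>i. i \<noteq> p \<and> lookup m i \<noteq> 0"
      proof (rule ccontr)
        assume "\<not> (\<exists>i. i \<noteq> p \<and> lookup m i \<noteq> 0)"
        hence "m = single p b" using 2 by (intro poly_mapping_eqI) (auto simp: n_def lookup_single when_def)
        with ne show False ..
      qed
      then obtain i where i: "i \<noteq> p" "lookup m i \<noteq> 0" by blast
      have "(w(p := 0)) i \<le> V" unfolding V_def
        using w i by (intro wt_member) (auto simp: less_imp_le)
      hence "c0 \<le> V" using c0(2)[of i] i by simp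
      thus ?thesis unfolding goal using 2 \<eta> by (simp add: algebra_simps)
    next
      case 3
      have "a * (real b + 1) \<le> a * real n" using 3 a by (intro mult_left_mono) linarith+
      thus ?thesis unfolding goal using V0 \<eta> by (simp add: algebra_simps)
    qed
  qed
  hence h: "h \<in> Fil t W \<tau> (real b * a + \<eta>)"
  proof (rule Fil_change[OF rsp pos rsp', rotated -1])
    show "t' i \<in> ideal_of (t ` W)" if "i \<in> W" for i
      using off[of i] that p by (auto intro: ideal.span_base)
    show "t' i \<in> Fil t W \<tau> (\<tau> i)" if "i \<notin> W" for i
      using off[of i] Fil_param[OF rsp, of i W \<tau>] y by (cases "i = p") (auto simp: y_def \<tau>_def)
  qed
  have DF: "D g \<in> Fil t W \<tau> (\<gamma> - a)" if "g \<in> Fil t W \<tau> \<gamma>" for g \<gamma>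
    using Fil_derivation[OF rsp pos D DW _ that] DV[OF \<open>A \<noteq> 0\<close> Ap] by (simp add: \<tau>_def a_def)
  have Dh: "(D ^^ k) h \<in> Fil t W \<tau> (real b * a + \<eta> - real k * a)" for k
  proof (induction k)
    case (Suc k)
    from DF[OF Suc] show ?case by (simp add: algebra_simps)
  qed (use h in simp)
  obtain c' where c': "(D ^^ (b - 1)) (y ^ b) - Const c' * (D y ^ (b - 1) * y ^ (b - (b - 1)))
      \<in> Fil t W \<tau> (real (b - (b - 1)) * a + \<eta>)"
    using derivation_power_initial[OF rsp pos D DF y \<eta>(3), of "b - 1" b] by auto
  have b1: "b - (b - 1) = 1" using b by simp
  define x where "x = Const c * Const c' * D y ^ (b - 1)"
  define r where "r = Const c * ((D ^^ (b - 1)) (y ^ b) - Const c' * (D y ^ (b - 1) * y)) + (D ^^ (b - 1)) h"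
  have lin: "(D ^^ k) (Const c * y ^ b + h) = Const c * (D ^^ k) (y ^ b) + (D ^^ k) h" for k
    by (induction k) (simp_all add: derivationD[OF D])
  have "(D ^^ (b - 1)) f = (D ^^ (b - 1)) (Const c * y ^ b + h)" by (simp add: h_def)
  hence Gf: "(D ^^ (b - 1)) f = x * y + r" unfolding lin x_def r_def by (simp add: algebra_simps)
  have "(D ^^ (b - 1)) h \<in> Fil t W \<tau> (a + \<eta>)"
    using Dh[of "b - 1"] b by (simp add: of_nat_diff algebra_simps)
  moreover have "Const c * ((D ^^ (b - 1)) (y ^ b) - Const c' * (D y ^ (b - 1) * y)) \<in> Fil t W \<tau> (a + \<eta>)"
    using c' unfolding b1 by (intro Fil_scale[OF rsp pos]) simp
  ultimately have r: "r \<in> Fil t W \<tau> (a + \<eta>)" unfolding r_def by (intro Fil_add[OF rsp])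
  \<comment> \<open>In weight \<open>a\<close>, \<open>D^(b-1) f\<close> is a constant multiple of
    \<open>y\<close>. The coefficient of \<open>t p\<close> shows the constant to be nonzero, and
    then the monomial \<open>A\<close> of \<open>y\<close> contradicts \<open>G(2)\<close>.\<close>
  have eq: "tc t ((D ^^ (b - 1)) f) m = tc t x 0 * tc t y m" if m: "wt \<tau> m = a" "keys m \<inter> W = {}" for m
  proof -
    have "m \<notin> supp t W r" using r m \<eta> by (force simp: Fil_def)
    hence "tc t r m = 0" using m by (simp add: supp_def)
    thus ?thesis unfolding Gf tc_add[OF rsp] tc_mult_initial[OF rsp pos y m] by simp
  qed
  have "tc t ((D ^^ (b - 1)) f) (single p 1) = tc t x 0 * tc t y (single p 1)"
    by (rule eq) (use p in \<open>auto simp: \<tau>_def\<close>)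
  hence "tc t x 0 \<noteq> 0" using G(1) by auto
  moreover have "keys A \<inter> W = {}" "tc t y A \<noteq> 0" using A(1) by (auto simp: S_def supp_def)
  moreover have "tc t ((D ^^ (b - 1)) f) A = tc t x 0 * tc t y A"
    by (rule eq) (use wt0[OF Ap] calculation in \<open>auto simp: \<tau>_def a_def\<close>)
  ultimately show False using G(2)[OF _ Ap] by simp
qed

section \<open>Weights for which \<open>t p\<close> is the lightest parameter\<close>

lemma maxid_Fil:
  fixes t :: "'n::finite \<Rightarrow> ('k::field, 'n) mfps"
  assumes rsp: "rsp t" and "f \<in> maxid" and "\<And>i. c \<le> \<tau> i" "0 \<le> c"
  shows "f \<in> Fil t W \<tau> c"
  unfolding Fil_def
proof (clarify)
  fix m assume "m \<in> supp t W f"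
  hence "m \<noteq> 0" using assms(2) by (auto simp: supp_def maxid_tc[OF rsp])
  hence "1 \<le> mdeg m" by (metis less_one mdeg_eq_0_iff not_less)
  hence "c * 1 \<le> c * real (mdeg m)" using assms(4) by (intro mult_left_mono) auto
  also have "\<dots> \<le> wt \<tau> m" by (rule wt_lower) (rule assms(3))
  finally show "c \<le> wt \<tau> m" by simp
qed

text \<open>For \<open>\<theta> < 1\<close> the initial form with respect to the weight \<open>\<theta>\<close> of \<open>t\<^sub>p\<close> does not depend on the choice
  of \<open>t\<^sub>p\<close>; the weights \<open>(w, \<delta>)\<close> are perturbed to \<open>\<tau>\<^sub>s\<close>, for which this remains true.\<close>

lemma small_weight_stable:
  fixes t t' :: "'n::finite \<Rightarrow> ('k::field, 'n) mfps"
  assumes rsp: "rsp t" and rsp': "rsp t'" and p: "p \<notin> W" and off: "\<And>i. i \<noteq> p \<Longrightarrow> t' i = t i"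
    and w: "\<And>i. 0 < w i" and \<theta>: "0 < \<theta>" "\<theta> < 1" and \<delta>: "0 < \<delta>"
    and min: "\<And>m'. m' \<in> supp t W f \<Longrightarrow> wt ((\<lambda>_. 1)(p := \<theta>)) m \<le> wt ((\<lambda>_. 1)(p := \<theta>)) m'"
    and m: "m \<in> supp t W f" and f: "f \<in> Fil t' W (w(p := \<delta>)) \<gamma>"
  shows "\<gamma> \<le> wt (w(p := \<delta>)) m"
proof -
  define \<tau>\<^sub>0 :: "'n \<Rightarrow> real" where "\<tau>\<^sub>0 = (\<lambda>_. 1)(p := \<theta>)"
  define \<tau>\<^sub>1 where "\<tau>\<^sub>1 = w(p := \<delta>)"
  \<comment> \<open>With this value the combined weight \<tau> is \<open>1 - s\<close> at
    \<open>p\<close> and \<open>(1 - s) + s * w i\<close> elsewhere: \<open>t p\<close> stays the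
    lightest parameter, so every element of the maximal ideal has at least its weight.\<close>
  define s where "s = (1 - \<theta>) / (1 - \<theta> + \<delta>)"
  have s: "0 < s" "s < 1" "(1 - s) * (1 - \<theta>) = s * \<delta>" using \<theta> \<delta> by (auto simp: s_def field_simps)
  define \<tau> where "\<tau> = (\<lambda>i. (1 - s) * \<tau>\<^sub>0 i + s * \<tau>\<^sub>1 i)"
  have pos0: "0 < \<tau>\<^sub>0 i" for i using \<theta> by (simp add: \<tau>\<^sub>0_def)
  have pos: "0 < \<tau> i" for i
    unfolding \<tau>_def using pos0 w \<delta> s by (intro add_pos_pos mult_pos_pos) (auto simp: \<tau>\<^sub>1_def)
  have min_p: "\<tau> p \<le> \<tau> i" for i
  proof (cases "i = p")
    case False
    have "0 < s * w i" using s w by simp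
    thus ?thesis using False s(3) by (simp add: \<tau>_def \<tau>\<^sub>0_def \<tau>\<^sub>1_def algebra_simps)
  qed simp
  have ideal: "i \<in> W \<Longrightarrow> t i \<in> ideal_of (t' ` W)" "i \<in> W \<Longrightarrow> t' i \<in> ideal_of (t ` W)" for i
    using off[of i] p by (metis ideal.span_base image_eqI)+
  define \<gamma>\<^sub>0 where "\<gamma>\<^sub>0 = wt \<tau>\<^sub>0 m"
  have "f \<in> Fil t W \<tau>\<^sub>0 \<gamma>\<^sub>0" using min by (simp add: Fil_def \<gamma>\<^sub>0_def \<tau>\<^sub>0_def)
  \<comment> \<open>Transport from \<open>t\<close> to \<open>t'\<close> for the weights
    \<open>\<tau>\<^sub>0\<close>; the way back is made for \<tau>. Both are possible because
    \<open>t p\<close> and \<open>t' p\<close> lie in the maximal ideal and \<open>p\<close> has the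
    least weight.\<close>
  hence f0: "f \<in> Fil t' W \<tau>\<^sub>0 \<gamma>\<^sub>0"
  proof (rule Fil_change[OF rsp' pos0 rsp ideal(1), rotated -1])
    show "t i \<in> Fil t' W \<tau>\<^sub>0 (\<tau>\<^sub>0 i)" for i
    proof (cases "i = p")
      case True
      have "t p \<in> Fil t' W \<tau>\<^sub>0 \<theta>"
        using \<theta> by (intro maxid_Fil[OF rsp' rsp_maxid[OF rsp]]) (auto simp: \<tau>\<^sub>0_def)
      thus ?thesis using True by (simp add: \<tau>\<^sub>0_def)
    qed (use off[of i] Fil_param[OF rsp', of i W \<tau>\<^sub>0] in auto)
  qed
  have wt: "wt \<tau> k = (1 - s) * wt \<tau>\<^sub>0 k + s * wt \<tau>\<^sub>1 k" for k unfolding \<tau>_def by (rule wt_linear)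
  have "f \<in> Fil t' W \<tau> ((1 - s) * \<gamma>\<^sub>0 + s * \<gamma>)"
    unfolding Fil_def
  proof (clarify)
    fix k assume k: "k \<in> supp t' W f"
    have "(1 - s) * \<gamma>\<^sub>0 \<le> (1 - s) * wt \<tau>\<^sub>0 k" "s * \<gamma> \<le> s * wt \<tau>\<^sub>1 k"
      using k f0 f s by (auto simp: Fil_def \<tau>\<^sub>1_def)
    thus "(1 - s) * \<gamma>\<^sub>0 + s * \<gamma> \<le> wt \<tau> k" unfolding wt by linarith
  qed
  hence "f \<in> Fil t W \<tau> ((1 - s) * \<gamma>\<^sub>0 + s * \<gamma>)"
  proof (rule Fil_change[OF rsp pos rsp' ideal(2), rotated -1])
    show "t' i \<in> Fil t W \<tau> (\<tau> i)" for i
    proof (cases "i = p")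
      case True
      show ?thesis unfolding True
        by (rule maxid_Fil[OF rsp rsp_maxid[OF rsp'] min_p]) (use pos[of p] in simp)
    qed (use off[of i] Fil_param[OF rsp, of i W \<tau>] in auto)
  qed
  hence "(1 - s) * \<gamma>\<^sub>0 + s * \<gamma> \<le> wt \<tau> m" using m by (simp add: Fil_def)
  \<comment> \<open>As \<open>\<gamma>\<^sub>0\<close> is the exact weight of \<open>m\<close> for
    \<open>\<tau>\<^sub>0\<close>, its share cancels and the bound for \<open>\<tau>\<^sub>1\<close>
    is left.\<close>
  hence "s * \<gamma> \<le> s * wt \<tau>\<^sub>1 m" unfolding wt \<gamma>\<^sub>0_def by simp
  thus ?thesis using s by (simp add: \<tau>\<^sub>1_def)
qed

section \<open>Minimal expansions\<close>

definition minimals :: "('n \<Rightarrow>\<^sub>0 nat) set \<Rightarrow> ('n \<Rightarrow>\<^sub>0 nat) set" where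
  "minimals S = {m \<in> S. \<forall>m'\<in>S. mle m' m \<longrightarrow> m' = m}"

section \<open>Dickson's lemma for exponents\<close>

lemma nat_incseq_subseq:
  fixes x :: "nat \<Rightarrow> nat"
  shows "\<exists>h :: nat \<Rightarrow> nat. strict_mono h \<and> mono (\<lambda>n. x (h n))"
proof -
  obtain h where h: "strict_mono h" "monoseq (\<lambda>n. x (h n))" using seq_monosub by blast
  show ?thesis
  proof (cases "incseq (\<lambda>n. x (h n))")
    case True
    thus ?thesis using h(1) by (intro exI[of _ h] conjI)
  next
    case False
    hence dec: "decseq (\<lambda>n. x (h n))" using h(2) by (auto simp: monoseq_iff)
    \<comment> \<open>A decreasing sequence of natural numbers is constant from the position of its
      least value on.\<close>
    obtain k where k: "\<And>n. x (h k) \<le> x (h n)"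
      using ex_has_least_nat[of "\<lambda>_. True" 0 "\<lambda>n. x (h n)"] by auto
    have "x (h (k + n)) = x (h k)" for n
      using decseqD[OF dec, of k "k + n"] k[of "k + n"] by simp
    moreover have "strict_mono (\<lambda>n. h (k + n))" using h(1) by (simp add: strict_mono_def)
    ultimately show ?thesis by (intro exI[of _ "\<lambda>n. h (k + n)"]) (simp add: mono_def)
  qed
qed

lemma incseq_exponents_subseq:
  fixes s :: "nat \<Rightarrow> 'n \<Rightarrow>\<^sub>0 nat"
  assumes "finite A" shows "\<exists>h :: nat \<Rightarrow> nat. strict_mono h \<and> (\<forall>i\<in>A. mono (\<lambda>n. lookup (s (h n)) i))"
  using assms
proof (induction A rule: finite_induct)
  case empty
  show ?case by (intro exI[of _ "\<lambda>n. n"]) (simp add: strict_mono_def)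
next
  case (insert a A)
  then obtain h :: "nat \<Rightarrow> nat" where h: "strict_mono h" "\<And>i. i \<in> A \<Longrightarrow> mono (\<lambda>n. lookup (s (h n)) i)" by blast
  obtain g :: "nat \<Rightarrow> nat" where g: "strict_mono g" "mono (\<lambda>n. lookup (s (h (g n))) a)"
    using nat_incseq_subseq[of "\<lambda>n. lookup (s (h n)) a"] by blast
  have "mono (\<lambda>n. lookup (s (h (g n))) i)" if "i \<in> A" for i
    using h(2)[OF that] strict_mono_mono[OF g(1)] by (simp add: mono_def)
  moreover have "strict_mono (\<lambda>n. h (g n))" using h(1) g(1) by (simp add: strict_mono_def)
  ultimately show ?case using g(2) by (intro exI[of _ "\<lambda>n. h (g n)"]) auto
qed

text \<open>Infinitely many minimal exponents would contain a sequence that increases in every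
  coordinate, and its first two members would be comparable.\<close>

lemma finite_minimals: "finite (minimals (S :: ('n::finite \<Rightarrow>\<^sub>0 nat) set))"
proof (rule ccontr)
  assume "infinite (minimals S)"
  then obtain s :: "nat \<Rightarrow> 'n \<Rightarrow>\<^sub>0 nat" where s: "inj s" "range s \<subseteq> minimals S"
    using infinite_countable_subset by blast
  obtain h :: "nat \<Rightarrow> nat" where h: "strict_mono h" "\<And>i. mono (\<lambda>n. lookup (s (h n)) i)"
    using incseq_exponents_subseq[OF finite, of UNIV s] by blast
  have "mle (s (h 0)) (s (h 1))" unfolding mle_def using h(2) by (auto simp: mono_def)
  moreover have "s n \<in> minimals S" for n using s(2) by blast
  ultimately have "s (h 0) = s (h 1)" unfolding minimals_def by blast
  hence "h 0 = h 1" using s(1) by (rule injD[rotated])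
  moreover have "h 0 < h 1" using h(1) by (rule strict_monoD) simp
  ultimately show False by simp
qed

lemma minimals_below:
  fixes m :: "'n::finite \<Rightarrow>\<^sub>0 nat"
  assumes "m \<in> S" shows "\<exists>m'\<in>minimals S. mle m' m"
proof -
  obtain m' where m': "m' \<in> S \<and> mle m' m" "\<And>k. k \<in> S \<and> mle k m \<Longrightarrow> mdeg m' \<le> mdeg k"
    using ex_has_least_nat[of "\<lambda>m'. m' \<in> S \<and> mle m' m" m mdeg] assms by auto
  have "k = m'" if "k \<in> S" "mle k m'" for k
    using m' that mle_trans[of k m' m] mle_mdeg[of k m'] by (intro mle_mdeg_eq) (auto intro: order_antisym)
  thus ?thesis using m'(1) by (auto simp: minimals_def)
qed

context
  fixes t :: "'n::finite \<Rightarrow> ('k::field, 'n) mfps" and W :: "'n set"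
  assumes rsp: "rsp t"
begin

text \<open>Each exponent of \<open>f\<close> is sent to a minimal one below it, and its term is
  collected there. A minimal exponent is sent to itself, so the collected coefficient has a nonzero
  constant term and is a unit.\<close>

lemma expansion_minimals: "expansion (ideal_of (t ` W)) t (- W) f (minimals (supp t W f))"
proof -
  let ?X = "minimals (supp t W f)"
  define F where "F = Mfps (\<lambda>m. if keys m \<inter> W = {} then tc t f m else 0)"
  define c where "c m = (SOME m'. m' \<in> {m' \<in> ?X. mle m' m})" for m
  have c: "c m \<in> {m' \<in> ?X. mle m' m}" if "m \<in> supp t W f" for m
    unfolding c_def some_in_eq using minimals_below[OF that] by blast
  have cx: "c x = x" if "x \<in> ?X" for x
    using that c[of x] by (auto simp: minimals_def)
  define G where "G x = Mfps (\<lambda>k. if c (x + k) = x then mcoeff F (x + k) else 0)" for x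
  have "F = (\<Sum>x\<in>?X. Mono x * G x)"
    unfolding G_def
  proof (rule monomial_division[where e = "\<lambda>x. x", OF finite_minimals])
    fix m assume "mcoeff F m \<noteq> 0"
    hence "m \<in> supp t W f" by (auto simp: F_def supp_def split: if_splits)
    thus "c m \<in> ?X \<and> mle (c m) m" using c by blast
  qed
  hence "substitute t F = (\<Sum>x\<in>?X. substitute t (Mono x) * substitute t (G x))"
    by (simp only: kalg_homD[OF kalg_hom_substitute[OF rsp]])
  hence F: "substitute t F = (\<Sum>x\<in>?X. substitute t (G x) * monom_val t x)"
    by (simp only: substitute_monomial[OF rsp] mult.commute)
  have "substitute t (G x) \<notin> maxid" if "x \<in> ?X" for x
  proof -
    have "x \<in> supp t W f" using that by (simp add: minimals_def)
    thus ?thesis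
      using cx[OF that] by (simp add: maxid_tc[OF rsp] tc_substitute[OF rsp] G_def F_def supp_def)
  qed
  moreover have "f - (\<Sum>x\<in>?X. substitute t (G x) * monom_val t x) \<in> ideal_of (t ` W)"
    unfolding F[symmetric] ideal_tc[OF rsp] by (auto simp: supp_def tc_diff[OF rsp] tc_substitute[OF rsp] F_def)
  moreover have "\<forall>m\<in>?X. keys m \<subseteq> - W" by (auto simp: minimals_def supp_def)
  ultimately show ?thesis
    unfolding expansion_def using finite_minimals by (intro conjI exI[of _ "\<lambda>x. substitute t (G x)"]) auto
qed

text \<open>Nothing cancels at a minimal exponent \<open>k\<close> of the expansion: there
  \<open>f\<close> has the constant term of the unit \<open>C k\<close> as coefficient. So below
  every exponent of \<open>f\<close> lies one that belongs both to \<open>f\<close> and to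
  \<open>X\<close>.\<close>

lemma minimals_subset_expansion:
  assumes "expansion (ideal_of (t ` W)) t (- W) f X" shows "minimals (supp t W f) \<subseteq> X"
proof
  fix m assume m: "m \<in> minimals (supp t W f)"
  obtain C where X: "finite X" "\<And>m. m \<in> X \<Longrightarrow> keys m \<subseteq> - W" "\<And>m. m \<in> X \<Longrightarrow> C m \<notin> maxid"
      "f - (\<Sum>m\<in>X. C m * monom_val t m) \<in> ideal_of (t ` W)"
    using assms unfolding expansion_def by blast
  have tcf: "tc t f k = (\<Sum>m\<in>X. if mle m k then tc t (C m) (k - m) else 0)" if "keys k \<inter> W = {}" for k
  proof -
    have "tc t (f - (\<Sum>m\<in>X. C m * monom_val t m)) k = 0"
      using X(4) that by (auto simp: ideal_tc[OF rsp] supp_def)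
    hence "tc t f k = (\<Sum>m\<in>X. tc t (monom_val t m * C m) k)"
      by (simp add: tc_diff[OF rsp] tc_sum[OF rsp] mult.commute)
    thus ?thesis unfolding tc_monom_val_mult[OF rsp] .
  qed
  have "(\<Sum>x\<in>X. if mle x m then tc t (C x) (m - x) else 0) \<noteq> 0"
    using m tcf[of m] by (auto simp: minimals_def supp_def)
  then obtain x where "x \<in> X" "(if mle x m then tc t (C x) (m - x) else 0) \<noteq> 0"
    by (rule sum.not_neutral_contains_not_neutral)
  hence "x \<in> X" "mle x m" by (auto split: if_splits)
  then obtain k where k: "k \<in> minimals X" "mle k x" "mle x m" using minimals_below by blast
  have kX: "k \<in> X" using k(1) by (simp add: minimals_def)
  have kW: "keys k \<inter> W = {}" using X(2)[OF kX] by blast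
  have "tc t f k = (\<Sum>m\<in>X. if m = k then tc t (C k) 0 else 0)"
    unfolding tcf[OF kW] using k(1) by (intro sum.cong) (auto simp: minimals_def)
  hence "tc t f k = tc t (C k) 0" using X(1) kX by (simp add: sum.delta)
  hence "k \<in> supp t W f" using X(3)[OF kX] kW by (simp add: supp_def maxid_tc[OF rsp])
  moreover have "mle k m" using k by (blast intro: mle_trans)
  ultimately have "k = m" using m by (auto simp: minimals_def)
  thus "m \<in> X" using kX by simp
qed

lemma minimal_expansion_iff:
  "minimal_expansion (ideal_of (t ` W)) t (- W) f X \<longleftrightarrow> X = minimals (supp t W f)"
proof
  assume X: "minimal_expansion (ideal_of (t ` W)) t (- W) f X"
  hence "minimals (supp t W f) \<subseteq> X" "finite X" "card X \<le> card (minimals (supp t W f))"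
    using minimals_subset_expansion expansion_minimals by (auto simp: minimal_expansion_def expansion_def)
  thus "X = minimals (supp t W f)" by (metis card_seteq)
next
  have "card (minimals (supp t W f)) \<le> card X'" if "expansion (ideal_of (t ` W)) t (- W) f X'" for X'
  proof (rule card_mono)
    show "finite X'" using that by (simp add: expansion_def)
  qed (rule minimals_subset_expansion[OF that])
  moreover assume "X = minimals (supp t W f)"
  ultimately show "minimal_expansion (ideal_of (t ` W)) t (- W) f X"
    unfolding minimal_expansion_def using expansion_minimals by blast
qed

end

section \<open>Linear functionals on the projected polyhedron\<close>

text \<open>The case of a single \<open>y = t p\<close>; \<open>W\<close> holds the indices of the
  parameters \<open>y_1, ..., y_(r-1)\<close> that vanish on the ambient subscheme.\<close>

definition polyh :: "('n \<Rightarrow> ('k::field, 'n::finite) mfps) \<Rightarrow> 'n set \<Rightarrow> 'n \<Rightarrow> ('k, 'n) pair \<Rightarrow> (real ^ 'n) set" where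
  "polyh t W p F = proj_polyhedron (ideal_of (t ` W)) t (- insert p W) {p} F"

text \<open>All contributing exponents, not only the minimal ones: the additional points lie in the
  polyhedron anyway (\<open>polyh_mem\<close>), and the whole support is easier to follow through a
  change of parameters.\<close>

definition vertices :: "('n \<Rightarrow> ('k::field, 'n::finite) mfps) \<Rightarrow> 'n set \<Rightarrow> 'n \<Rightarrow> ('k, 'n) mfps \<Rightarrow> real \<Rightarrow> ('n \<Rightarrow>\<^sub>0 nat) set" where
  "vertices t W p f b = {m \<in> supp t W f. real (lookup m p) < b}"

context
  fixes t :: "'n::finite \<Rightarrow> ('k::field, 'n) mfps" and W :: "'n set" and p :: 'n and F :: "('k, 'n) pair"
  assumes rsp: "rsp t" and p: "p \<notin> W"
begin

lemma polyh_eq: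
  "polyh t W p F = (\<lambda>C. closed C \<and> convex C) hull
     (\<Union>{orthant_at b (- insert p W) {p} m | f b m.
         (f, b) \<in> F \<and> m \<in> minimals (supp t W f) \<and> real (lookup m p) < b})"
proof -
  have "- insert p W \<union> {p} = - W" using p by blast
  thus ?thesis
    unfolding polyh_def proj_polyhedron_def by (simp add: minimal_expansion_iff[OF rsp] ydeg_def)
qed

lemma closed_convex_polyh: "closed (polyh t W p F)" "convex (polyh t W p F)"
proof -
  have "closed (polyh t W p F) \<and> convex (polyh t W p F)"
    unfolding polyh_eq by (rule hull_in) (auto intro: closed_Inter convex_Inter)
  thus "closed (polyh t W p F)" "convex (polyh t W p F)" by auto
qed

lemma polyh_mem:
  assumes "(f, b) \<in> F" "m \<in> vertices t W p f b"
    and v: "\<And>i. i \<in> - insert p W \<Longrightarrow> real (lookup m i) / (b - real (lookup m p)) \<le> v $ i"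
      "\<And>i. i \<in> insert p W \<Longrightarrow> v $ i = 0"
  shows "v \<in> polyh t W p F"
proof -
  obtain k where k: "k \<in> minimals (supp t W f)" "mle k m"
    using minimals_below[of m "supp t W f"] assms(2) by (auto simp: vertices_def)
  have le: "lookup k i \<le> lookup m i" for i using k(2) by (simp add: mle_def)
  have b: "real (lookup m p) < b" using assms(2) by (simp add: vertices_def)
  hence kb: "real (lookup k p) < b" using le[of p] by linarith
  have yd: "ydeg {p} k = lookup k p" by (simp add: ydeg_def)
  have "v \<in> orthant_at b (- insert p W) {p} k"
    unfolding orthant_at_def mem_Collect_eq yd
  proof (intro conjI ballI allI impI)
    fix i assume i: "i \<in> - insert p W"
    \<comment> \<open>A smaller exponent has a smaller numerator and a larger
      \<open>b - |B|\<close>, so its orthant contains the given one.\<close>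
    have "real (lookup k i) / (b - real (lookup k p)) \<le> real (lookup m i) / (b - real (lookup m p))"
      using le[of i] le[of p] b by (intro frac_le) auto
    thus "real (lookup k i) / (b - real (lookup k p)) \<le> v $ i" using v(1)[OF i] by linarith
  qed (use v(2) in blast)
  hence "v \<in> \<Union>{orthant_at b (- insert p W) {p} m | f b m.
         (f, b) \<in> F \<and> m \<in> minimals (supp t W f) \<and> real (lookup m p) < b}"
    using assms(1) k(1) kb by blast
  thus ?thesis unfolding polyh_eq by (rule hull_inc)
qed

lemma polyh_subset:
  assumes "closed C" "convex C"
    and "\<And>f b m v. (f, b) \<in> F \<Longrightarrow> m \<in> vertices t W p f b \<Longrightarrow>
      (\<And>i. i \<in> - insert p W \<Longrightarrow> real (lookup m i) / (b - real (lookup m p)) \<le> v $ i) \<Longrightarrow>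
      (\<And>i. i \<in> insert p W \<Longrightarrow> v $ i = 0) \<Longrightarrow> v \<in> C"
  shows "polyh t W p F \<subseteq> C"
  unfolding polyh_eq
proof (rule hull_minimal)
  show "\<Union>{orthant_at b (- insert p W) {p} m | f b m.
         (f, b) \<in> F \<and> m \<in> minimals (supp t W f) \<and> real (lookup m p) < b} \<subseteq> C"
  proof (clarify)
    fix v f b m
    assume a: "(f, b) \<in> F" "m \<in> minimals (supp t W f)" "real (lookup m p) < b"
      "v \<in> orthant_at b (- insert p W) {p} m"
    show "v \<in> C"
    proof (rule assms(3)[OF a(1)])
      show "m \<in> vertices t W p f b" using a by (simp add: vertices_def minimals_def)
    qed (use a(4) in \<open>auto simp: orthant_at_def ydeg_def\<close>)
  qed
qed (use assms in simp)

lemma polyh_lower: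
  assumes "\<And>i. 0 \<le> w i"
    and "\<And>f b m. (f, b) \<in> F \<Longrightarrow> m \<in> vertices t W p f b \<Longrightarrow>
      c \<le> (\<Sum>i\<in>- insert p W. w i * (real (lookup m i) / (b - real (lookup m p))))"
    and "v \<in> polyh t W p F"
  shows "c \<le> (\<Sum>i\<in>- insert p W. w i * v $ i)"
proof -
  define a :: "real ^ 'n" where "a = (\<chi> i. if i \<in> - insert p W then w i else 0)"
  have inner: "a \<bullet> x = (\<Sum>i\<in>- insert p W. w i * x $ i)" for x
    unfolding inner_vec_def by (rule sum.mono_neutral_cong_right) (auto simp: a_def)
  have "polyh t W p F \<subseteq> {x. a \<bullet> x \<ge> c}"
  proof (rule polyh_subset)
    fix f b m x
    assume m: "(f, b) \<in> F" "m \<in> vertices t W p f b"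
      "\<And>i. i \<in> - insert p W \<Longrightarrow> real (lookup m i) / (b - real (lookup m p)) \<le> x $ i"
    have "(\<Sum>i\<in>- insert p W. w i * (real (lookup m i) / (b - real (lookup m p)))) \<le> a \<bullet> x"
      unfolding inner using m(3) assms(1) by (intro sum_mono mult_left_mono) auto
    thus "x \<in> {x. a \<bullet> x \<ge> c}" using assms(2)[OF m(1,2)] by auto
  qed (auto intro: closed_halfspace_ge convex_halfspace_ge)
  thus ?thesis using assms(3) inner by auto
qed

lemma vertex_point_mem:
  assumes "(f, b) \<in> F" "m \<in> vertices t W p f b"
  shows "(\<chi> i. if i \<in> - insert p W then real (lookup m i) / (b - real (lookup m p)) else 0) \<in> polyh t W p F"
  by (rule polyh_mem[OF assms]) auto

text \<open>A lower bound on the generating points defines a closed half-space, which therefore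
  contains the hull; nonnegative coefficients take care of the orthants.\<close>

lemma INF_polyh:
  assumes "\<And>i. 0 \<le> w i"
  shows "(INF v\<in>polyh t W p F. ereal (\<Sum>i\<in>- insert p W. w i * v $ i))
    = (INF (f, b)\<in>F. INF m\<in>vertices t W p f b.
        ereal (\<Sum>i\<in>- insert p W. w i * (real (lookup m i) / (b - real (lookup m p)))))" (is "?L = ?R")
proof (rule antisym)
  show "?L \<le> ?R"
  proof (intro INF_greatest, clarify, intro INF_greatest)
    fix f b m assume m: "(f, b) \<in> F" "m \<in> vertices t W p f b"
    from INF_lower[OF vertex_point_mem[OF this], of "\<lambda>v. ereal (\<Sum>i\<in>- insert p W. w i * v $ i)"]
    show "?L \<le> ereal (\<Sum>i\<in>- insert p W. w i * (real (lookup m i) / (b - real (lookup m p))))"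
      by simp
  qed
  show "?R \<le> ?L"
  proof (rule INF_greatest, rule ccontr)
    fix v assume v: "v \<in> polyh t W p F" and "\<not> ?R \<le> ereal (\<Sum>i\<in>- insert p W. w i * v $ i)"
    hence lt: "ereal (\<Sum>i\<in>- insert p W. w i * v $ i) < ?R" by (simp only: not_le)
    \<comment> \<open>A real number in between is needed because the right-hand side may be
      infinite.\<close>
    obtain c where c: "ereal (\<Sum>i\<in>- insert p W. w i * v $ i) < ereal c" "ereal c < ?R"
      using ereal_dense2[OF lt] by blast
    have "c \<le> (\<Sum>i\<in>- insert p W. w i * (real (lookup m i) / (b - real (lookup m p))))"
      if m: "(f, b) \<in> F" "m \<in> vertices t W p f b" for f b m
    proof -
      have "?R \<le> (INF m\<in>vertices t W p f b. ereal (\<Sum>i\<in>- insert p W. w i * (real (lookup m i) / (b - real (lookup m p)))))"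
        using INF_lower[OF m(1), of "\<lambda>(f, b). INF m\<in>vertices t W p f b. ereal (\<Sum>i\<in>- insert p W. w i * (real (lookup m i) / (b - real (lookup m p))))"]
        by simp
      also have "\<dots> \<le> ereal (\<Sum>i\<in>- insert p W. w i * (real (lookup m i) / (b - real (lookup m p))))"
        by (rule INF_lower[OF m(2)])
      finally have "ereal c < ereal (\<Sum>i\<in>- insert p W. w i * (real (lookup m i) / (b - real (lookup m p))))"
        using c(2) by (rule less_le_trans[rotated])
      thus ?thesis by simp
    qed
    hence "c \<le> (\<Sum>i\<in>- insert p W. w i * v $ i)" using assms v by (intro polyh_lower)
    thus False using c(1) by simp
  qed
qed

lemma wt_split:
  assumes "keys m \<inter> W = {}"
  shows "wt (w(p := \<delta>)) m = (\<Sum>i\<in>- insert p W. w i * real (lookup m i)) + \<delta> * real (lookup m p)"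
proof -
  have "wt (w(p := 0)) m = (\<Sum>i\<in>- insert p W. (w(p := 0)) i * real (lookup m i))"
    unfolding wt_def using assms by (intro sum.mono_neutral_right) (auto simp: in_keys_iff)
  also have "\<dots> = (\<Sum>i\<in>- insert p W. w i * real (lookup m i))" by (intro sum.cong) auto
  finally show ?thesis by (subst wt_upd) simp
qed

text \<open>Clearing denominators turns \<open>\<delta> \<le> \<lambda>(A) / (b - |B|)\<close> into
  \<open>b * \<delta> \<le> \<lambda>(A) + \<delta> * |B|\<close>, which is a weight bound with
  weight \<delta> on \<open>t p\<close>. Exponents with \<open>|B| \<ge> b\<close> satisfy it
  automatically.\<close>

lemma Fil_iff_vertices:
  assumes w: "\<And>i. 0 < w i" "0 < \<delta>"
  shows "f \<in> Fil t W (w(p := \<delta>)) (b * \<delta>) \<longleftrightarrow> (\<forall>m\<in>vertices t W p f b.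
    \<delta> \<le> (\<Sum>i\<in>- insert p W. w i * (real (lookup m i) / (b - real (lookup m p)))))"
proof -
  have "b * \<delta> \<le> wt (w(p := \<delta>)) m \<longleftrightarrow> (m \<in> vertices t W p f b \<longrightarrow>
    \<delta> \<le> (\<Sum>i\<in>- insert p W. w i * (real (lookup m i) / (b - real (lookup m p)))))"
    if m: "m \<in> supp t W f" for m
  proof -
    let ?S = "\<Sum>i\<in>- insert p W. w i * real (lookup m i)"
    have wt: "wt (w(p := \<delta>)) m = ?S + \<delta> * real (lookup m p)"
      using m by (intro wt_split) (simp add: supp_def)
    show ?thesis
    proof (cases "real (lookup m p) < b")
      case True
      have e: "(\<Sum>i\<in>- insert p W. w i * (real (lookup m i) / (b - real (lookup m p)))) = ?S / (b - real (lookup m p))"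
        by (simp add: sum_divide_distrib)
      have "\<delta> \<le> ?S / (b - real (lookup m p)) \<longleftrightarrow> \<delta> * (b - real (lookup m p)) \<le> ?S"
        using True by (intro pos_le_divide_eq) simp
      also have "\<dots> \<longleftrightarrow> b * \<delta> \<le> ?S + \<delta> * real (lookup m p)" by (simp add: right_diff_distrib mult.commute diff_le_eq)
      finally show ?thesis unfolding wt e using True m by (simp add: vertices_def)
    next
      case False
      hence "b * \<delta> \<le> \<delta> * real (lookup m p)" using w(2) by simp
      moreover have "0 \<le> ?S" using w(1) by (intro sum_nonneg) (simp add: less_imp_le)
      ultimately show ?thesis unfolding wt using False by (simp add: vertices_def)
    qed
  qed
  thus ?thesis unfolding Fil_def by (auto simp: vertices_def)
qed

text \<open>Separation by a hyperplane. The normal vector has no negative entry on the relevant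
  coordinates, because the polyhedron is stable under adding vectors of the orthant; a small
  perturbation makes the entries strictly positive, as the filtrations require.\<close>

lemma polyh_separate:
  assumes v: "v \<notin> polyh t W p F" "\<And>i. 0 \<le> v $ i" "\<And>i. i \<in> insert p W \<Longrightarrow> v $ i = 0"
  shows "\<exists>w \<delta>. (\<forall>i. 0 < w i) \<and> 0 < \<delta> \<and> (\<Sum>i\<in>- insert p W. w i * v $ i) < \<delta>
    \<and> (\<forall>(f, b)\<in>F. f \<in> Fil t W (w(p := \<delta>)) (b * \<delta>))"
proof -
  let ?U = "- insert p W"
  have Fil: "\<forall>(f, b)\<in>F. f \<in> Fil t W (w(p := \<delta>)) (b * \<delta>)"
    if w: "\<And>i. 0 < w i" "0 < \<delta>"
      and le: "\<And>f b m. (f, b) \<in> F \<Longrightarrow> m \<in> vertices t W p f b \<Longrightarrow>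
        \<delta> \<le> (\<Sum>i\<in>?U. w i * (real (lookup m i) / (b - real (lookup m p))))" for w \<delta>
    using le by (auto simp: Fil_iff_vertices[OF w])
  show ?thesis
  proof (cases "\<exists>f b. (f, b) \<in> F \<and> vertices t W p f b \<noteq> {}")
    case False
    hence none: "\<And>f b m. (f, b) \<in> F \<Longrightarrow> m \<notin> vertices t W p f b" by blast
    have "0 \<le> (\<Sum>i\<in>?U. v $ i)" using v(2) by (intro sum_nonneg)
    thus ?thesis
      using Fil[of "\<lambda>_. 1" "(\<Sum>i\<in>?U. v $ i) + 1"] none
      by (intro exI[of _ "\<lambda>_. 1"] exI[of _ "(\<Sum>i\<in>?U. v $ i) + 1"]) auto
  next
    case True
    then obtain f0 b0 m0 where m0: "(f0, b0) \<in> F" "m0 \<in> vertices t W p f0 b0" by blast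
    obtain a c where ac: "a \<bullet> v < c" "\<And>x. x \<in> polyh t W p F \<Longrightarrow> c < a \<bullet> x"
      using separating_hyperplane_closed_point[OF closed_convex_polyh(2,1) v(1)] by blast
    define q where "q m b = (\<chi> i. if i \<in> ?U then real (lookup m i) / (b - real (lookup m p)) else 0)"
      for m :: "'n \<Rightarrow>\<^sub>0 nat" and b
    have anonneg: "0 \<le> a $ i" if i: "i \<in> ?U" for i
    proof (rule ccontr)
      assume "\<not> 0 \<le> a $ i"
      hence neg: "a $ i < 0" by simp
      \<comment> \<open>Moving this far in direction \<open>i\<close> would bring the functional
        down to at most \<open>c\<close>.\<close>
      define s where "s = max 0 ((a \<bullet> q m0 b0 - c) / - (a $ i))"
      have "q m0 b0 + s *\<^sub>R axis i 1 \<in> polyh t W p F"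
        by (rule polyh_mem[OF m0]) (use i in \<open>auto simp: q_def axis_def s_def\<close>)
      hence "c < a \<bullet> (q m0 b0 + s *\<^sub>R axis i 1)" by (rule ac(2))
      also have "\<dots> = a \<bullet> q m0 b0 + s * a $ i" by (simp add: inner_add_right inner_axis)
      also have "\<dots> \<le> c"
      proof -
        have "(a \<bullet> q m0 b0 - c) / - (a $ i) \<le> s" by (simp add: s_def)
        thus ?thesis using neg by (simp add: field_simps)
      qed
      finally show False by simp
    qed
    define A where "A = (\<Sum>i\<in>?U. a $ i * v $ i)"
    define B where "B = (\<Sum>i\<in>?U. v $ i)"
    have split: "a \<bullet> x = (\<Sum>i\<in>?U. a $ i * x $ i)" if "\<And>i. i \<in> insert p W \<Longrightarrow> x $ i = 0" for x
      unfolding inner_vec_def using that by (intro sum.mono_neutral_cong_right) auto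
    have A: "A < c" using ac(1) split[OF v(3)] by (simp add: A_def)
    have B: "0 \<le> B" unfolding B_def using v(2) by (intro sum_nonneg)
    \<comment> \<open>Adding \<eta> to each entry keeps the value at \<open>v\<close> below
      \<open>c\<close> and can only raise the values at the generating points.\<close>
    define \<eta> where "\<eta> = (c - A) / (B + 1)"
    have \<eta>: "0 < \<eta>" "A + \<eta> * B < c"
    proof -
      show "0 < \<eta>" using A B by (simp add: \<eta>_def)
      have "\<eta> * (B + 1) = c - A" using B by (simp add: \<eta>_def)
      thus "A + \<eta> * B < c" using \<open>0 < \<eta>\<close> by (simp add: algebra_simps)
    qed
    define w where "w i = (if i \<in> ?U then a $ i + \<eta> else 1)" for i
    have w: "0 < w i" for i
      unfolding w_def using anonneg[of i] \<eta>(1) by (auto intro: add_nonneg_pos)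
    have wv: "(\<Sum>i\<in>?U. w i * v $ i) < c"
    proof -
      have "(\<Sum>i\<in>?U. w i * v $ i) = A + \<eta> * B"
        unfolding A_def B_def sum_distrib_left sum.distrib[symmetric] w_def
        by (intro sum.cong) (auto simp: algebra_simps)
      thus ?thesis using \<eta>(2) by simp
    qed
    have c: "0 < c"
    proof -
      have "0 \<le> (\<Sum>i\<in>?U. w i * v $ i)" using w v(2) by (intro sum_nonneg mult_nonneg_nonneg) (auto simp: less_imp_le)
      thus ?thesis using wv by simp
    qed
    have "c \<le> (\<Sum>i\<in>?U. w i * (real (lookup m i) / (b - real (lookup m p))))"
      if m: "(f, b) \<in> F" "m \<in> vertices t W p f b" for f b m
    proof -
      have "c < a \<bullet> q m b" unfolding q_def by (rule ac(2)[OF vertex_point_mem[OF m]])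
      also have "\<dots> = (\<Sum>i\<in>?U. a $ i * (real (lookup m i) / (b - real (lookup m p))))"
        by (subst split) (auto simp: q_def intro!: sum.cong)
      also have "\<dots> \<le> (\<Sum>i\<in>?U. w i * (real (lookup m i) / (b - real (lookup m p))))"
        using \<eta>(1) m(2) by (intro sum_mono mult_right_mono) (auto simp: w_def vertices_def)
      finally show ?thesis by simp
    qed
    from Fil[OF w c this] show ?thesis
      by (intro exI[of _ w] exI[of _ c] conjI allI w c wv)
  qed
qed

end

section \<open>Orders of the coefficients\<close>

lemma enat_le_Sup_iff:
  assumes "0 \<in> S" "\<And>k l. l \<in> S \<Longrightarrow> k \<le> l \<Longrightarrow> k \<in> S"
  shows "enat k \<le> Sup (enat ` S) \<longleftrightarrow> k \<in> S"
proof
  assume le: "enat k \<le> Sup (enat ` S)"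
  show "k \<in> S"
  proof (rule ccontr)
    assume k: "k \<notin> S"
    have "Sup (enat ` S) \<le> enat (k - 1)"
    proof (rule Sup_least)
      fix x assume "x \<in> enat ` S"
      then obtain l where "l \<in> S" "x = enat l" by blast
      with k assms(2)[of l k] show "x \<le> enat (k - 1)" by (cases "k \<le> l") auto
    qed
    hence "enat k \<le> enat (k - 1)" using le by (rule order_trans[rotated])
    hence "k = 0" by auto
    thus False using k assms(1) by simp
  qed
qed (auto intro: Sup_upper)

lemma ord_mod_le:
  fixes t :: "'n::finite \<Rightarrow> ('k::field, 'n) mfps"
  assumes "rsp t"
  shows "enat k \<le> ord_mod (ideal_of (t ` W)) f \<longleftrightarrow> (\<forall>m\<in>supp t W f. k \<le> mdeg m)"
proof -
  have "enat k \<le> ord_mod (ideal_of (t ` W)) f \<longleftrightarrow> k \<in> {k. \<forall>m\<in>supp t W f. k \<le> mdeg m}"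
    unfolding ord_mod_def ideal_van_tc[OF assms] by (rule enat_le_Sup_iff) (auto intro: order_trans)
  thus ?thesis by simp
qed

lemma ideal_power_diff:
  assumes "is_ideal I" "x - y \<in> I" shows "x ^ k - y ^ k \<in> I"
proof (induction k)
  case 0
  show ?case using ideal.subspace_0[OF assms(1)] by simp
next
  case (Suc k)
  have "x ^ Suc k - y ^ Suc k = x * (x ^ k - y ^ k) + y ^ k * (x - y)" by (simp add: algebra_simps)
  also have "\<dots> \<in> I"
    using assms Suc by (intro ideal.subspace_add[OF assms(1)] ideal.subspace_scale[OF assms(1)])
  finally show ?case .
qed

lemma on_sub_multiple:
  assumes "on_sub I T s" shows "\<exists>a. T - a * s \<in> ideal_of I"
proof -
  have "T \<in> ideal_of (insert s I)" using assms by (metis on_sub_def ideal.span_base insertI1)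
  thus ?thesis unfolding ideal.span_insert by blast
qed

lemma on_sub_sym: "on_sub I T s \<Longrightarrow> on_sub I s T"
  by (simp add: on_sub_def)

lemma divisible_on_sub:
  assumes I: "is_ideal I" and sub: "on_sub I T s" and g: "\<exists>g. h - T ^ k * g \<in> I"
  shows "\<exists>g. h - s ^ k * g \<in> I"
proof -
  obtain g where g: "h - T ^ k * g \<in> I" using g by blast
  have "ideal_of I = I" using I by (rule ideal.span_eq_iff[THEN iffD2])
  with on_sub_multiple[OF sub] have "\<exists>a. T - a * s \<in> I" by (simp only:)
  then obtain a where "T - a * s \<in> I" by blast
  hence "T ^ k - (a * s) ^ k \<in> I" by (rule ideal_power_diff[OF I])
  hence "g * (T ^ k - (a * s) ^ k) \<in> I" by (rule ideal.subspace_scale[OF I])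
  with g have "(h - T ^ k * g) + g * (T ^ k - (a * s) ^ k) \<in> I" by (rule ideal.subspace_add[OF I])
  moreover have "(h - T ^ k * g) + g * (T ^ k - (a * s) ^ k) = h - s ^ k * (a ^ k * g)"
    by (simp add: algebra_simps power_mult_distrib)
  ultimately show ?thesis by auto
qed

text \<open>Modulo the ideal, \<open>T\<close> and \<open>t i\<close> divide each other, so
  divisibility by their powers agrees; for \<open>t i\<close> it is read off from the
  exponents.\<close>

lemma ord_along_le:
  fixes t :: "'n::finite \<Rightarrow> ('k::field, 'n) mfps"
  assumes rsp: "rsp t" and sub: "on_sub (ideal_of (t ` W)) T (t i)"
  shows "enat k \<le> ord_along (ideal_of (t ` W)) T f \<longleftrightarrow> (\<forall>m\<in>supp t W f. k \<le> lookup m i)"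
proof -
  let ?I = "ideal_of (t ` W)"
  have id: "is_ideal ?I" by (rule ideal.subspace_span)
  have "(\<exists>g. f - t i ^ k * g \<in> ?I) \<longleftrightarrow> (\<forall>m\<in>supp t W f. k \<le> lookup m i)" for k
  proof
    assume "\<exists>g. f - t i ^ k * g \<in> ?I"
    then obtain g where g: "f - monom_val t (single i k) * g \<in> ?I" by auto
    show "\<forall>m\<in>supp t W f. k \<le> lookup m i"
    proof
      fix m assume m: "m \<in> supp t W f"
      hence "tc t (f - monom_val t (single i k) * g) m = 0"
        using g by (auto simp: ideal_tc[OF rsp] supp_def)
      hence "tc t (monom_val t (single i k) * g) m \<noteq> 0"
        using m unfolding tc_diff[OF rsp] by (simp add: supp_def del: monom_val_single)
      hence "mle (single i k) m" unfolding tc_monom_val_mult[OF rsp] by (auto split: if_splits)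
      thus "k \<le> lookup m i" by (auto simp: mle_def dest: spec[of _ i])
    qed
  next
    assume s: "\<forall>m\<in>supp t W f. k \<le> lookup m i"
    define F where "F = Mfps (\<lambda>m. if keys m \<inter> W = {} then tc t f m else 0)"
    have "\<exists>G. F = Mono (single i k) * G"
    proof -
      have "F = (\<Sum>x\<in>{()}. Mono (single i k) * Mfps (\<lambda>l. if () = x then mcoeff F (single i k + l) else 0))"
        by (rule monomial_division[where c = "\<lambda>_. ()"])
          (use s in \<open>auto simp: F_def supp_def mle_def lookup_single when_def split: if_splits\<close>)
      thus ?thesis by auto
    qed
    then obtain G where "F = Mono (single i k) * G" by blast
    hence "substitute t F = t i ^ k * substitute t G"
      by (simp add: kalg_homD[OF kalg_hom_substitute[OF rsp]] substitute_monomial[OF rsp])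
    moreover have "f - substitute t F \<in> ?I"
      by (auto simp: ideal_tc[OF rsp] supp_def tc_diff[OF rsp] tc_substitute[OF rsp] F_def)
    ultimately show "\<exists>g. f - t i ^ k * g \<in> ?I" by auto
  qed
  moreover have "(\<exists>g. f - T ^ k * g \<in> ?I) \<longleftrightarrow> (\<exists>g. f - t i ^ k * g \<in> ?I)" for k
    using divisible_on_sub[OF id sub, of f k] divisible_on_sub[OF id on_sub_sym[OF sub], of f k] by blast
  ultimately have "enat k \<le> ord_along ?I T f \<longleftrightarrow> k \<in> {k. \<forall>m\<in>supp t W f. k \<le> lookup m i}"
    unfolding ord_along_def by (simp only:) (rule enat_le_Sup_iff, auto intro: order_trans)
  thus ?thesis by simp
qed

text \<open>The coefficient of \<open>u^A\<close> in \<open>\<partial>^q f / \<partial>y^q\<close>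
  at \<open>y = 0\<close> is a nonzero multiple of that of \<open>u^A y^q\<close> in
  \<open>f\<close>, so both sides minimise the same quotients, the left one first for fixed
  \<open>q\<close>. \<open>val\<close> covers the order (all weights 1) and the order along one
  \<open>t j\<close> (a single weight 1).\<close>

lemma INF_coefficients:
  fixes t :: "'n::finite \<Rightarrow> ('k::field_char_0, 'n) mfps" and w :: "'n \<Rightarrow> nat"
  assumes rsp: "rsp t" and p: "p \<notin> W"
    and val: "\<And>k h. enat k \<le> val h \<longleftrightarrow> (\<forall>m\<in>supp t (insert p W) h. k \<le> (\<Sum>i\<in>- insert p W. w i * lookup m i))"
  shows "(INF q\<in>{q. real q < b}. ereal_of_enat (val ((partial t p ^^ q) f)) / ereal (b - real q))
    = (INF m\<in>vertices t W p f b. ereal (\<Sum>i\<in>- insert p W. real (w i) * (real (lookup m i) / (b - real (lookup m p)))))"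
    (is "?L = ?R")
proof -
  let ?\<nu> = "\<lambda>m. \<Sum>i\<in>- insert p W. w i * lookup m i"
  have \<nu>: "ereal (\<Sum>i\<in>- insert p W. real (w i) * (real (lookup m i) / (b - real (lookup m p))))
      = ereal (real (?\<nu> m)) / ereal (b - real (lookup m p))" if "real (lookup m p) < b" for m
    using that by (simp add: sum_divide_distrib)
  have mem: "m \<in> supp t (insert p W) ((partial t p ^^ q) f) \<longleftrightarrow> m + single p q \<in> supp t W f \<and> lookup m p = 0" for m q
  proof -
    obtain c where "c \<noteq> 0" "tc t ((partial t p ^^ q) f) m = c * tc t f (m + single p q)"
      using tc_partial_power[OF rsp] by blast
    thus ?thesis using p by (cases "q = 0") (auto simp: supp_def keys_add_nat in_keys_iff)
  qed
  have shift: "?\<nu> (m + single p q) = ?\<nu> m" for m q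
    by (intro sum.cong) (auto simp: lookup_add lookup_single when_def)
  show ?thesis
  proof (rule antisym)
    show "?L \<le> ?R"
    proof (rule INF_greatest)
      fix m assume m: "m \<in> vertices t W p f b"
      define q where "q = lookup m p"
      have q: "real q < b" using m by (simp add: vertices_def q_def)
      have "mle (single p q) m" by (auto simp: mle_def q_def lookup_single when_def)
      from mle_imp_add[OF this] obtain k where k: "m = k + single p q" by (metis add.commute)
      have "q = lookup k p + q" using arg_cong[OF k, of "\<lambda>m. lookup m p"] by (simp add: q_def lookup_add)
      hence "lookup k p = 0" by simp
      hence "k \<in> supp t (insert p W) ((partial t p ^^ q) f)" using mem m k by (simp add: vertices_def)
      \<comment> \<open>\<open>val\<close> is known only through its lower bounds, so an upper bound
        has to come from the failure of the next one.\<close>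
      hence "\<not> enat (Suc (?\<nu> k)) \<le> val ((partial t p ^^ q) f)"
        unfolding val by (intro notI) (drule bspec, assumption, simp)
      hence "val ((partial t p ^^ q) f) \<le> enat (?\<nu> k)" by (simp only: Suc_ile_eq not_less)
      hence "ereal_of_enat (val ((partial t p ^^ q) f)) \<le> ereal_of_enat (enat (?\<nu> m))"
        unfolding k shift by (simp only: ereal_of_enat_le_iff)
      hence "ereal_of_enat (val ((partial t p ^^ q) f)) \<le> ereal (real (?\<nu> m))"
        by (simp only: ereal_of_enat_simps)
      hence "ereal_of_enat (val ((partial t p ^^ q) f)) / ereal (b - real q) \<le> ereal (real (?\<nu> m)) / ereal (b - real q)"
        using q by (intro ereal_divide_right_mono) auto
      also have "\<dots> = ereal (\<Sum>i\<in>- insert p W. real (w i) * (real (lookup m i) / (b - real (lookup m p))))"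
        using \<nu>[of m] q by (simp add: q_def)
      finally show "?L \<le> ereal (\<Sum>i\<in>- insert p W. real (w i) * (real (lookup m i) / (b - real (lookup m p))))"
        using q by (intro INF_lower2[of q]) auto
    qed
    show "?R \<le> ?L"
    proof (rule INF_greatest)
      fix q assume "q \<in> {q. real q < b}"
      hence q: "real q < b" by simp
      show "?R \<le> ereal_of_enat (val ((partial t p ^^ q) f)) / ereal (b - real q)"
      proof (cases "val ((partial t p ^^ q) f)")
        case infinity
        thus ?thesis using q by simp
      next
        case (enat k)
        hence "\<not> enat (Suc k) \<le> val ((partial t p ^^ q) f)" by simp
        then obtain m where m: "m \<in> supp t (insert p W) ((partial t p ^^ q) f)" "\<not> Suc k \<le> ?\<nu> m"
          unfolding val by blast
        define m' where "m' = m + single p q"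
        have m': "m' \<in> supp t W f" "lookup m' p = q"
          using m(1) mem by (auto simp: m'_def lookup_add)
        have "?R \<le> ereal (\<Sum>i\<in>- insert p W. real (w i) * (real (lookup m' i) / (b - real (lookup m' p))))"
          using m' q by (intro INF_lower) (simp add: vertices_def)
        also have "\<dots> = ereal (real (?\<nu> m')) / ereal (b - real q)" using \<nu>[of m'] m' q by simp
        also have "\<dots> \<le> ereal (real k) / ereal (b - real q)"
        proof (rule ereal_divide_right_mono)
          have "?\<nu> m' \<le> k" using m(2) unfolding m'_def shift by simp
          thus "ereal (real (?\<nu> m')) \<le> ereal (real k)" by (simp only: ereal_less_eq of_nat_le_iff)
        qed (use q in simp)
        finally show ?thesis using enat by simp
      qed
    qed
  qed
qed

lemma mu_delta:
  fixes t :: "'n::finite \<Rightarrow> ('k::field_char_0, 'n) mfps"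
  assumes rsp: "rsp t" and p: "p \<notin> W"
  shows "(INF (f, b)\<in>F. INF q\<in>{q. real q < b}.
      ereal_of_enat (ord_mod (ideal_of (t ` insert p W)) ((partial t p ^^ q) f)) / ereal (b - real q))
    = delta (- insert p W) (polyh t W p F)"
proof -
  have val: "enat k \<le> ord_mod (ideal_of (t ` insert p W)) h
      \<longleftrightarrow> (\<forall>m\<in>supp t (insert p W) h. k \<le> (\<Sum>i\<in>- insert p W. 1 * lookup m i))" for k h
  proof -
    have "mdeg m = (\<Sum>i\<in>- insert p W. 1 * lookup m i)" if "m \<in> supp t (insert p W) h" for m
      unfolding mdeg_def using that by (intro sum.mono_neutral_cong_right) (auto simp: supp_def in_keys_iff)
    thus ?thesis unfolding ord_mod_le[OF rsp] by auto
  qed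
  show ?thesis
    unfolding delta_def INF_coefficients[OF rsp p val]
    using INF_polyh[OF rsp p, of "\<lambda>_. 1" F] by simp
qed

lemma muH_dcoord:
  fixes t :: "'n::finite \<Rightarrow> ('k::field_char_0, 'n) mfps"
  assumes rsp: "rsp t" and p: "p \<notin> W" and j: "j \<in> - insert p W" and sub: "on_sub (ideal_of (t ` insert p W)) T (t j)"
  shows "(INF (f, b)\<in>F. INF q\<in>{q. real q < b}.
      ereal_of_enat (ord_along (ideal_of (t ` insert p W)) T ((partial t p ^^ q) f)) / ereal (b - real q))
    = dcoord j (polyh t W p F)"
proof -
  define w :: "'n \<Rightarrow> nat" where "w i = (if i = j then 1 else 0)" for i
  have "w i * x = (if i = j then x else 0)" "real (w i) * y = (if i = j then y else 0)" for i x y by (simp_all add: w_def)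
  hence w: "(\<Sum>i\<in>- insert p W. w i * x i) = x j" "(\<Sum>i\<in>- insert p W. real (w i) * y i) = y j" for x y
    using j by (simp_all add: sum.delta)
  have val: "enat k \<le> ord_along (ideal_of (t ` insert p W)) T h
      \<longleftrightarrow> (\<forall>m\<in>supp t (insert p W) h. k \<le> (\<Sum>i\<in>- insert p W. w i * lookup m i))" for k h
    unfolding w by (rule ord_along_le[OF rsp sub])
  show ?thesis
    unfolding dcoord_def INF_coefficients[OF rsp p val]
    using INF_polyh[OF rsp p, of "\<lambda>i. real (w i)" F] by (simp add: w)
qed

section \<open>The Tschirnhausen transformation\<close>

lemma partial_ideal:
  fixes t :: "'n::finite \<Rightarrow> ('k::field, 'n) mfps"
  assumes rsp: "rsp t" and p: "p \<notin> W" and "x \<in> ideal_of (t ` W)"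
  shows "partial t p x \<in> ideal_of (t ` W)"
proof -
  have "keys (m + single p 1) \<inter> W = {}" if "keys m \<inter> W = {}" for m :: "'n \<Rightarrow>\<^sub>0 nat"
    using that p unfolding keys_add_nat by simp
  thus ?thesis
    using assms(3) by (auto simp: ideal_tc[OF rsp] supp_def tc_partial[OF rsp])
qed

text \<open>Exchange: when \<open>g\<close> is written through \<open>t\<close>, the coefficient of
  \<open>t p\<close> is a unit, so \<open>t p\<close> can be solved for.\<close>

lemma rsp_replace:
  fixes t :: "'n::finite \<Rightarrow> ('k::field, 'n) mfps"
  assumes rsp: "rsp t" and g: "g \<in> maxid" "tc t g (single p 1) \<noteq> 0"
  shows "rsp (t(p := g))"
proof -
  let ?s = "t(p := g)"
  have "g \<in> ideal_of (t ` UNIV)" using g rsp by (simp add: rsp_def)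
  then obtain c where c: "g = (\<Sum>i\<in>UNIV. c i * t i)" using ideal_of_image_sum by blast
  have "tc t (c i * t i) (single p 1) = (if i = p then tc t (c p) 0 else 0)" for i
    unfolding mult.commute[of "c i"] tc_param_mult[OF rsp] by (auto simp: lookup_single when_def)
  hence "tc t g (single p 1) = tc t (c p) 0" unfolding c tc_sum[OF rsp] by simp
  hence "c p \<notin> maxid" using g(2) by (simp add: maxid_tc[OF rsp])
  then obtain c' where c': "c p * c' = 1" using is_unit_mfps by blast
  have s: "?s i \<in> ideal_of (range ?s)" for i by (rule ideal.span_base) (rule rangeI)
  have "g = c p * t p + (\<Sum>i\<in>UNIV - {p}. c i * t i)"
    unfolding c by (rule sum.remove) auto
  also have "(\<Sum>i\<in>UNIV - {p}. c i * t i) = (\<Sum>i\<in>UNIV - {p}. c i * ?s i)" by (intro sum.cong) auto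
  finally have g': "g = c p * t p + (\<Sum>i\<in>UNIV - {p}. c i * ?s i)" .
  have "c' * (g - (\<Sum>i\<in>UNIV - {p}. c i * ?s i)) = (c p * c') * t p"
    by (subst g') (simp add: algebra_simps)
  hence tp: "t p = c' * (?s p - (\<Sum>i\<in>UNIV - {p}. c i * ?s i))" using c' by simp
  have "t p \<in> ideal_of (range ?s)"
    unfolding tp using s by (intro ideal.span_scale ideal.span_diff ideal.span_sum)
  hence "t i \<in> ideal_of (range ?s)" for i using s[of i] by (cases "i = p") auto
  hence "ideal_of (range t) \<subseteq> ideal_of (range ?s)" by (intro ideal.span_minimal ideal.subspace_span) auto
  moreover have "ideal_of (range ?s) \<subseteq> maxid"
    unfolding maxid_van
  proof (rule ideal.span_minimal[OF _ is_ideal_van])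
    show "range ?s \<subseteq> van 1" using rsp_maxid[OF rsp] g(1) by (auto simp: maxid_van)
  qed
  ultimately show ?thesis using rsp by (auto simp: rsp_def)
qed

lemma monom_val_cong: "(\<And>i. i \<in> keys m \<Longrightarrow> t i = t' i) \<Longrightarrow> monom_val t m = monom_val t' m"
  unfolding monom_val_def by (intro prod.cong refl) (metis in_keys_iff power_0)

text \<open>An implicit function argument: \<eta> is found by rewriting \<open>t p\<close> in the
  system where the derivative \<open>g\<close> replaces \<open>t p\<close>, and dropping all terms
  with \<open>g\<close>. As \<eta> is free of \<open>t p\<close>, the parameter
  \<open>t p - \<eta>\<close> has the same partial derivative, and \<open>g\<close> is a unit times
  it.\<close>

lemma tschirnhausen:
  fixes t :: "'n::finite \<Rightarrow> ('k::field_char_0, 'n) mfps"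
  assumes rsp: "rsp t" and b: "0 < b"
    and f: "tc t f (single p b) \<noteq> 0" "tc t f (single p (b - 1)) = 0"
  shows "\<exists>s. rsp s \<and> (\<forall>i. i \<noteq> p \<longrightarrow> s i = t i)
    \<and> tc s ((partial s p ^^ (b - 1)) f) (single p 1) \<noteq> 0
    \<and> (\<forall>m. lookup m p = 0 \<longrightarrow> tc s ((partial s p ^^ (b - 1)) f) m = 0)"
proof -
  let ?D = "partial t p"
  define g where "g = (?D ^^ (b - 1)) f"
  have D: "derivation ?D" by (rule derivation_partial[OF rsp])
  obtain c where "tc t g 0 = c * tc t f (0 + single p (b - 1))"
    using tc_partial_power[OF rsp] unfolding g_def by blast
  hence g0: "g \<in> maxid" using f(2) by (simp add: maxid_tc[OF rsp])
  obtain c where c: "c \<noteq> 0" "tc t g (single p 1) = c * tc t f (single p 1 + single p (b - 1))"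
    using tc_partial_power[OF rsp] unfolding g_def by blast
  have "single p 1 + single p (b - 1) = single p b" using b by (simp flip: single_add)
  hence "tc t g (single p 1) \<noteq> 0" using c f(1) by simp
  hence rspr: "rsp (t(p := g))" by (rule rsp_replace[OF rsp g0])
  define r where "r = t(p := g)"
  have rr: "rsp r" using rspr by (simp add: r_def)
  text \<open>\<open>t\<^sub>p - \<eta>\<close> is a multiple of \<open>g\<close>, where \<open>\<eta>\<close> does not involve \<open>t\<^sub>p\<close>.\<close>
  define \<eta> where "\<eta> = substitute r (Mfps (\<lambda>m. if lookup m p = 0 then tc r (t p) m else 0))"
  have \<eta>: "tc r \<eta> m = (if lookup m p = 0 then tc r (t p) m else 0)" for m
    by (simp add: \<eta>_def tc_substitute[OF rr])
  have "t p - \<eta> \<in> ideal_of (r ` {p})"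
    unfolding ideal_tc[OF rr] by (auto simp: supp_def tc_diff[OF rr] \<eta> in_keys_iff)
  from ideal_of_image_sum[OF this] obtain a where a: "t p - \<eta> = a * g" by (auto simp: r_def)
  \<comment> \<open>The systems \<open>r\<close> and \<open>t\<close> differ only at
    \<open>p\<close>, so \<eta> is a series in the other \<open>t i\<close>, which \<open>?D\<close>
    kills.\<close>
  have D\<eta>: "?D \<eta> = 0"
  proof (rule van_eqI)
    fix N
    define P where "P = (\<Sum>m | mdeg m < Suc N. Const (tc r \<eta> m) * monom_val r m)"
    have "?D (Const (tc r \<eta> m) * monom_val r m) = 0" for m
    proof (cases "lookup m p = 0")
      case True
      have "monom_val r m = monom_val t m"
        using True by (intro monom_val_cong) (auto simp: r_def in_keys_iff)
      moreover have "?D (monom_val t m) = 0"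
      proof (rule tc_eqI[OF rsp])
        fix k
        have "k + single p 1 \<noteq> m" using True by (auto simp: lookup_add)
        thus "tc t (?D (monom_val t m)) k = tc t 0 k"
          by (simp add: tc_partial[OF rsp] tc_monom_val[OF rsp] tc_zero[OF rsp])
      qed
      ultimately show ?thesis by (simp add: derivationD(8)[OF D])
    qed (simp add: \<eta> derivationD(4)[OF D])
    hence "?D P = 0" unfolding P_def derivationD(7)[OF D] by simp
    moreover have "?D (\<eta> - P) \<in> van N"
      unfolding P_def by (rule derivation_van[OF D truncation_tc[OF rr]])
    ultimately show "?D \<eta> - 0 \<in> van N" by (simp add: derivationD(6)[OF D])
  qed
  have ag: "a * g \<in> maxid" using g0 unfolding maxid_van by (rule van_scale)
  have "tc t (?D \<eta>) 0 = of_nat (lookup 0 p + 1) * tc t \<eta> (0 + single p 1)" by (rule tc_partial[OF rsp])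
  hence "tc t \<eta> (single p 1) = 0" unfolding D\<eta> by (simp add: tc_zero[OF rsp])
  \<comment> \<open>The linear coefficient 1 makes \<open>a * g\<close> a parameter; it also forces
    \<open>a\<close> to be a unit, since otherwise \<open>a * g\<close> would have order at least
    2.\<close>
  hence one: "tc t (a * g) (single p 1) = 1"
    unfolding a[symmetric] by (simp add: tc_diff[OF rsp] tc_param[OF rsp])
  define s where "s = t(p := a * g)"
  have s: "rsp s" unfolding s_def by (rule rsp_replace[OF rsp ag]) (simp only: one one_neq_zero not_False_eq_True)
  have "partial s p = ?D"
  proof (rule partial_unique[OF s D])
    fix j
    show "?D (s j) = (if j = p then 1 else 0)"
      using partial_param[OF rsp, of p] by (simp add: s_def a[symmetric] derivationD(6)[OF D] D\<eta>)
  qed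
  hence G: "(partial s p ^^ (b - 1)) f = g" by (simp add: g_def)
  have "a \<notin> maxid"
  proof
    assume "a \<in> maxid"
    hence "a * g \<in> van (1 + 1)" using g0 unfolding maxid_van by (rule van_mult)
    hence "tc t (a * g) (single p 1) = 0" unfolding van_tc[OF rsp] by simp
    with one show False by simp
  qed
  then obtain a' where a': "a * a' = 1" "a' \<notin> maxid" using is_unit_mfps by blast
  have "s p * a' = (a * a') * g" by (simp add: s_def ac_simps)
  hence gs: "g = s p * a'" using a' by simp
  have "tc s g m = (if lookup m p \<noteq> 0 then tc s a' (m - single p 1) else 0)" for m
    unfolding gs by (rule tc_param_mult[OF s])
  moreover have "tc s a' 0 \<noteq> 0" using a'(2) by (simp add: maxid_tc[OF s])
  ultimately show ?thesis using s unfolding G[symmetric]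
    by (intro exI[of _ s]) (auto simp: s_def G)
qed

section \<open>The polyhedron of a hypersurface of maximal contact\<close>

lemma contact_Fil_change:
  fixes t t' :: "'n::finite \<Rightarrow> ('k::field, 'n) mfps"
  assumes rsp: "rsp t" and rsp': "rsp t'" and p: "p \<notin> W" and off: "\<And>i. i \<noteq> p \<Longrightarrow> t' i = t i"
    and w: "\<And>i. 0 < w i" "0 < \<delta>" and tp: "t' p \<in> Fil t W (w(p := \<delta>)) \<delta>"
    and f: "f \<in> Fil t' W (w(p := \<delta>)) \<gamma>"
  shows "f \<in> Fil t W (w(p := \<delta>)) \<gamma>"
proof (rule Fil_change[OF rsp _ rsp' _ _ f])
  show "0 < (w(p := \<delta>)) i" for i using w by simp
  show "t' i \<in> ideal_of (t ` W)" if "i \<in> W" for i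
    using off[of i] that p by (auto intro: ideal.span_base)
  show "t' i \<in> Fil t W (w(p := \<delta>)) ((w(p := \<delta>)) i)" if "i \<notin> W" for i
    using off[of i] tp Fil_param[OF rsp, of i W "w(p := \<delta>)"] by (cases "i = p") auto
qed

text \<open>A half-space containing the polyhedron of \<open>t'\<close> provides weights
  \<open>(w, \<delta>)\<close>. If \<open>t' p\<close> has weight at least \<delta> in terms of
  \<open>t\<close>, the same half-space contains the polyhedron of \<open>t\<close>, so a point
  outside the former polyhedron is outside the latter.\<close>

lemma polyh_separate_subset:
  fixes t t' :: "'n::finite \<Rightarrow> ('k::field, 'n) mfps"
  assumes rsp: "rsp t" and rsp': "rsp t'" and p: "p \<notin> W" and off: "\<And>i. i \<noteq> p \<Longrightarrow> t' i = t i"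
    and contact: "\<And>w \<delta>. (\<And>i. 0 < w i) \<Longrightarrow> 0 < \<delta> \<Longrightarrow> \<forall>(f, b)\<in>F. f \<in> Fil t' W (w(p := \<delta>)) (b * \<delta>) \<Longrightarrow>
      t' p \<in> Fil t W (w(p := \<delta>)) \<delta>"
  shows "polyh t W p F \<subseteq> polyh t' W p F"
proof (rule polyh_subset[OF rsp p closed_convex_polyh[OF rsp' p]])
  fix f b m v
  assume m: "(f, b) \<in> F" "m \<in> vertices t W p f b"
    and v: "\<And>i. i \<in> - insert p W \<Longrightarrow> real (lookup m i) / (b - real (lookup m p)) \<le> v $ i"
      "\<And>i. i \<in> insert p W \<Longrightarrow> v $ i = 0"
  show "v \<in> polyh t' W p F"
  proof (rule ccontr)
    assume nv: "v \<notin> polyh t' W p F"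
    have v0: "0 \<le> v $ i" for i
    proof (cases "i \<in> insert p W")
      case False
      have "0 \<le> real (lookup m i) / (b - real (lookup m p))" using m(2) by (simp add: vertices_def)
      also have "\<dots> \<le> v $ i" using v(1) False by simp
      finally show ?thesis .
    qed (use v(2) in simp)
    obtain w \<delta> where w: "\<And>i. 0 < w i" "0 < \<delta>" "(\<Sum>i\<in>- insert p W. w i * v $ i) < \<delta>"
        "\<forall>(f, b)\<in>F. f \<in> Fil t' W (w(p := \<delta>)) (b * \<delta>)"
      using polyh_separate[OF rsp' p nv v0 v(2)] by blast
    have "f \<in> Fil t' W (w(p := \<delta>)) (b * \<delta>)" using w(4) m(1) by auto
    hence "f \<in> Fil t W (w(p := \<delta>)) (b * \<delta>)"
      using off by (intro contact_Fil_change[OF rsp rsp' p _ w(1,2) contact[OF w(1,2,4)]])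
    hence "\<delta> \<le> (\<Sum>i\<in>- insert p W. w i * (real (lookup m i) / (b - real (lookup m p))))"
      unfolding Fil_iff_vertices[OF rsp p w(1,2)] by (rule bspec[OF _ m(2)])
    also have "\<dots> \<le> (\<Sum>i\<in>- insert p W. w i * v $ i)"
      using v(1) w(1) by (intro sum_mono mult_left_mono) (auto simp: less_imp_le)
    finally show False using w(3) by simp
  qed
qed

section \<open>Exponents of lowest weight and points common to all polyhedra\<close>

lemma wt_one_upd: "wt ((\<lambda>_. 1)(p := \<theta>)) m = real (mdeg m) - (1 - \<theta>) * real (lookup m p)"
proof -
  have "wt ((\<lambda>_. 1)(p := 1)) m = real (mdeg m)" by (simp add: wt_def mdeg_def fun_upd_idem)
  thus ?thesis unfolding wt_upd[of "\<lambda>_. 1" p \<theta>] wt_upd[of "\<lambda>_. 1" p 1] by (simp add: algebra_simps)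
qed

lemma sum_lookup_off:
  fixes m :: "'n::finite \<Rightarrow>\<^sub>0 nat"
  assumes "keys m \<inter> W = {}" "p \<notin> W"
  shows "(\<Sum>i\<in>- insert p W. real (lookup m i)) = real (mdeg m) - real (lookup m p)"
proof -
  have "(\<Sum>i\<in>- insert p W. real (lookup m i)) = (\<Sum>i\<in>UNIV - {p}. real (lookup m i))"
    using assms by (intro sum.mono_neutral_left) (auto simp: in_keys_iff)
  also have "\<dots> = real (mdeg m) - real (lookup m p)"
    unfolding mdeg_def of_nat_sum by (subst sum.remove[of UNIV p]) auto
  finally show ?thesis .
qed

text \<open>By \<open>small_weight_stable\<close> such an exponent satisfies every inequality valid
  on the polyhedron of \<open>t'\<close>, so no hyperplane can separate its point.\<close>

lemma stable_vertex_mem: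
  fixes t t' :: "'n::finite \<Rightarrow> ('k::field, 'n) mfps"
  assumes rsp: "rsp t" and rsp': "rsp t'" and p: "p \<notin> W" and off: "\<And>i. i \<noteq> p \<Longrightarrow> t' i = t i"
    and m: "(f, b) \<in> F" "m \<in> vertices t W p f b" and \<theta>: "0 < \<theta>" "\<theta> < 1"
    and min: "\<And>m'. m' \<in> supp t W f \<Longrightarrow> wt ((\<lambda>_. 1)(p := \<theta>)) m \<le> wt ((\<lambda>_. 1)(p := \<theta>)) m'"
  shows "(\<chi> i. if i \<in> - insert p W then real (lookup m i) / (b - real (lookup m p)) else 0) \<in> polyh t' W p F"
    (is "?v \<in> _")
proof (rule ccontr)
  assume nv: "?v \<notin> polyh t' W p F"
  have bm: "real (lookup m p) < b" and ms: "m \<in> supp t W f" using m(2) by (auto simp: vertices_def)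
  have v0: "0 \<le> ?v $ i" for i using bm by simp
  have v1: "?v $ i = 0" if "i \<in> insert p W" for i using that by auto
  obtain w \<delta> where w: "\<And>i. 0 < w i" "0 < \<delta>" "(\<Sum>i\<in>- insert p W. w i * ?v $ i) < \<delta>"
      "\<forall>(f, b)\<in>F. f \<in> Fil t' W (w(p := \<delta>)) (b * \<delta>)"
    using polyh_separate[OF rsp' p nv v0 v1] by blast
  have "f \<in> Fil t' W (w(p := \<delta>)) (b * \<delta>)" using w(4) m(1) by auto
  hence le: "b * \<delta> \<le> wt (w(p := \<delta>)) m"
    using off min by (intro small_weight_stable[OF rsp rsp' p _ w(1) \<theta> w(2) _ ms])
  have wt: "wt (w(p := \<delta>)) m = (\<Sum>i\<in>- insert p W. w i * real (lookup m i)) + \<delta> * real (lookup m p)"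
    using ms by (intro wt_split[OF rsp p]) (simp add: supp_def)
  have "(\<Sum>i\<in>- insert p W. w i * ?v $ i)
      = (\<Sum>i\<in>- insert p W. w i * real (lookup m i)) / (b - real (lookup m p))"
    by (simp add: sum_divide_distrib)
  hence "(\<Sum>i\<in>- insert p W. w i * real (lookup m i)) < \<delta> * (b - real (lookup m p))"
    using w(3) bm by (simp add: pos_divide_less_eq)
  thus False using le unfolding wt by (simp add: algebra_simps)
qed

text \<open>\<open>D\<close> is to be the partial derivative in the Weierstrass coordinates. The
  assumptions \<open>G\<close> say that \<open>D^(b-1) f\<close> is a unit times \<open>t p\<close>
  modulo the \<open>t i\<close> with \<open>i\<close> in \<open>W\<close>; nothing is assumed about
  how \<open>D\<close> acts on the \<open>u_i\<close>.\<close>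

theorem delta_maximal_contact:
  fixes t :: "'n::finite \<Rightarrow> ('k::field_char_0, 'n) mfps"
  assumes rsp: "rsp t" and p: "p \<notin> W" and f: "(f, real b) \<in> F" and b: "0 < b"
    and ord: "\<And>m. m \<in> supp t W f \<Longrightarrow> b \<le> mdeg m" "\<exists>m\<in>supp t W f. mdeg m = b"
    and D: "derivation D" and DW: "\<And>x. x \<in> ideal_of (t ` W) \<Longrightarrow> D x \<in> ideal_of (t ` W)"
    and G: "tc t ((D ^^ (b - 1)) f) (single p 1) \<noteq> 0"
      "\<And>m. keys m \<inter> W = {} \<Longrightarrow> lookup m p = 0 \<Longrightarrow> tc t ((D ^^ (b - 1)) f) m = 0"
  shows "delta (- insert p W) (\<Inter>t'\<in>{t'. rsp t' \<and> (\<forall>i. i \<noteq> p \<longrightarrow> t' i = t i)}. polyh t' W p F)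
    = delta (- insert p W) (polyh t W p F)" (is "delta ?U ?M = _")
proof (rule antisym)
  show "delta ?U (polyh t W p F) \<le> delta ?U ?M"
    unfolding delta_def by (rule INF_superset_mono) (use rsp in auto)
  have INF: "delta ?U (polyh s W p F) = (INF (f, b)\<in>F. INF m\<in>vertices s W p f b.
      ereal (\<Sum>i\<in>?U. 1 * (real (lookup m i) / (b - real (lookup m p)))))" if "rsp s" for s
    unfolding delta_def using INF_polyh[OF that p, of "\<lambda>_. 1" F] by simp
  have stable: "delta ?U ?M \<le> ereal ((real (mdeg m) - real (lookup m p)) / (c - real (lookup m p)))"
    if m: "(g, c) \<in> F" "m \<in> vertices t W p g c" and \<theta>: "0 < \<theta>" "\<theta> < 1"
      and min: "\<And>m'. m' \<in> supp t W g \<Longrightarrow> wt ((\<lambda>_. 1)(p := \<theta>)) m \<le> wt ((\<lambda>_. 1)(p := \<theta>)) m'" for g c m \<theta>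
  proof -
    let ?v = "\<chi> i. if i \<in> ?U then real (lookup m i) / (c - real (lookup m p)) else 0"
    have "?v \<in> ?M" using stable_vertex_mem[OF rsp _ p _ m \<theta> min] by blast
    hence "delta ?U ?M \<le> ereal (\<Sum>i\<in>?U. ?v $ i)" unfolding delta_def by (rule INF_lower)
    also have "(\<Sum>i\<in>?U. ?v $ i) = (\<Sum>i\<in>?U. real (lookup m i)) / (c - real (lookup m p))"
      by (simp add: sum_divide_distrib)
    also have "\<dots> = (real (mdeg m) - real (lookup m p)) / (c - real (lookup m p))"
      using m(2) by (subst sum_lookup_off[OF _ p]) (auto simp: vertices_def supp_def)
    finally show ?thesis .
  qed
  show "delta ?U ?M \<le> delta ?U (polyh t W p F)"
  proof (cases "single p b \<in> supp t W f")
    case True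
    have "single p (b - 1) \<notin> supp t W f" using ord(1)[of "single p (b - 1)"] b by auto
    hence "tc t f (single p (b - 1)) = 0" using p by (auto simp: supp_def split: if_splits)
    then obtain s where s: "rsp s" "\<And>i. i \<noteq> p \<Longrightarrow> s i = t i"
        "tc s ((partial s p ^^ (b - 1)) f) (single p 1) \<noteq> 0"
        "\<And>m. lookup m p = 0 \<Longrightarrow> tc s ((partial s p ^^ (b - 1)) f) m = 0"
      using tschirnhausen[OF rsp b, of f p] True by (auto simp: supp_def)
    have "polyh s W p F \<subseteq> polyh t' W p F" if t': "rsp t'" "\<forall>i. i \<noteq> p \<longrightarrow> t' i = t i" for t'
    proof (rule polyh_separate_subset[OF s(1) t'(1) p])
      show off: "t' i = s i" if "i \<noteq> p" for i using s(2) t'(2) that by simp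
      fix w :: "'n \<Rightarrow> real" and \<delta> :: real
      assume w: "\<And>i. 0 < w i" and \<delta>: "0 < \<delta>" and Fil: "\<forall>(f, b)\<in>F. f \<in> Fil t' W (w(p := \<delta>)) (b * \<delta>)"
      have fF: "f \<in> Fil t' W (w(p := \<delta>)) (real b * \<delta>)" using bspec[OF Fil f] by simp
      show "t' p \<in> Fil s W (w(p := \<delta>)) \<delta>"
      proof (rule contact_optimal[OF s(1) t'(1) p off w derivation_partial[OF s(1)] partial_ideal[OF s(1) p]
            _ b s(3) s(4) \<delta> fF])
        \<comment> \<open>In the system \<open>s\<close> the derivation kills all \<open>s i\<close>
          with \<open>i \<noteq> p\<close>, so the condition on weights holds for arbitrary
          \<open>w\<close>, that is, for all half-spaces.\<close>
        fix m i assume m: "m \<noteq> (0 :: 'n \<Rightarrow>\<^sub>0 nat)" "lookup m p = 0"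
        have "0 < wt w m" using w m(1) by (rule wt_positive)
        hence pos: "0 < (w(p := wt w m)) i" for i using w by simp
        show "partial s p (s i) \<in> Fil s W (w(p := wt w m)) ((w(p := wt w m)) i - wt w m)"
        proof (cases "i = p")
          case True
          show ?thesis by (rule Fil_nonpos[OF s(1) pos]) (simp add: True)
        qed (simp add: partial_param[OF s(1)] Fil_zero[OF s(1)])
      qed
    qed
    hence "delta ?U ?M \<le> delta ?U (polyh s W p F)"
      unfolding delta_def by (intro INF_superset_mono) auto
    also have "delta ?U (polyh s W p F) \<le> delta ?U (polyh t W p F)"
      unfolding INF[OF rsp]
    proof (intro INF_greatest, clarify, intro INF_greatest, rule ccontr)
      fix g c m assume m: "(g, c) \<in> F" "m \<in> vertices t W p g c"
      let ?x = "\<Sum>i\<in>?U. 1 * (real (lookup m i) / (c - real (lookup m p)))"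
      assume "\<not> delta ?U (polyh s W p F) \<le> ereal ?x"
      hence lt: "ereal ?x < delta ?U (polyh s W p F)" by (simp only: not_le)
      obtain \<delta> where \<delta>: "ereal ?x < ereal \<delta>" "ereal \<delta> < delta ?U (polyh s W p F)"
        using ereal_dense2[OF lt] by blast
      have "0 \<le> ?x" using m(2) by (intro sum_nonneg) (simp add: vertices_def)
      hence \<delta>0: "0 < \<delta>" using \<delta>(1) by simp
      define w :: "'n \<Rightarrow> real" where "w = (\<lambda>_. 1)"
      have w: "0 < w i" for i by (simp add: w_def)
      have Fil: "h \<in> Fil s W (w(p := \<delta>)) (e * \<delta>)" if h: "(h, e) \<in> F" for h e
        unfolding Fil_iff_vertices[OF s(1) p w \<delta>0]
      proof
        fix k assume k: "k \<in> vertices s W p h e"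
        have "delta ?U (polyh s W p F) \<le> ereal (\<Sum>i\<in>?U. 1 * (real (lookup k i) / (e - real (lookup k p))))"
          unfolding INF[OF s(1)] by (rule INF_lower2[OF h]) (simp only: prod.case, rule INF_lower[OF k])
        hence "ereal \<delta> \<le> ereal (\<Sum>i\<in>?U. 1 * (real (lookup k i) / (e - real (lookup k p))))"
          using \<delta>(2) by (meson less_imp_le order_trans)
        thus "\<delta> \<le> (\<Sum>i\<in>?U. w i * (real (lookup k i) / (e - real (lookup k p))))" by (simp add: w_def)
      qed
      have sp: "s p \<in> Fil t W (w(p := \<delta>)) \<delta>"
      proof (rule contact_optimal[OF rsp s(1) p s(2) w D DW _ b G \<delta>0 Fil[OF f]])
        \<comment> \<open>Here \<open>D (t i)\<close> may be a unit. With all weights equal to 1 the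
          weight demanded of it is at most 0.\<close>
        fix m i assume m: "m \<noteq> (0 :: 'n \<Rightarrow>\<^sub>0 nat)" "lookup m p = 0"
        have "1 \<le> mdeg m" using m(1) by (metis less_one mdeg_eq_0_iff not_less)
        moreover have "real (mdeg m) \<le> wt w m" using wt_lower[of 1 w m] by (simp add: w_def)
        ultimately have one: "1 \<le> wt w m" by linarith
        have pos: "0 < (w(p := wt w m)) i" for i using one by (simp add: w_def)
        show "D (t i) \<in> Fil t W (w(p := wt w m)) ((w(p := wt w m)) i - wt w m)"
          by (rule Fil_nonpos[OF rsp pos]) (use one in \<open>simp add: w_def\<close>)
      qed
      have "g \<in> Fil t W (w(p := \<delta>)) (c * \<delta>)"
        by (rule contact_Fil_change[OF rsp s(1) p _ w \<delta>0 sp Fil[OF m(1)]]) (rule s(2))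
      hence "\<delta> \<le> (\<Sum>i\<in>?U. w i * (real (lookup m i) / (c - real (lookup m p))))"
        unfolding Fil_iff_vertices[OF rsp p w \<delta>0] by (rule bspec[OF _ m(2)])
      thus False using \<delta>(1) by (simp add: w_def)
    qed
    finally show ?thesis .
  next
    case False
    have small: "delta ?U ?M \<le> 1"
    proof -
      \<comment> \<open>Large enough for every monomial of degree above \<open>b\<close> to weigh at
        least \<open>b\<close>, a weight that monomials of degree \<open>b\<close> do not
        exceed.\<close>
      define \<theta> where "\<theta> = real b / (real b + 1)"
      have \<theta>: "0 < \<theta>" "\<theta> < 1" "\<theta> * (real b + 1) = real b" using b by (auto simp: \<theta>_def)
      \<comment> \<open>Among the monomials of degree \<open>b\<close> the lightest have the most
        factors \<open>t p\<close>. As \<open>y^b\<close> is absent, these are fewer than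
        \<open>b\<close>, and the resulting point has coordinate sum
        \<open>(b - B) / (b - B) = 1\<close>.\<close>
      define S where "S = {m \<in> supp t W f. mdeg m = b}"
      have "finite S" unfolding S_def by (rule finite_subset[OF _ finite_mdeg_le[of b]]) auto
      moreover have "S \<noteq> {}" using ord(2) by (auto simp: S_def)
      ultimately have "Max ((\<lambda>m. lookup m p) ` S) \<in> (\<lambda>m. lookup m p) ` S" by (intro Max_in) auto
      then obtain A where A: "A \<in> S" "lookup A p = Max ((\<lambda>m. lookup m p) ` S)" by auto
      have Amax: "lookup m p \<le> lookup A p" if "m \<in> S" for m
        unfolding A(2) using \<open>finite S\<close> that by (intro Max_ge) auto
      have As: "A \<in> supp t W f" "mdeg A = b" using A(1) by (auto simp: S_def)
      have "lookup A p \<noteq> b"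
      proof
        assume "lookup A p = b"
        hence "mle (single p b) A" by (auto simp: mle_def lookup_single when_def)
        from mle_mdeg_eq[OF this] have "A = single p b" using As(2) by simp
        thus False using False As(1) by simp
      qed
      hence Ap: "lookup A p < b" using lookup_le_mdeg[of A p] As(2) by simp
      have min: "wt ((\<lambda>_. 1)(p := \<theta>)) A \<le> wt ((\<lambda>_. 1)(p := \<theta>)) m" if m: "m \<in> supp t W f" for m
      proof (cases "mdeg m = b")
        case True
        hence "(1 - \<theta>) * real (lookup m p) \<le> (1 - \<theta>) * real (lookup A p)"
          using Amax[of m] m \<theta> by (intro mult_left_mono) (auto simp: S_def)
        thus ?thesis unfolding wt_one_upd using True As(2) by simp
      next
        case False
        hence "b + 1 \<le> mdeg m" using ord(1)[OF m] by simp
        hence "real b + 1 \<le> real (mdeg m)" by linarith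
        hence "\<theta> * (real b + 1) \<le> \<theta> * real (mdeg m)" using \<theta>(1) by (intro mult_left_mono) auto
        hence "real b \<le> \<theta> * real (mdeg m)" using \<theta>(3) by simp
        also have "\<dots> \<le> wt ((\<lambda>_. 1)(p := \<theta>)) m"
        proof (rule wt_lower)
          show "\<theta> \<le> ((\<lambda>_. 1)(p := \<theta>)) i" for i using \<theta> by simp
        qed
        finally have "real b \<le> wt ((\<lambda>_. 1)(p := \<theta>)) m" .
        moreover have "wt ((\<lambda>_. 1)(p := \<theta>)) A \<le> real b" unfolding wt_one_upd using As(2) \<theta> by simp
        ultimately show ?thesis by linarith
      qed
      have "A \<in> vertices t W p f (real b)" using As(1) Ap by (simp add: vertices_def)
      from stable[OF f this \<theta>(1,2) min] show ?thesis
        using Ap As(2) by (simp add: one_ereal_def)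
    qed
    show ?thesis
      unfolding INF[OF rsp]
    proof (intro INF_greatest, clarify, intro INF_greatest)
      fix g c m assume m: "(g, c) \<in> F" "m \<in> vertices t W p g c"
      let ?x = "\<Sum>i\<in>?U. 1 * (real (lookup m i) / (c - real (lookup m p)))"
      have mc: "real (lookup m p) < c" and ms: "m \<in> supp t W g" using m(2) by (auto simp: vertices_def)
      have x: "?x * (c - real (lookup m p)) = real (mdeg m) - real (lookup m p)"
      proof -
        have "?x = (\<Sum>i\<in>?U. real (lookup m i)) / (c - real (lookup m p))" by (simp add: sum_divide_distrib)
        also have "(\<Sum>i\<in>?U. real (lookup m i)) = real (mdeg m) - real (lookup m p)"
          using ms by (intro sum_lookup_off[OF _ p]) (simp add: supp_def)
        finally show ?thesis using mc by simp
      qed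
      have x0: "0 \<le> ?x" using mc by (intro sum_nonneg) simp
      show "delta ?U ?M \<le> ereal ?x"
      proof (cases "?x < 1")
        case False
        hence "1 \<le> ereal ?x" by (simp add: one_ereal_def)
        with small show ?thesis by (rule order_trans)
      next
        case True
        \<comment> \<open>For \<theta> above the coordinate sum of the given point, the lightest
          monomial yields a common point of sum at most \<theta>. It need not be the given monomial,
          so the sum itself is reached only in the limit.\<close>
        have "delta ?U ?M \<le> ereal \<theta>" if \<theta>: "?x < \<theta>" "\<theta> < 1" for \<theta>
        proof -
          have \<theta>0: "0 < \<theta>" using \<theta>(1) x0 by linarith
          have pos: "0 < ((\<lambda>_. 1)(p := \<theta>)) i" for i using \<theta>0 by simp
          obtain A where A: "A \<in> supp t W g"
              "\<And>k. k \<in> supp t W g \<Longrightarrow> wt ((\<lambda>_. 1)(p := \<theta>)) A \<le> wt ((\<lambda>_. 1)(p := \<theta>)) k"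
            using wt_argmin[of "(\<lambda>_. 1)(p := \<theta>)" "supp t W g", OF pos] ms by auto
          have "?x * (c - real (lookup m p)) < \<theta> * (c - real (lookup m p))"
            using \<theta>(1) mc by (intro mult_strict_right_mono) auto
          hence "wt ((\<lambda>_. 1)(p := \<theta>)) m < \<theta> * c"
            unfolding x wt_one_upd by (simp add: algebra_simps)
          hence lt: "real (mdeg A) - real (lookup A p) + \<theta> * real (lookup A p) < \<theta> * c"
            using A(2)[OF ms] unfolding wt_one_upd by (simp add: algebra_simps)
          have "real (lookup A p) \<le> real (mdeg A)" using lookup_le_mdeg[of A p] by simp
          hence "\<theta> * real (lookup A p) < \<theta> * c" using lt by linarith
          hence Ac: "real (lookup A p) < c" using \<theta>0 by simp
          hence "(real (mdeg A) - real (lookup A p)) / (c - real (lookup A p)) \<le> \<theta>"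
            using lt by (simp add: pos_divide_le_eq algebra_simps)
          moreover have "A \<in> vertices t W p g c" using A(1) Ac by (simp add: vertices_def)
          ultimately show ?thesis using stable[OF m(1) _ \<theta>0 \<theta>(2) A(2)] by (meson ereal_less_eq(3) order_trans)
        qed
        hence large: "delta ?U ?M \<le> ereal \<theta>" if "?x < \<theta>" for \<theta>
        proof (cases "\<theta> < 1")
          case False
          have "delta ?U ?M \<le> 1" by (rule small)
          also have "1 \<le> ereal \<theta>" using False by (simp add: one_ereal_def)
          finally show ?thesis .
        qed (use that in blast)
        show ?thesis
        proof (rule ccontr)
          assume "\<not> delta ?U ?M \<le> ereal ?x"
          hence lt: "ereal ?x < delta ?U ?M" by (simp only: not_le)
          obtain \<theta> where "ereal ?x < ereal \<theta>" "ereal \<theta> < delta ?U ?M" using ereal_dense2[OF lt] by blast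
          moreover from this(1) have "delta ?U ?M \<le> ereal \<theta>" by (intro large) (simp only: less_ereal.simps)
          ultimately show False by (simp only: not_le[symmetric] simp_thms)
        qed
      qed
    qed
  qed
qed

section \<open>The entries of the invariant in terms of the polyhedron\<close>

theorem theorem1:
  fixes j r :: nat
    and A J :: "nat \<Rightarrow> ('k::field_char_0, 'n::finite) mfps set"
    and dv :: "nat \<Rightarrow> nat \<Rightarrow> ('k, 'n) mfps set"
    and \<rho> :: "nat \<Rightarrow> ('k, 'n) run"
    and I :: "('k, 'n) mfps set" and t :: "'n \<Rightarrow> ('k, 'n) mfps"
    and U Y :: "'n set" and F :: "('k, 'n) pair" and d :: "nat \<Rightarrow> ereal"
  assumes "blow_up_sequence j A J dv"
    and "J j \<noteq> UNIV"
    and "\<And>k. k \<le> j \<Longrightarrow> is_run J dv \<rho> k"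
    and "r \<in> {1..steps (\<rho> j)}"
  defines "I \<equiv> idN (\<rho> j) (r - 1)"
    and "t \<equiv> param (\<rho> j) r"
    and "U \<equiv> uix (\<rho> j) r"
    and "Y \<equiv> {idx (\<rho> j) r}"
    and "F \<equiv> pairF (\<rho> j) r"
    and "d \<equiv> exc_data I t U Y F (gens (\<rho> j))"
  shows "mu (\<rho> j) r = delta U (proj_polyhedron I t U Y F)
    \<and> nu_entry (inv_X J \<rho> j) (r + 1) = nu_hist I t U Y F (excR (\<rho> j) r) d
    \<and> nu_hist I t U Y F (excR (\<rho> j) r) d
          = delta U (proj_polyhedron I t U Y F) - (\<Sum>l\<in>excR (\<rho> j) r. d l)"
proof -
  define R where "R = \<rho> j"
  define W where "W = idx R ` {1..r - 1}"
  define p where "p = idx R r"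
  have r: "1 \<le> r" "r \<le> steps R" using assms(4) by (auto simp: R_def)
  have run: "is_run J dv \<rho> j" using assms(3) by blast
  have inj: "inj_on (idx R) {1..steps R}"
    and rsp: "rsp t"
    and param: "\<And>i. i \<in> {1..r} \<Longrightarrow> t (idx R i) = yy R i"
    and contact: "contact_step R r"
    and adapted: "adapted (idN R r) t (uix R r) (gens R) (excR R r)"
    using run assms(4) unfolding is_run_def R_def t_def by auto
  have ivl: "{1..r} = insert r {1..r - 1}" using r by auto
  have p: "p \<notin> W"
  proof
    assume "p \<in> W"
    then obtain i where i: "i \<in> {1..r - 1}" "idx R r = idx R i" by (auto simp: W_def p_def)
    hence "r = i" using inj r by (intro inj_onD[OF inj]) auto
    thus False using i r by auto
  qed
  have U: "U = - insert p W" unfolding U_def uix_def R_def[symmetric] ivl by (simp add: W_def p_def)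
  have Y: "Y = {p}" by (simp add: Y_def p_def R_def)
  have yW: "yy R ` {1..r - 1} = t ` W"
    unfolding W_def image_image using param by (intro image_cong) auto
  have I: "I = ideal_of (t ` W)" unfolding I_def idN_def R_def[symmetric] yW ..
  have yr: "yy R r = t p" using param[of r] r by (simp add: p_def)
  have IN: "idN R r = ideal_of (t ` insert p W)" unfolding idN_def ivl by (simp only: image_insert yr yW)
  have FR: "F = pairF R r" by (simp add: F_def R_def)
  have P: "proj_polyhedron I t U Y F = polyh t W p F" by (simp add: polyh_def I U Y)
  have minP: "min_polyhedron I t U Y F
      = (\<Inter>t'\<in>{t'. rsp t' \<and> (\<forall>i. i \<noteq> p \<longrightarrow> t' i = t i)}. polyh t' W p F)"
  proof -
    have "proj_polyhedron I t' U Y F = polyh t' W p F" if "\<forall>i. i \<noteq> p \<longrightarrow> t' i = t i" for t'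
    proof -
      have "t' ` W = t ` W" using that p by (intro image_cong) auto
      thus ?thesis by (simp add: polyh_def I U Y)
    qed
    thus ?thesis unfolding min_polyhedron_def Y by (intro INF_cong) auto
  qed
  have mu: "mu R r = delta U (polyh t W p F)"
    unfolding U mu_delta[OF rsp p, symmetric] mu_def IN FR hcoef_def by (simp add: t_def R_def p_def)

  have delta_min: "delta U (min_polyhedron I t U Y F) = delta U (polyh t W p F)"
  proof -
    \<comment> \<open>The last obtained variable is the set of remaining components of
      \<open>pairF R r\<close>, not the family of Weierstrass coefficients.\<close>
    obtain f0 f b \<epsilon> v \<phi> where c: "0 < b" "ord_mod I f0 = enat b" "rsp v" "\<forall>i\<in>{1..<r}. v (idx R i) = yy R i"
        "\<epsilon> \<notin> maxid" "f - \<epsilon> * f0 \<in> I" "pairF R r = insert (f, real b) \<phi>"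
        "yy R r - Const (1 / fact b) * (partial v p ^^ (b - 1)) f \<in> I"
      using contact unfolding contact_step_def Let_def I_def R_def[symmetric] p_def[symmetric] by blast
    have s0: "b \<le> mdeg m" if "m \<in> supp t W f0" for m
      using c(2) ord_mod_le[OF rsp, of b W f0] that by (simp add: I)
    have "\<not> enat (Suc b) \<le> ord_mod I f0" using c(2) by simp
    then obtain m0 where m0: "m0 \<in> supp t W f0" "\<not> Suc b \<le> mdeg m0"
      unfolding I ord_mod_le[OF rsp] by blast
    hence m0b: "mdeg m0 = b" using s0 by force
    have tcf: "tc t f m = tc t (\<epsilon> * f0) m" if "keys m \<inter> W = {}" for m
      using c(6) that by (auto simp: I ideal_tc[OF rsp] supp_def tc_diff[OF rsp])
    hence suppf: "supp t W f = supp t W (\<epsilon> * f0)" by (auto simp: supp_def)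
    have vW: "v ` W = t ` W"
      unfolding W_def image_image using c(4) param r by (intro image_cong) auto
    let ?D = "partial v p"
    \<comment> \<open>Modulo \<open>I\<close>, the derivative is a constant multiple of
      \<open>y_r\<close>, so it has the coefficients of the single parameter \<open>t p\<close> up
      to that factor.\<close>
    have G: "tc t (t p) m = 1 / fact b * tc t ((?D ^^ (b - 1)) f) m" if "keys m \<inter> W = {}" for m
      using c(8) that unfolding yr I ideal_tc[OF rsp] by (auto simp: supp_def tc_diff[OF rsp] tc_scale[OF rsp])
    show ?thesis
      unfolding minP unfolding U
    proof (rule delta_maximal_contact[OF rsp p _ c(1)])
      show "(f, real b) \<in> F" using c(7) by (simp add: FR)
      show "b \<le> mdeg m" if m: "m \<in> supp t W f" for m
      proof -
        obtain k l where "m = k + l" "l \<in> supp t W f0" using m supp_mult[OF rsp] unfolding suppf by blast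
        thus ?thesis using s0[of l] by simp
      qed
      show "\<exists>m\<in>supp t W f. mdeg m = b"
      proof (rule bexI)
        have wt1: "wt (\<lambda>_. 1) m = real (mdeg m)" for m :: "'n \<Rightarrow>\<^sub>0 nat" by (simp add: wt_def mdeg_def)
        \<comment> \<open>The lowest part of \<open>\<epsilon> * f0\<close> is that of
          \<open>f0\<close> times the nonzero constant term of \<epsilon>, so \<open>f\<close> has
          order exactly \<open>b\<close> as well.\<close>
        have "f0 \<in> Fil t W (\<lambda>_. 1) (real b)" using s0 by (simp add: Fil_def wt1)
        hence "tc t (\<epsilon> * f0) m0 = tc t \<epsilon> 0 * tc t f0 m0"
          using m0 m0b by (intro tc_mult_initial[OF rsp, where \<tau> = "\<lambda>_. 1" and W = W and a = "real b"]) (auto simp: wt1 supp_def)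
        thus "m0 \<in> supp t W f"
          using m0(1) c(5) unfolding suppf by (simp add: supp_def maxid_tc[OF rsp])
      qed (rule m0b)
      show "derivation ?D" by (rule derivation_partial[OF c(3)])
      show "?D x \<in> ideal_of (t ` W)" if "x \<in> ideal_of (t ` W)" for x
        using partial_ideal[OF c(3) p, of x] that by (simp add: vW)
      have "tc t (t p) (single p 1) = 1" by (simp add: tc_param[OF rsp])
      thus "tc t ((?D ^^ (b - 1)) f) (single p 1) \<noteq> 0" using G[of "single p 1"] p by auto
      fix m :: "'n \<Rightarrow>\<^sub>0 nat" assume m: "keys m \<inter> W = {}" "lookup m p = 0"
      hence "m \<noteq> single p 1" by auto
      hence "tc t (t p) m = 0" by (simp add: tc_param[OF rsp])
      thus "tc t ((?D ^^ (b - 1)) f) m = 0" using G[OF m(1)] by simp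
    qed
  qed

  have muH: "muH R r l = d l" if l: "l \<in> excR R r" and fin: "mu R r \<noteq> \<infinity>" for l
  proof -
    have IN': "ideal_of (I \<union> t ` Y) = idN R r"
    proof -
      have "ideal_of (I \<union> t ` Y) = ideal_of (t ` W \<union> t ` Y)"
        unfolding I ideal.span_Un ideal.span_span ..
      thus ?thesis unfolding IN Y by (simp add: insert_commute Un_commute)
    qed
    show ?thesis
    proof (cases "gens R l \<in> idN R r")
      case True
      \<comment> \<open>The generator vanishes on \<open>N_r\<close>, where the exceptional data is
        0 by definition. The infimum is 0 too: \<mu> being finite, some coefficient is nonzero on
        \<open>N_r\<close>, and its order along a vanishing element is 0.\<close>
      have idl: "is_ideal (idN R r)" unfolding idN_def by (rule ideal.subspace_span)
      have oa: "ord_along (idN R r) (gens R l) h = 0" if "h \<notin> idN R r" for h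
      proof -
        have "{k. \<exists>g. h - gens R l ^ k * g \<in> idN R r} \<subseteq> {0}"
        proof (clarify)
          fix k g assume g: "h - gens R l ^ k * g \<in> idN R r"
          show "k = 0"
          proof (rule ccontr)
            assume "k \<noteq> 0"
            then obtain k' where "k = Suc k'" by (cases k) auto
            hence "gens R l ^ k * g = (gens R l ^ k' * g) * gens R l" by (simp add: ac_simps)
            hence "gens R l ^ k * g \<in> idN R r" using ideal.subspace_scale[OF idl True] by simp
            from ideal.subspace_add[OF idl g this] that show False by simp
          qed
        qed
        hence "Sup (enat ` {k. \<exists>g. h - gens R l ^ k * g \<in> idN R r}) \<le> 0"
          by (intro Sup_least) (auto simp: zero_enat_def)
        thus ?thesis by (simp add: ord_along_def)
      qed
      have "\<exists>f b q. (f, b) \<in> pairF R r \<and> real q < b \<and> hcoef R r f q \<notin> idN R r"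
      proof (rule ccontr)
        assume none: "\<not> (\<exists>f b q. (f, b) \<in> pairF R r \<and> real q < b \<and> hcoef R r f q \<notin> idN R r)"
        have inf: "ord_mod (idN R r) h = \<infinity>" if "h \<in> idN R r" for h
        proof -
          have "supp t (insert p W) h = {}" using that unfolding IN ideal_tc[OF rsp] .
          hence "enat k \<le> ord_mod (idN R r) h" for k
            unfolding IN ord_mod_le[OF rsp] by simp
          from this[of "Suc (the_enat (ord_mod (idN R r) h))"] show ?thesis
            by (cases "ord_mod (idN R r) h") auto
        qed
        have "\<infinity> \<le> mu R r"
          unfolding mu_def
        proof (intro INF_greatest, clarify, intro INF_greatest)
          fix f b q assume fb: "(f, b) \<in> pairF R r" "q \<in> {q. real q < b}"
          hence "hcoef R r f q \<in> idN R r" using none by blast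
          thus "\<infinity> \<le> ereal_of_enat (ord_mod (idN R r) (hcoef R r f q)) / ereal (b - real q)"
            using inf fb(2) by simp
        qed
        with fin show False by simp
      qed
      then obtain f b q where fb: "(f, b) \<in> pairF R r" "real q < b" "hcoef R r f q \<notin> idN R r" by blast
      have "muH R r l \<le> (INF q\<in>{q. real q < b}.
          ereal_of_enat (ord_along (idN R r) (gens R l) (hcoef R r f q)) / ereal (b - real q))"
        unfolding muH_def by (rule INF_lower2[OF fb(1)]) simp
      also have "\<dots> \<le> ereal_of_enat (ord_along (idN R r) (gens R l) (hcoef R r f q)) / ereal (b - real q)"
        using fb(2) by (intro INF_lower) simp
      also have "\<dots> = 0" using oa[OF fb(3)] fb(2) by simp
      finally have "muH R r l \<le> 0" .
      moreover have "0 \<le> muH R r l"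
        unfolding muH_def by (intro INF_greatest, clarify, intro INF_greatest zero_le_divide_ereal) auto
      moreover have "d l = 0" using True by (simp add: d_def exc_data_def IN' R_def[symmetric] Let_def)
      ultimately show ?thesis by (simp add: antisym)
    next
      case False
      then obtain i where i: "i \<in> - insert p W" "on_sub (ideal_of (t ` insert p W)) (gens R l) (t i)"
        using adapted l unfolding adapted_def IN U_def[unfolded R_def[symmetric], symmetric] U by blast
      \<comment> \<open>Distinct parameters generate distinct ideals on \<open>N_r\<close>, which
        determines the index chosen by \<open>THE\<close>.\<close>
      have the: "(THE i. i \<in> U \<and> on_sub (idN R r) (gens R l) (t i)) = i"
      proof (rule the_equality)
        show "i \<in> U \<and> on_sub (idN R r) (gens R l) (t i)" using i by (simp add: U IN)
        fix k assume k: "k \<in> U \<and> on_sub (idN R r) (gens R l) (t k)"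
        show "k = i"
        proof (rule ccontr)
          assume ne: "k \<noteq> i"
          have "on_sub (idN R r) (t k) (t i)" using k i(2) by (simp add: on_sub_def IN)
          then obtain a where "t k - a * t i \<in> ideal_of (idN R r)" using on_sub_multiple by blast
          hence "t k - t i * a \<in> ideal_of (t ` insert p W)" unfolding IN by (simp add: ideal.span_span mult.commute)
          hence "supp t (insert p W) (t k - t i * a) = {}" unfolding ideal_tc[OF rsp] .
          moreover have "keys (single k (1 :: nat)) \<inter> insert p W = {}" using k by (simp add: U)
          ultimately have "tc t (t k - t i * a) (single k 1) = 0" unfolding supp_def by blast
          moreover have "tc t (t i * a) (single k 1) = 0"
            unfolding tc_param_mult[OF rsp] using ne by (simp add: lookup_single when_def)
          ultimately show False by (simp add: tc_diff[OF rsp] tc_param[OF rsp])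
        qed
      qed
      have "d l = dcoord i (polyh t W p F)"
        using False the by (simp add: d_def exc_data_def IN' R_def[symmetric] Let_def P)
      also have "\<dots> = muH R r l"
        unfolding muH_dcoord[OF rsp p i, symmetric] muH_def IN FR hcoef_def by (simp add: t_def R_def p_def)
      finally show ?thesis ..
    qed
  qed

  have hist: "nu_hist I t U Y F (excR R r) d = delta U (polyh t W p F) - (\<Sum>l\<in>excR R r. d l)"
  proof (cases "polyh t W p F = {}")
    case True
    \<comment> \<open>The infimum over the empty set is \<infinity>, and in \<open>ereal\<close>
      subtracting anything leaves it \<infinity>.\<close>
    hence "delta U (polyh t W p F) = \<infinity>" by (simp add: delta_def top_ereal_def)
    thus ?thesis using True by (simp add: nu_hist_def Let_def P)
  next
    case False
    \<comment> \<open>By \<open>delta_min\<close> both branches of the condition on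
      \<open>e'\<close> have the same value.\<close>
    thus ?thesis by (simp add: nu_hist_def Let_def P delta_min)
  qed
  have nu: "nu R r = delta U (polyh t W p F) - (\<Sum>l\<in>excR R r. d l)"
  proof (cases "mu R r = \<infinity>")
    case True
    \<comment> \<open>The \<open>muH\<close> and the exceptional data are compared only for finite
      \<mu>; here \<infinity> absorbs the sum.\<close>
    thus ?thesis by (simp add: nu_def flip: mu)
  next
    case False
    thus ?thesis using muH by (simp add: nu_def mu)
  qed
  have entry: "nu_entry (inv_X J \<rho> j) (r + 1) = nu R r"
  proof -
    \<comment> \<open>The list starts with the pair of \<open>s_1\<close> and
      \<open>\<nu>_2\<close>, so \<open>nu_entry\<close> subtracts 2 and entry \<open>r + 1\<close>
      sits at position \<open>r - 1\<close>.\<close>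
    have "[1..<Suc (steps R)] ! (r - 1) = r" using r by (subst nth_upt) auto
    thus ?thesis using r by (simp add: nu_entry_def inv_X_def inv_half_def R_def del: upt_Suc)
  qed
  show ?thesis
    unfolding P R_def[symmetric] using mu entry nu hist by simp
qed

end
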